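(* Let $\Phi$ be a unital commutative ring containing $\frac12$, and let $L=L_1\oplus L_0\oplus L_{-1}$ be a Jordan 3-graded Lie algebra over $\Phi$ with associated Jordan pair $V=(L_1,L_{-1})$. If $L$ satisfies an essential 3-graded polynomial identity, then the Jordan pair $V$ satisfies an essential polynomial identity.
   Context: A Lie algebra $L$ is 3-graded if $L=L_1\oplus L_0\oplus L_{-1}$ with $[L_i,L_j]\subseteq L_{i+j}$, where $L_k=0$ for $k\notin\{0,\pm1\}$. It is Jordan 3-graded if moreover $[L_1,L_{-1}]=L_0$ and $(L_1,L_{-1})$ is a Jordan pair with $\{x,y,z\}=[[x,y],z]$, $Q_xy=\frac12[[x,y],x]$; this is the associated Jordan pair. For a polarized set of variables $X=X^+\cup X^-$ (disjoint union), $\mathcal{L}(X^+,X^-)$ denotes the free 3-graded Lie algebra over $\Phi$ on $X$, i.e. the 3-graded Lie algebra generated by $X$ with $X^{\pm}$ in degrees $\pm1$, such that every map $\varphi:X\to G$ into a 3-graded Lie algebra $G$ with $\varphi(X^\sigma)\subseteq G_\sigma$ ($G_+=G_1$, $G_-=G_{-1}$) extends uniquely to a homomorphism $\mathcal{L}(X^+,X^-)\to G$. An element $f\in\mathcal{L}(X^+,X^-)$ is a 3-graded polynomial identity of $L$ if all such extensions to $L$ send $f$ to $0$. Let $Ass[X^+,X^-]$ be the quotient of the free associative algebra on $X$ by the ideal generated by all $x^\sigma y^\sigma$ with $x^\sigma,y^\sigma\in X^\sigma$, $\sigma=\pm$; it has as basis the alternating words in $X^+$ and $X^-$ and is 3-graded.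 Let $\pi:\mathcal{L}(X^+,X^-)\to Ass[X^+,X^-]^{(-)}$ be the homomorphism of 3-graded Lie algebras that is the identity on $X$. The element $f$ is essential if $\pi(f)\neq0$ and $\pi(f)$ has a monic leading term of highest degree as an associative polynomial (a monomial of maximal degree with coefficient $1$). $L$ satisfies an essential 3-graded polynomial identity if for some $X$ there is an essential $f\in\mathcal{L}(X^+,X^-)$ which is a 3-graded polynomial identity of $L$. For Jordan pairs: let $FJP(X^+,X^-)$ be the free Jordan pair over $\Phi$ on $X=X^+\cup X^-$, and map it canonically (identity on $X$) into the special Jordan pair obtained from the free associative pair on $X$, whose elements of sign $\sigma$ are combinations of alternating words of odd length starting and ending in $X^\sigma$, with Jordan product $Q_ab=aba$. An element $g\in FJP(X^+,X^-)^\sigma$ is essential if its image is nonzero and has a monic leading term of highest degree as an associative polynomial. $V$ satisfies an essential polynomial identity if for some $X$ and some $\sigma=\pm$ there is an essential $g\in FJP(X^+,X^-)^\sigma$ which is sent to $0$ by every Jordan pair homomorphism $FJP(X^+,X^-)\to V$. *)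

theory Defs
  imports "HOL-Algebra.Module"
begin

section \<open>3-graded Lie algebras\<close>

text \<open>Lie algebras are HOL-Algebra modules with a bracket; the fields \<open>mult\<close> and \<open>one\<close> that the
  record type inherits from rings play no role.\<close>

record ('a, 'b) lie = "('a, 'b) module" +
  bracket :: "'b \<Rightarrow> 'b \<Rightarrow> 'b"

record ('a, 'b) graded_lie = "('a, 'b) lie" +
  grade :: "int \<Rightarrow> 'b set"

locale lie_algebra = module R L for R (structure) and L (structure) +
  assumes bracket_closed:
      "\<lbrakk>x \<in> carrier L; y \<in> carrier L\<rbrakk> \<Longrightarrow> bracket L x y \<in> carrier L"
    and bracket_add_left:
      "\<lbrakk>x \<in> carrier L; y \<in> carrier L; z \<in> carrier L\<rbrakk> \<Longrightarrow>
        bracket L (x \<oplus>\<^bsub>L\<^esub> y) z = bracket L x z \<oplus>\<^bsub>L\<^esub> bracket L y z"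
    and bracket_add_right:
      "\<lbrakk>x \<in> carrier L; y \<in> carrier L; z \<in> carrier L\<rbrakk> \<Longrightarrow>
        bracket L z (x \<oplus>\<^bsub>L\<^esub> y) = bracket L z x \<oplus>\<^bsub>L\<^esub> bracket L z y"
    and bracket_smult_left:
      "\<lbrakk>c \<in> carrier R; x \<in> carrier L; y \<in> carrier L\<rbrakk> \<Longrightarrow>
        bracket L (c \<odot>\<^bsub>L\<^esub> x) y = c \<odot>\<^bsub>L\<^esub> bracket L x y"
    and bracket_smult_right:
      "\<lbrakk>c \<in> carrier R; x \<in> carrier L; y \<in> carrier L\<rbrakk> \<Longrightarrow>
        bracket L x (c \<odot>\<^bsub>L\<^esub> y) = c \<odot>\<^bsub>L\<^esub> bracket L x y"
    and bracket_self:
      "x \<in> carrier L \<Longrightarrow> bracket L x x = \<zero>\<^bsub>L\<^esub>"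
    and jacobi:
      "\<lbrakk>x \<in> carrier L; y \<in> carrier L; z \<in> carrier L\<rbrakk> \<Longrightarrow>
        bracket L (bracket L x y) z \<oplus>\<^bsub>L\<^esub> bracket L (bracket L y z) x
          \<oplus>\<^bsub>L\<^esub> bracket L (bracket L z x) y = \<zero>\<^bsub>L\<^esub>"

locale three_graded_lie_algebra = lie_algebra R L for R (structure) and L (structure) +
  assumes grade_submodule: "submodule (grade L k) R L"
    and grade_trivial: "k \<notin> {-1, 0, 1} \<Longrightarrow> grade L k = {\<zero>\<^bsub>L\<^esub>}"
    and grade_direct_sum:
      "x \<in> carrier L \<Longrightarrow>
        \<exists>!(a, b, c). a \<in> grade L 1 \<and> b \<in> grade L 0 \<and> c \<in> grade L (-1)
          \<and> x = a \<oplus>\<^bsub>L\<^esub> b \<oplus>\<^bsub>L\<^esub> c"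
    and grade_bracket:
      "\<lbrakk>x \<in> grade L i; y \<in> grade L j\<rbrakk> \<Longrightarrow> bracket L x y \<in> grade L (i + j)"

definition linear_maps ::
    "('a, 'r) ring_scheme \<Rightarrow> ('a, 'b, 'm) module_scheme \<Rightarrow> ('a, 'c, 'n) module_scheme \<Rightarrow> ('b \<Rightarrow> 'c) set"
  where "linear_maps R M N =
    {h \<in> carrier M \<rightarrow> carrier N.
      (\<forall>x\<in>carrier M. \<forall>y\<in>carrier M. h (x \<oplus>\<^bsub>M\<^esub> y) = h x \<oplus>\<^bsub>N\<^esub> h y) \<and>
      (\<forall>c\<in>carrier R. \<forall>x\<in>carrier M. h (c \<odot>\<^bsub>M\<^esub> x) = c \<odot>\<^bsub>N\<^esub> h x)}"

definition graded_lie_homs ::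
    "('a, 'r) ring_scheme \<Rightarrow> ('a, 'b, 'm) graded_lie_scheme \<Rightarrow> ('a, 'c, 'n) graded_lie_scheme
      \<Rightarrow> ('b \<Rightarrow> 'c) set"
  where "graded_lie_homs R L M =
    {h \<in> linear_maps R L M.
      (\<forall>x\<in>carrier L. \<forall>y\<in>carrier L. h (bracket L x y) = bracket M (h x) (h y)) \<and>
      (\<forall>k. h ` grade L k \<subseteq> grade M k)}"

definition lin_span :: "('a, 'r) ring_scheme \<Rightarrow> ('a, 'b, 'm) module_scheme \<Rightarrow> 'b set \<Rightarrow> 'b set"
  where "lin_span R M S = \<Inter>{H. submodule H R M \<and> S \<subseteq> H}"


section \<open>Jordan pairs\<close>

datatype sign = Pos | Neg

fun opp :: "sign \<Rightarrow> sign" where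
  "opp Pos = Neg"
| "opp Neg = Pos"

fun deg :: "sign \<Rightarrow> int" where
  "deg Pos = 1"
| "deg Neg = -1"

text \<open>The two modules of a pair have a common element type; they need not be disjoint or have the
  same operations.\<close>

record ('a, 'v) pair =
  side :: "sign \<Rightarrow> ('a, 'v) module"
  quad :: "sign \<Rightarrow> 'v \<Rightarrow> 'v \<Rightarrow> 'v"

definition triple :: "('a, 'v, 'm) pair_scheme \<Rightarrow> sign \<Rightarrow> 'v \<Rightarrow> 'v \<Rightarrow> 'v \<Rightarrow> 'v"
  where "triple V \<sigma> x y z =
    quad V \<sigma> (x \<oplus>\<^bsub>side V \<sigma>\<^esub> z) y \<ominus>\<^bsub>side V \<sigma>\<^esub> quad V \<sigma> x y \<ominus>\<^bsub>side V \<sigma>\<^esub> quad V \<sigma> z y"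

text \<open>A Jordan pair in the sense of Loos: the identities
  \[ D(x,y) Q_x = Q_x D(y,x), \qquad D(Q_x y, y) = D(x, Q_y x), \qquad Q_{Q_x y} = Q_x Q_y Q_x \]
  are required in all scalar extensions, i.e. together with all their linearizations. The first and
  the third have degrees 3 and 4 in \<open>x\<close>; their components \<open>JP1_lin\<close> and \<open>JP3_lin\<close> that are linear in
  a second variable \<open>w\<close> have to be listed. All other linearizations follow from the five identities
  below by substituting sums of elements of \<open>V\<close>.\<close>

locale jordan_pair = R?: cring R for R (structure) and V (structure) +
  assumes side_module: "module R (side V \<sigma>)"
    and quad_linear:
      "x \<in> carrier (side V \<sigma>) \<Longrightarrow> quad V \<sigma> x \<in> linear_maps R (side V (opp \<sigma>)) (side V \<sigma>)"
    and quad_smult: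
      "\<lbrakk>c \<in> carrier R; x \<in> carrier (side V \<sigma>); y \<in> carrier (side V (opp \<sigma>))\<rbrakk> \<Longrightarrow>
        quad V \<sigma> (c \<odot>\<^bsub>side V \<sigma>\<^esub> x) y = (c \<otimes> c) \<odot>\<^bsub>side V \<sigma>\<^esub> quad V \<sigma> x y"
    and triple_linear:
      "\<lbrakk>x \<in> carrier (side V \<sigma>); y \<in> carrier (side V (opp \<sigma>))\<rbrakk> \<Longrightarrow>
        triple V \<sigma> x y \<in> linear_maps R (side V \<sigma>) (side V \<sigma>)"
    and JP1:
      "\<lbrakk>x \<in> carrier (side V \<sigma>); y \<in> carrier (side V (opp \<sigma>)); z \<in> carrier (side V (opp \<sigma>))\<rbrakk> \<Longrightarrow>
        triple V \<sigma> x y (quad V \<sigma> x z) = quad V \<sigma> x (triple V (opp \<sigma>) y x z)"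
    and JP1_lin:
      "\<lbrakk>x \<in> carrier (side V \<sigma>); w \<in> carrier (side V \<sigma>);
        y \<in> carrier (side V (opp \<sigma>)); z \<in> carrier (side V (opp \<sigma>))\<rbrakk> \<Longrightarrow>
        triple V \<sigma> w y (quad V \<sigma> x z) \<oplus>\<^bsub>side V \<sigma>\<^esub> triple V \<sigma> x y (triple V \<sigma> x z w)
          = triple V \<sigma> x (triple V (opp \<sigma>) y x z) w
            \<oplus>\<^bsub>side V \<sigma>\<^esub> quad V \<sigma> x (triple V (opp \<sigma>) y w z)"
    and JP2:
      "\<lbrakk>x \<in> carrier (side V \<sigma>); y \<in> carrier (side V (opp \<sigma>)); z \<in> carrier (side V \<sigma>)\<rbrakk> \<Longrightarrow>
        triple V \<sigma> (quad V \<sigma> x y) y z = triple V \<sigma> x (quad V (opp \<sigma>) y x) z"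
    and JP3:
      "\<lbrakk>x \<in> carrier (side V \<sigma>); y \<in> carrier (side V (opp \<sigma>)); z \<in> carrier (side V (opp \<sigma>))\<rbrakk> \<Longrightarrow>
        quad V \<sigma> (quad V \<sigma> x y) z = quad V \<sigma> x (quad V (opp \<sigma>) y (quad V \<sigma> x z))"
    and JP3_lin:
      "\<lbrakk>x \<in> carrier (side V \<sigma>); w \<in> carrier (side V \<sigma>);
        y \<in> carrier (side V (opp \<sigma>)); z \<in> carrier (side V (opp \<sigma>))\<rbrakk> \<Longrightarrow>
        triple V \<sigma> (quad V \<sigma> x y) z (triple V \<sigma> x y w)
          = quad V \<sigma> x (quad V (opp \<sigma>) y (triple V \<sigma> x z w))
            \<oplus>\<^bsub>side V \<sigma>\<^esub> triple V \<sigma> x (quad V (opp \<sigma>) y (quad V \<sigma> x z)) w"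

definition pair_homs ::
    "('a, 'r) ring_scheme \<Rightarrow> ('a, 'v, 'm) pair_scheme \<Rightarrow> ('a, 'w, 'n) pair_scheme
      \<Rightarrow> (sign \<Rightarrow> 'v \<Rightarrow> 'w) set"
  where "pair_homs R V W =
    {h. \<forall>\<sigma>. h \<sigma> \<in> linear_maps R (side V \<sigma>) (side W \<sigma>) \<and>
      (\<forall>x\<in>carrier (side V \<sigma>). \<forall>y\<in>carrier (side V (opp \<sigma>)).
        h \<sigma> (quad V \<sigma> x y) = quad W \<sigma> (h \<sigma> x) (h (opp \<sigma>) y))}"

text \<open>The pair \<open>(L\<^sub>1, L\<^sub>-\<^sub>1)\<close> with \<open>Q\<^sub>x y = \<onehalf>[[x,y],x]\<close>. If it is a Jordan pair, then
  \<open>{x,y,z} = [[x,y],z]\<close> holds automatically, by the Jacobi identity and \<open>[x,z] = 0\<close>.\<close>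

definition lie_pair ::
    "('a, 'r) ring_scheme \<Rightarrow> ('a, 'b, 'm) graded_lie_scheme \<Rightarrow> ('a, 'b) pair"
  where "lie_pair R L =
    \<lparr>side = (\<lambda>\<sigma>. module.truncate (L\<lparr>carrier := grade L (deg \<sigma>)\<rparr>)),
     quad = (\<lambda>\<sigma> x y. inv\<^bsub>R\<^esub> (\<one>\<^bsub>R\<^esub> \<oplus>\<^bsub>R\<^esub> \<one>\<^bsub>R\<^esub>) \<odot>\<^bsub>L\<^esub> bracket L (bracket L x y) x)\<rparr>"

locale jordan_3_graded_lie_algebra =
  three_graded_lie_algebra R L for R (structure) and L (structure) +
  assumes half: "\<one> \<oplus> \<one> \<in> Units R"
    and grade_zero_span:
      "lin_span R L {bracket L x y | x y. x \<in> grade L 1 \<and> y \<in> grade L (-1)} = grade L 0"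
    and lie_pair_jordan: "jordan_pair R (lie_pair R L)"


section \<open>The free 3-graded Lie algebra\<close>

text \<open>A polarized set of variables is given by \<open>X :: sign \<Rightarrow> 'x set\<close> with \<open>X Pos\<close> and \<open>X Neg\<close>
  disjoint. The free 3-graded Lie algebra is the set of formal Lie expressions in \<open>X\<close> over \<open>R\<close>,
  modulo the least congruence that forces the axioms of a Lie algebra and kills all homogeneous
  expressions of degree outside \<open>{-1, 0, 1}\<close>.\<close>

definition polarized :: "(sign \<Rightarrow> 'x set) \<Rightarrow> bool"
  where "polarized X \<longleftrightarrow> X Pos \<inter> X Neg = {}"

datatype ('a, 'x) lie_term =
    LVar 'x
  | LZero
  | LAdd "('a, 'x) lie_term" "('a, 'x) lie_term"
  | LSmult 'a "('a, 'x) lie_term"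
  | LBracket "('a, 'x) lie_term" "('a, 'x) lie_term"

inductive_set lie_terms :: "('a, 'r) ring_scheme \<Rightarrow> (sign \<Rightarrow> 'x set) \<Rightarrow> ('a, 'x) lie_term set"
  for R (structure) and X where
  "x \<in> X \<sigma> \<Longrightarrow> LVar x \<in> lie_terms R X"
| "LZero \<in> lie_terms R X"
| "\<lbrakk>s \<in> lie_terms R X; t \<in> lie_terms R X\<rbrakk> \<Longrightarrow> LAdd s t \<in> lie_terms R X"
| "\<lbrakk>c \<in> carrier R; t \<in> lie_terms R X\<rbrakk> \<Longrightarrow> LSmult c t \<in> lie_terms R X"
| "\<lbrakk>s \<in> lie_terms R X; t \<in> lie_terms R X\<rbrakk> \<Longrightarrow> LBracket s t \<in> lie_terms R X"

inductive lie_homogeneous ::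
    "('a, 'r) ring_scheme \<Rightarrow> (sign \<Rightarrow> 'x set) \<Rightarrow> int \<Rightarrow> ('a, 'x) lie_term \<Rightarrow> bool"
  for R (structure) and X where
  "x \<in> X \<sigma> \<Longrightarrow> lie_homogeneous R X (deg \<sigma>) (LVar x)"
| "lie_homogeneous R X k LZero"
| "\<lbrakk>lie_homogeneous R X k s; lie_homogeneous R X k t\<rbrakk> \<Longrightarrow> lie_homogeneous R X k (LAdd s t)"
| "\<lbrakk>c \<in> carrier R; lie_homogeneous R X k t\<rbrakk> \<Longrightarrow> lie_homogeneous R X k (LSmult c t)"
| "\<lbrakk>lie_homogeneous R X i s; lie_homogeneous R X j t\<rbrakk> \<Longrightarrow>
    lie_homogeneous R X (i + j) (LBracket s t)"

inductive lie_eq ::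
    "('a, 'r) ring_scheme \<Rightarrow> (sign \<Rightarrow> 'x set) \<Rightarrow> ('a, 'x) lie_term \<Rightarrow> ('a, 'x) lie_term \<Rightarrow> bool"
  for R (structure) and X where
  refl: "t \<in> lie_terms R X \<Longrightarrow> lie_eq R X t t"
| sym: "lie_eq R X s t \<Longrightarrow> lie_eq R X t s"
| trans: "\<lbrakk>lie_eq R X s t; lie_eq R X t u\<rbrakk> \<Longrightarrow> lie_eq R X s u"
| cong_add: "\<lbrakk>lie_eq R X s s'; lie_eq R X t t'\<rbrakk> \<Longrightarrow> lie_eq R X (LAdd s t) (LAdd s' t')"
| cong_smult: "\<lbrakk>c \<in> carrier R; lie_eq R X t t'\<rbrakk> \<Longrightarrow> lie_eq R X (LSmult c t) (LSmult c t')"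
| cong_bracket:
    "\<lbrakk>lie_eq R X s s'; lie_eq R X t t'\<rbrakk> \<Longrightarrow> lie_eq R X (LBracket s t) (LBracket s' t')"
| add_assoc:
    "\<lbrakk>s \<in> lie_terms R X; t \<in> lie_terms R X; u \<in> lie_terms R X\<rbrakk> \<Longrightarrow>
      lie_eq R X (LAdd (LAdd s t) u) (LAdd s (LAdd t u))"
| add_comm:
    "\<lbrakk>s \<in> lie_terms R X; t \<in> lie_terms R X\<rbrakk> \<Longrightarrow> lie_eq R X (LAdd s t) (LAdd t s)"
| add_zero: "t \<in> lie_terms R X \<Longrightarrow> lie_eq R X (LAdd LZero t) t"
| add_neg: "t \<in> lie_terms R X \<Longrightarrow> lie_eq R X (LAdd (LSmult (\<ominus> \<one>) t) t) LZero"
| smult_l_distr: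
    "\<lbrakk>c \<in> carrier R; d \<in> carrier R; t \<in> lie_terms R X\<rbrakk> \<Longrightarrow>
      lie_eq R X (LSmult (c \<oplus> d) t) (LAdd (LSmult c t) (LSmult d t))"
| smult_r_distr:
    "\<lbrakk>c \<in> carrier R; s \<in> lie_terms R X; t \<in> lie_terms R X\<rbrakk> \<Longrightarrow>
      lie_eq R X (LSmult c (LAdd s t)) (LAdd (LSmult c s) (LSmult c t))"
| smult_assoc:
    "\<lbrakk>c \<in> carrier R; d \<in> carrier R; t \<in> lie_terms R X\<rbrakk> \<Longrightarrow>
      lie_eq R X (LSmult (c \<otimes> d) t) (LSmult c (LSmult d t))"
| smult_one: "t \<in> lie_terms R X \<Longrightarrow> lie_eq R X (LSmult \<one> t) t"
| bracket_add_left: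
    "\<lbrakk>s \<in> lie_terms R X; t \<in> lie_terms R X; u \<in> lie_terms R X\<rbrakk> \<Longrightarrow>
      lie_eq R X (LBracket (LAdd s t) u) (LAdd (LBracket s u) (LBracket t u))"
| bracket_add_right:
    "\<lbrakk>s \<in> lie_terms R X; t \<in> lie_terms R X; u \<in> lie_terms R X\<rbrakk> \<Longrightarrow>
      lie_eq R X (LBracket u (LAdd s t)) (LAdd (LBracket u s) (LBracket u t))"
| bracket_smult_left:
    "\<lbrakk>c \<in> carrier R; s \<in> lie_terms R X; t \<in> lie_terms R X\<rbrakk> \<Longrightarrow>
      lie_eq R X (LBracket (LSmult c s) t) (LSmult c (LBracket s t))"
| bracket_smult_right:
    "\<lbrakk>c \<in> carrier R; s \<in> lie_terms R X; t \<in> lie_terms R X\<rbrakk> \<Longrightarrow>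
      lie_eq R X (LBracket s (LSmult c t)) (LSmult c (LBracket s t))"
| bracket_self: "t \<in> lie_terms R X \<Longrightarrow> lie_eq R X (LBracket t t) LZero"
| jacobi:
    "\<lbrakk>s \<in> lie_terms R X; t \<in> lie_terms R X; u \<in> lie_terms R X\<rbrakk> \<Longrightarrow>
      lie_eq R X
        (LAdd (LAdd (LBracket (LBracket s t) u) (LBracket (LBracket t u) s))
          (LBracket (LBracket u s) t))
        LZero"
| three_graded:
    "\<lbrakk>lie_homogeneous R X k t; k \<notin> {-1, 0, 1}\<rbrakk> \<Longrightarrow> lie_eq R X t LZero"

definition lie_class ::
    "('a, 'r) ring_scheme \<Rightarrow> (sign \<Rightarrow> 'x set) \<Rightarrow> ('a, 'x) lie_term \<Rightarrow> ('a, 'x) lie_term set"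
  where "lie_class R X t = {u. lie_eq R X t u}"

definition free_lie ::
    "('a, 'r) ring_scheme \<Rightarrow> (sign \<Rightarrow> 'x set) \<Rightarrow> ('a, ('a, 'x) lie_term set) graded_lie"
  where "free_lie R X =
    \<lparr>carrier = lie_class R X ` lie_terms R X,
     mult = (\<lambda>_ _. undefined),
     one = undefined,
     zero = lie_class R X LZero,
     add = (\<lambda>A B. \<Union>s\<in>A. \<Union>t\<in>B. lie_class R X (LAdd s t)),
     smult = (\<lambda>c A. \<Union>t\<in>A. lie_class R X (LSmult c t)),
     bracket = (\<lambda>A B. \<Union>s\<in>A. \<Union>t\<in>B. lie_class R X (LBracket s t)),
     grade = (\<lambda>k. lie_class R X ` {t. lie_homogeneous R X k t})\<rparr>"


section \<open>Associative words\<close>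

text \<open>For a set \<open>W\<close> of words, the module with basis \<open>W\<close>, where the product of two words is their
  concatenation if it lies in \<open>W\<close> and zero otherwise.\<close>

definition word_algebra ::
    "('a, 'r) ring_scheme \<Rightarrow> 'x list set \<Rightarrow> ('a, 'x list \<Rightarrow> 'a) module"
  where "word_algebra R W =
    \<lparr>carrier = {p. (\<forall>w. p w \<in> carrier R) \<and> finite {w. p w \<noteq> \<zero>\<^bsub>R\<^esub>} \<and> {w. p w \<noteq> \<zero>\<^bsub>R\<^esub>} \<subseteq> W},
     mult = (\<lambda>p q w. if w \<in> W
       then \<Oplus>\<^bsub>R\<^esub>i\<in>{..length w}. p (take i w) \<otimes>\<^bsub>R\<^esub> q (drop i w) else \<zero>\<^bsub>R\<^esub>),
     one = (\<lambda>w. if w = [] then \<one>\<^bsub>R\<^esub> else \<zero>\<^bsub>R\<^esub>),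
     zero = (\<lambda>w. \<zero>\<^bsub>R\<^esub>),
     add = (\<lambda>p q w. p w \<oplus>\<^bsub>R\<^esub> q w),
     smult = (\<lambda>c p w. c \<otimes>\<^bsub>R\<^esub> p w)\<rparr>"

definition monomial :: "('a, 'r) ring_scheme \<Rightarrow> 'x list \<Rightarrow> 'x list \<Rightarrow> 'a"
  where "monomial R v w = (if w = v then \<one>\<^bsub>R\<^esub> else \<zero>\<^bsub>R\<^esub>)"

definition alternating_words :: "(sign \<Rightarrow> 'x set) \<Rightarrow> 'x list set"
  where "alternating_words X =
    {w. set w \<subseteq> X Pos \<union> X Neg \<and>
      (\<forall>i \<sigma>. Suc i < length w \<longrightarrow> \<not> (w ! i \<in> X \<sigma> \<and> w ! Suc i \<in> X \<sigma>))}"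

text \<open>The ideal of the free associative algebra generated by the \<open>x\<^sup>\<sigma> y\<^sup>\<sigma>\<close> is spanned by the words that
  are not alternating, so the quotient has the alternating words as a basis.\<close>

definition ass :: "('a, 'r) ring_scheme \<Rightarrow> (sign \<Rightarrow> 'x set) \<Rightarrow> ('a, 'x list \<Rightarrow> 'a) module"
  where "ass R X = word_algebra R (alternating_words X)"

definition word_degree :: "(sign \<Rightarrow> 'x set) \<Rightarrow> 'x list \<Rightarrow> int"
  where "word_degree X w = (\<Sum>x\<leftarrow>w. if x \<in> X Pos then 1 else -1)"

definition ass_minus :: "('a, 'r) ring_scheme \<Rightarrow> (sign \<Rightarrow> 'x set) \<Rightarrow> ('a, 'x list \<Rightarrow> 'a) graded_lie"
  where "ass_minus R X = lie.extend
    (module.extend (ass R X)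
      (lie.fields (\<lambda>p q. p \<otimes>\<^bsub>ass R X\<^esub> q \<ominus>\<^bsub>ass R X\<^esub> q \<otimes>\<^bsub>ass R X\<^esub> p)))
    (graded_lie.fields (\<lambda>k. {p \<in> carrier (ass R X). \<forall>w. p w \<noteq> \<zero>\<^bsub>R\<^esub> \<longrightarrow> word_degree X w = k}))"

definition monic_leading_term :: "('a, 'r) ring_scheme \<Rightarrow> ('x list \<Rightarrow> 'a) \<Rightarrow> bool"
  where "monic_leading_term R p \<longleftrightarrow>
    (\<exists>w. p w = \<one>\<^bsub>R\<^esub> \<and> (\<forall>v. p v \<noteq> \<zero>\<^bsub>R\<^esub> \<longrightarrow> length v \<le> length w))"


section \<open>Essential 3-graded polynomial identities\<close>

text \<open>By the universal property of \<open>free_lie R X\<close> the set below consists of one map (as far as its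
  values on the carrier are concerned), and the graded homomorphisms into \<open>L\<close> are exactly the
  extensions of the maps \<open>X \<rightarrow> L\<close> of degree zero.\<close>

definition lie_pi_maps ::
    "('a, 'r) ring_scheme \<Rightarrow> (sign \<Rightarrow> 'x set) \<Rightarrow> (('a, 'x) lie_term set \<Rightarrow> 'x list \<Rightarrow> 'a) set"
  where "lie_pi_maps R X =
    {\<pi> \<in> graded_lie_homs R (free_lie R X) (ass_minus R X).
      \<forall>\<sigma>. \<forall>x\<in>X \<sigma>. \<pi> (lie_class R X (LVar x)) = monomial R [x]}"

definition essential_lie ::
    "('a, 'r) ring_scheme \<Rightarrow> (sign \<Rightarrow> 'x set) \<Rightarrow> ('a, 'x) lie_term set \<Rightarrow> bool"
  where "essential_lie R X f \<longleftrightarrow>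
    (\<exists>\<pi>\<in>lie_pi_maps R X. \<pi> f \<noteq> \<zero>\<^bsub>ass R X\<^esub> \<and> monic_leading_term R (\<pi> f))"

definition three_graded_identity ::
    "('a, 'r) ring_scheme \<Rightarrow> (sign \<Rightarrow> 'x set) \<Rightarrow> ('a, 'b, 'm) graded_lie_scheme
      \<Rightarrow> ('a, 'x) lie_term set \<Rightarrow> bool"
  where "three_graded_identity R X L f \<longleftrightarrow>
    (\<forall>h\<in>graded_lie_homs R (free_lie R X) L. h f = \<zero>\<^bsub>L\<^esub>)"

text \<open>The type argument fixes only the type from which the sets of variables are taken.\<close>

definition satisfies_essential_3_graded_identity ::
    "'x itself \<Rightarrow> ('a, 'r) ring_scheme \<Rightarrow> ('a, 'b, 'm) graded_lie_scheme \<Rightarrow> bool"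
  where "satisfies_essential_3_graded_identity (_ :: 'x itself) R L \<longleftrightarrow>
    (\<exists>(X :: sign \<Rightarrow> 'x set) f. polarized X \<and> f \<in> carrier (free_lie R X) \<and>
      essential_lie R X f \<and> three_graded_identity R X L f)"


section \<open>The free Jordan pair and essential identities of Jordan pairs\<close>

datatype ('a, 'x) jordan_term =
    JVar 'x
  | JZero
  | JAdd "('a, 'x) jordan_term" "('a, 'x) jordan_term"
  | JSmult 'a "('a, 'x) jordan_term"
  | JQuad "('a, 'x) jordan_term" "('a, 'x) jordan_term"

inductive jordan_term_of ::
    "('a, 'r) ring_scheme \<Rightarrow> (sign \<Rightarrow> 'x set) \<Rightarrow> sign \<Rightarrow> ('a, 'x) jordan_term \<Rightarrow> bool"
  for R (structure) and X where
  "x \<in> X \<sigma> \<Longrightarrow> jordan_term_of R X \<sigma> (JVar x)"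
| "jordan_term_of R X \<sigma> JZero"
| "\<lbrakk>jordan_term_of R X \<sigma> s; jordan_term_of R X \<sigma> t\<rbrakk> \<Longrightarrow> jordan_term_of R X \<sigma> (JAdd s t)"
| "\<lbrakk>c \<in> carrier R; jordan_term_of R X \<sigma> t\<rbrakk> \<Longrightarrow> jordan_term_of R X \<sigma> (JSmult c t)"
| "\<lbrakk>jordan_term_of R X \<sigma> s; jordan_term_of R X (opp \<sigma>) t\<rbrakk> \<Longrightarrow> jordan_term_of R X \<sigma> (JQuad s t)"

definition jtriple ::
    "('a, 'r) ring_scheme \<Rightarrow> ('a, 'x) jordan_term \<Rightarrow> ('a, 'x) jordan_term
      \<Rightarrow> ('a, 'x) jordan_term \<Rightarrow> ('a, 'x) jordan_term"
  where "jtriple R x y z =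
    JAdd (JAdd (JQuad (JAdd x z) y) (JSmult (\<ominus>\<^bsub>R\<^esub> \<one>\<^bsub>R\<^esub>) (JQuad x y)))
      (JSmult (\<ominus>\<^bsub>R\<^esub> \<one>\<^bsub>R\<^esub>) (JQuad z y))"

text \<open>The least congruence that forces the axioms of \<open>jordan_pair\<close>.\<close>

inductive jordan_eq ::
    "('a, 'r) ring_scheme \<Rightarrow> (sign \<Rightarrow> 'x set) \<Rightarrow> sign
      \<Rightarrow> ('a, 'x) jordan_term \<Rightarrow> ('a, 'x) jordan_term \<Rightarrow> bool"
  for R (structure) and X where
  refl: "jordan_term_of R X \<sigma> t \<Longrightarrow> jordan_eq R X \<sigma> t t"
| sym: "jordan_eq R X \<sigma> s t \<Longrightarrow> jordan_eq R X \<sigma> t s"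
| trans: "\<lbrakk>jordan_eq R X \<sigma> s t; jordan_eq R X \<sigma> t u\<rbrakk> \<Longrightarrow> jordan_eq R X \<sigma> s u"
| cong_add:
    "\<lbrakk>jordan_eq R X \<sigma> s s'; jordan_eq R X \<sigma> t t'\<rbrakk> \<Longrightarrow> jordan_eq R X \<sigma> (JAdd s t) (JAdd s' t')"
| cong_smult:
    "\<lbrakk>c \<in> carrier R; jordan_eq R X \<sigma> t t'\<rbrakk> \<Longrightarrow> jordan_eq R X \<sigma> (JSmult c t) (JSmult c t')"
| cong_quad:
    "\<lbrakk>jordan_eq R X \<sigma> s s'; jordan_eq R X (opp \<sigma>) t t'\<rbrakk> \<Longrightarrow>
      jordan_eq R X \<sigma> (JQuad s t) (JQuad s' t')"
| add_assoc:
    "\<lbrakk>jordan_term_of R X \<sigma> s; jordan_term_of R X \<sigma> t; jordan_term_of R X \<sigma> u\<rbrakk> \<Longrightarrow>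
      jordan_eq R X \<sigma> (JAdd (JAdd s t) u) (JAdd s (JAdd t u))"
| add_comm:
    "\<lbrakk>jordan_term_of R X \<sigma> s; jordan_term_of R X \<sigma> t\<rbrakk> \<Longrightarrow>
      jordan_eq R X \<sigma> (JAdd s t) (JAdd t s)"
| add_zero: "jordan_term_of R X \<sigma> t \<Longrightarrow> jordan_eq R X \<sigma> (JAdd JZero t) t"
| add_neg: "jordan_term_of R X \<sigma> t \<Longrightarrow> jordan_eq R X \<sigma> (JAdd (JSmult (\<ominus> \<one>) t) t) JZero"
| smult_l_distr:
    "\<lbrakk>c \<in> carrier R; d \<in> carrier R; jordan_term_of R X \<sigma> t\<rbrakk> \<Longrightarrow>
      jordan_eq R X \<sigma> (JSmult (c \<oplus> d) t) (JAdd (JSmult c t) (JSmult d t))"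
| smult_r_distr:
    "\<lbrakk>c \<in> carrier R; jordan_term_of R X \<sigma> s; jordan_term_of R X \<sigma> t\<rbrakk> \<Longrightarrow>
      jordan_eq R X \<sigma> (JSmult c (JAdd s t)) (JAdd (JSmult c s) (JSmult c t))"
| smult_assoc:
    "\<lbrakk>c \<in> carrier R; d \<in> carrier R; jordan_term_of R X \<sigma> t\<rbrakk> \<Longrightarrow>
      jordan_eq R X \<sigma> (JSmult (c \<otimes> d) t) (JSmult c (JSmult d t))"
| smult_one: "jordan_term_of R X \<sigma> t \<Longrightarrow> jordan_eq R X \<sigma> (JSmult \<one> t) t"
| quad_add:
    "\<lbrakk>jordan_term_of R X \<sigma> x; jordan_term_of R X (opp \<sigma>) s; jordan_term_of R X (opp \<sigma>) t\<rbrakk> \<Longrightarrow>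
      jordan_eq R X \<sigma> (JQuad x (JAdd s t)) (JAdd (JQuad x s) (JQuad x t))"
| quad_linear_smult:
    "\<lbrakk>c \<in> carrier R; jordan_term_of R X \<sigma> x; jordan_term_of R X (opp \<sigma>) t\<rbrakk> \<Longrightarrow>
      jordan_eq R X \<sigma> (JQuad x (JSmult c t)) (JSmult c (JQuad x t))"
| quad_smult:
    "\<lbrakk>c \<in> carrier R; jordan_term_of R X \<sigma> x; jordan_term_of R X (opp \<sigma>) t\<rbrakk> \<Longrightarrow>
      jordan_eq R X \<sigma> (JQuad (JSmult c x) t) (JSmult (c \<otimes> c) (JQuad x t))"
| triple_add:
    "\<lbrakk>jordan_term_of R X \<sigma> x; jordan_term_of R X (opp \<sigma>) y;
      jordan_term_of R X \<sigma> s; jordan_term_of R X \<sigma> t\<rbrakk> \<Longrightarrow>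
      jordan_eq R X \<sigma> (jtriple R x y (JAdd s t)) (JAdd (jtriple R x y s) (jtriple R x y t))"
| triple_smult:
    "\<lbrakk>c \<in> carrier R; jordan_term_of R X \<sigma> x; jordan_term_of R X (opp \<sigma>) y;
      jordan_term_of R X \<sigma> t\<rbrakk> \<Longrightarrow>
      jordan_eq R X \<sigma> (jtriple R x y (JSmult c t)) (JSmult c (jtriple R x y t))"
| JP1:
    "\<lbrakk>jordan_term_of R X \<sigma> x; jordan_term_of R X (opp \<sigma>) y; jordan_term_of R X (opp \<sigma>) z\<rbrakk> \<Longrightarrow>
      jordan_eq R X \<sigma> (jtriple R x y (JQuad x z)) (JQuad x (jtriple R y x z))"
| JP1_lin:
    "\<lbrakk>jordan_term_of R X \<sigma> x; jordan_term_of R X \<sigma> w;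
      jordan_term_of R X (opp \<sigma>) y; jordan_term_of R X (opp \<sigma>) z\<rbrakk> \<Longrightarrow>
      jordan_eq R X \<sigma>
        (JAdd (jtriple R w y (JQuad x z)) (jtriple R x y (jtriple R x z w)))
        (JAdd (jtriple R x (jtriple R y x z) w) (JQuad x (jtriple R y w z)))"
| JP2:
    "\<lbrakk>jordan_term_of R X \<sigma> x; jordan_term_of R X (opp \<sigma>) y; jordan_term_of R X \<sigma> z\<rbrakk> \<Longrightarrow>
      jordan_eq R X \<sigma> (jtriple R (JQuad x y) y z) (jtriple R x (JQuad y x) z)"
| JP3:
    "\<lbrakk>jordan_term_of R X \<sigma> x; jordan_term_of R X (opp \<sigma>) y; jordan_term_of R X (opp \<sigma>) z\<rbrakk> \<Longrightarrow>
      jordan_eq R X \<sigma> (JQuad (JQuad x y) z) (JQuad x (JQuad y (JQuad x z)))"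
| JP3_lin:
    "\<lbrakk>jordan_term_of R X \<sigma> x; jordan_term_of R X \<sigma> w;
      jordan_term_of R X (opp \<sigma>) y; jordan_term_of R X (opp \<sigma>) z\<rbrakk> \<Longrightarrow>
      jordan_eq R X \<sigma>
        (jtriple R (JQuad x y) z (jtriple R x y w))
        (JAdd (JQuad x (JQuad y (jtriple R x z w))) (jtriple R x (JQuad y (JQuad x z)) w))"

definition jordan_class ::
    "('a, 'r) ring_scheme \<Rightarrow> (sign \<Rightarrow> 'x set) \<Rightarrow> sign \<Rightarrow> ('a, 'x) jordan_term
      \<Rightarrow> ('a, 'x) jordan_term set"
  where "jordan_class R X \<sigma> t = {u. jordan_eq R X \<sigma> t u}"

definition free_jordan_pair ::
    "('a, 'r) ring_scheme \<Rightarrow> (sign \<Rightarrow> 'x set) \<Rightarrow> ('a, ('a, 'x) jordan_term set) pair"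
  where "free_jordan_pair R X =
    \<lparr>side = (\<lambda>\<sigma>.
       \<lparr>carrier = jordan_class R X \<sigma> ` {t. jordan_term_of R X \<sigma> t},
        mult = (\<lambda>_ _. undefined),
        one = undefined,
        zero = jordan_class R X \<sigma> JZero,
        add = (\<lambda>A B. \<Union>s\<in>A. \<Union>t\<in>B. jordan_class R X \<sigma> (JAdd s t)),
        smult = (\<lambda>c A. \<Union>t\<in>A. jordan_class R X \<sigma> (JSmult c t))\<rparr>),
     quad = (\<lambda>\<sigma> A B. \<Union>s\<in>A. \<Union>t\<in>B. jordan_class R X \<sigma> (JQuad s t))\<rparr>"

text \<open>The special Jordan pair of the free associative pair.\<close>

definition special_jordan_pair ::
    "('a, 'r) ring_scheme \<Rightarrow> (sign \<Rightarrow> 'x set) \<Rightarrow> ('a, 'x list \<Rightarrow> 'a) pair"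
  where "special_jordan_pair R X =
    \<lparr>side = (\<lambda>\<sigma>. (ass R X)\<lparr>carrier := {p \<in> carrier (ass R X).
       \<forall>w. p w \<noteq> \<zero>\<^bsub>R\<^esub> \<longrightarrow> odd (length w) \<and> hd w \<in> X \<sigma> \<and> last w \<in> X \<sigma>}\<rparr>),
     quad = (\<lambda>\<sigma> p q. p \<otimes>\<^bsub>ass R X\<^esub> q \<otimes>\<^bsub>ass R X\<^esub> p)\<rparr>"

definition jordan_pi_maps ::
    "('a, 'r) ring_scheme \<Rightarrow> (sign \<Rightarrow> 'x set)
      \<Rightarrow> (sign \<Rightarrow> ('a, 'x) jordan_term set \<Rightarrow> 'x list \<Rightarrow> 'a) set"
  where "jordan_pi_maps R X =
    {\<pi> \<in> pair_homs R (free_jordan_pair R X) (special_jordan_pair R X).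
      \<forall>\<sigma>. \<forall>x\<in>X \<sigma>. \<pi> \<sigma> (jordan_class R X \<sigma> (JVar x)) = monomial R [x]}"

definition essential_jordan ::
    "('a, 'r) ring_scheme \<Rightarrow> (sign \<Rightarrow> 'x set) \<Rightarrow> sign \<Rightarrow> ('a, 'x) jordan_term set \<Rightarrow> bool"
  where "essential_jordan R X \<sigma> g \<longleftrightarrow>
    (\<exists>\<pi>\<in>jordan_pi_maps R X. \<pi> \<sigma> g \<noteq> \<zero>\<^bsub>ass R X\<^esub> \<and> monic_leading_term R (\<pi> \<sigma> g))"

definition jordan_identity ::
    "('a, 'r) ring_scheme \<Rightarrow> (sign \<Rightarrow> 'x set) \<Rightarrow> ('a, 'v, 'm) pair_scheme \<Rightarrow> sign
      \<Rightarrow> ('a, 'x) jordan_term set \<Rightarrow> bool"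
  where "jordan_identity R X V \<sigma> g \<longleftrightarrow>
    (\<forall>h\<in>pair_homs R (free_jordan_pair R X) V. h \<sigma> g = \<zero>\<^bsub>side V \<sigma>\<^esub>)"

definition satisfies_essential_jordan_identity ::
    "'x itself \<Rightarrow> ('a, 'r) ring_scheme \<Rightarrow> ('a, 'v, 'm) pair_scheme \<Rightarrow> bool"
  where "satisfies_essential_jordan_identity (_ :: 'x itself) R V \<longleftrightarrow>
    (\<exists>(X :: sign \<Rightarrow> 'x set) \<sigma> g. polarized X \<and> g \<in> carrier (side (free_jordan_pair R X) \<sigma>) \<and>
      essential_jordan R X \<sigma> g \<and> jordan_identity R X V \<sigma> g)"

end

theory Submission
  imports Defs
begin

text \<open>
  Let \<open>f\<close> be an essential identity of the Jordan 3-graded Lie algebra \<open>L\<close>. Every Lie polynomial in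
  variables of degree \<open>\<plusminus>1\<close> splits as \<open>f = f\<^sub>1 + f\<^sub>0 + f\<^sub>-\<^sub>1\<close>, where \<open>f\<^sub>\<plusminus>\<^sub>1\<close> are Jordan polynomials and
  \<open>f\<^sub>0 = \<Sum> [a\<^sub>i, b\<^sub>i]\<close> with Jordan polynomials \<open>a\<^sub>i\<close> and \<open>b\<^sub>i\<close> of signs \<open>+\<close> and \<open>-\<close>. This holds for the
  variables, and it is inherited by brackets because \<open>[[a, b], z]\<close> is the Jordan triple product
  \<open>{a, b, z}\<close> and \<open>[f\<^sub>0, _]\<close> is a derivation. The splitting is constructed on formal expressions in
  \<open>jordan_parts\<close>, and \<open>lie_eval_eq_jordan_parts\<close> shows that it is correct in every 3-graded Lie algebra
  whose two odd components carry a Jordan pair with \<open>2 Q\<^sub>x y = [[x, y], x]\<close>. There are two such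
  situations to which it is applied, \<open>V = (L\<^sub>1, L\<^sub>-\<^sub>1)\<close> inside \<open>L\<close>, and the special Jordan pair inside
  the commutator algebra of \<open>Ass[X\<^sup>+, X\<^sup>-]\<close>.

  Since \<open>L\<close> is the direct sum of its components, each of \<open>f\<^sub>1\<close>, \<open>f\<^sub>0\<close>, \<open>f\<^sub>-\<^sub>1\<close> vanishes on \<open>L\<close> (\<open>parts_vanish\<close>).
  In \<open>Ass[X\<^sup>+, X\<^sup>-]\<close> the degree of an alternating word is \<open>0\<close> or \<open>\<plusminus>1\<close>, according to its length being even
  or odd, so the monic leading word \<open>w\<close> of \<open>\<pi>(f)\<close> occurs in the image of exactly one of the three
  components and is a leading word there (\<open>leading_word_to_jordan\<close>). If the length of \<open>w\<close> is odd, then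
  \<open>f\<^sub>1\<close> or \<open>f\<^sub>-\<^sub>1\<close> is an essential Jordan identity of \<open>V\<close>. If it is even, take a variable \<open>z\<close> that does not
  occur in \<open>w\<close> and whose sign is opposite to that of the last letter of \<open>w\<close>. Then \<open>[f\<^sub>0, z]\<close>, which is a
  combination of triple products, is a Jordan identity of \<open>V\<close>. Its image is \<open>\<pi>(f\<^sub>0) z - z \<pi>(f\<^sub>0)\<close>; the
  alternating word \<open>w z\<close> has coefficient \<open>1\<close> in the first term, it does not occur in the second one,
  all of whose words begin with \<open>z\<close>, and no word is longer.

  The new variable and the passage to variables in \<open>\<nat>\<close> are obtained together: \<open>f\<close> is represented by an
  expression with finitely many variables, which are renamed to an initial segment of \<open>\<nat>\<close>
  (\<open>renames_lie_eval\<close>).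
\<close>

section \<open>The universal property of the free 3-graded Lie algebra\<close>

primrec lie_eval ::
    "('a, 'b, 'm) graded_lie_scheme \<Rightarrow> ('x \<Rightarrow> 'b) \<Rightarrow> ('a, 'x) lie_term \<Rightarrow> 'b"
  where
  "lie_eval L v (LVar x) = v x"
| "lie_eval L v LZero = \<zero>\<^bsub>L\<^esub>"
| "lie_eval L v (LAdd s t) = lie_eval L v s \<oplus>\<^bsub>L\<^esub> lie_eval L v t"
| "lie_eval L v (LSmult c t) = c \<odot>\<^bsub>L\<^esub> lie_eval L v t"
| "lie_eval L v (LBracket s t) = bracket L (lie_eval L v s) (lie_eval L v t)"

definition graded_valuation ::
    "(sign \<Rightarrow> 'x set) \<Rightarrow> ('a, 'b, 'm) graded_lie_scheme \<Rightarrow> ('x \<Rightarrow> 'b) \<Rightarrow> bool"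
  where "graded_valuation X L v \<longleftrightarrow> (\<forall>\<sigma>. \<forall>x\<in>X \<sigma>. v x \<in> grade L (deg \<sigma>))"

lemma lie_homogeneous_imp_lie_terms:
  "lie_homogeneous R X k t \<Longrightarrow> t \<in> lie_terms R X"
  by (induction rule: lie_homogeneous.induct) (auto intro: lie_terms.intros)

lemma lie_class_eqI:
  assumes "lie_eq R X s t"
  shows "lie_class R X s = lie_class R X t"
proof -
  have "lie_eq R X s u \<longleftrightarrow> lie_eq R X t u" for u
    using lie_eq.trans[OF assms] lie_eq.trans[OF lie_eq.sym[OF assms]] by (rule iffI[rotated])
  then show ?thesis
    by (simp add: lie_class_def)
qed

lemma lie_class_self: "t \<in> lie_terms R X \<Longrightarrow> t \<in> lie_class R X t"
  unfolding lie_class_def by (simp add: lie_eq.refl)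

lemma Union2_eq_const:
  assumes "a \<in> A" and "b \<in> B" and "\<And>x y. x \<in> A \<Longrightarrow> y \<in> B \<Longrightarrow> f x y = c"
  shows "(\<Union>x\<in>A. \<Union>y\<in>B. f x y) = c"
proof -
  have "(\<Union>y\<in>B. f x y) = c" if "x \<in> A" for x
    using SUP_eq_const[of B "f x" c] assms(2,3) that by blast
  then show ?thesis
    using SUP_eq_const[of A "\<lambda>x. \<Union>y\<in>B. f x y" c] assms(1) by blast
qed

lemma carrier_free_lie: "carrier (free_lie R X) = lie_class R X ` lie_terms R X"
  by (simp add: free_lie_def)

lemma add_free_lie:
  assumes "s \<in> lie_terms R X" "t \<in> lie_terms R X"
  shows "lie_class R X s \<oplus>\<^bsub>free_lie R X\<^esub> lie_class R X t = lie_class R X (LAdd s t)"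
proof -
  have "lie_class R X (LAdd s' t') = lie_class R X (LAdd s t)"
    if "s' \<in> lie_class R X s" "t' \<in> lie_class R X t" for s' t'
    using that unfolding lie_class_def mem_Collect_eq
    by (rule lie_class_eqI[unfolded lie_class_def, OF lie_eq.sym[OF lie_eq.cong_add]])
  note * = Union2_eq_const[OF lie_class_self[OF assms(1)] lie_class_self[OF assms(2)] this]
  show ?thesis
    by (simp add: free_lie_def *)
qed

lemma smult_free_lie:
  assumes "c \<in> carrier R" "t \<in> lie_terms R X"
  shows "c \<odot>\<^bsub>free_lie R X\<^esub> lie_class R X t = lie_class R X (LSmult c t)"
proof -
  have "lie_class R X (LSmult c t') = lie_class R X (LSmult c t)"
    if "t' \<in> lie_class R X t" for t'
    using assms(1) that unfolding lie_class_def mem_Collect_eq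
    by (rule lie_class_eqI[unfolded lie_class_def, OF lie_eq.sym[OF lie_eq.cong_smult]])
  note * = SUP_eq_const[OF _ this, of "lie_class R X t" "\<lambda>t. t"]
  show ?thesis
    using lie_class_self[OF assms(2)] by (auto simp: free_lie_def intro!: *)
qed

lemma bracket_free_lie:
  assumes "s \<in> lie_terms R X" "t \<in> lie_terms R X"
  shows "bracket (free_lie R X) (lie_class R X s) (lie_class R X t) = lie_class R X (LBracket s t)"
proof -
  have "lie_class R X (LBracket s' t') = lie_class R X (LBracket s t)"
    if "s' \<in> lie_class R X s" "t' \<in> lie_class R X t" for s' t'
    using that unfolding lie_class_def mem_Collect_eq
    by (rule lie_class_eqI[unfolded lie_class_def, OF lie_eq.sym[OF lie_eq.cong_bracket]])
  note * = Union2_eq_const[OF lie_class_self[OF assms(1)] lie_class_self[OF assms(2)] this]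
  show ?thesis
    by (simp add: free_lie_def *)
qed

lemma linear_mapsD:
  assumes "h \<in> linear_maps R M N"
  shows "x \<in> carrier M \<Longrightarrow> h x \<in> carrier N"
    and "x \<in> carrier M \<Longrightarrow> y \<in> carrier M \<Longrightarrow> h (x \<oplus>\<^bsub>M\<^esub> y) = h x \<oplus>\<^bsub>N\<^esub> h y"
    and "c \<in> carrier R \<Longrightarrow> x \<in> carrier M \<Longrightarrow> h (c \<odot>\<^bsub>M\<^esub> x) = c \<odot>\<^bsub>N\<^esub> h x"
  using assms unfolding linear_maps_def by auto

lemma linear_map_free_lie_zero:
  assumes "module R L" and h: "h \<in> linear_maps R (free_lie R X) L"
  shows "h (lie_class R X LZero) = \<zero>\<^bsub>L\<^esub>"
proof -
  interpret L: module R L by fact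
  have Z: "LZero \<in> lie_terms R X" by (rule lie_terms.intros)
  then have cZ: "lie_class R X LZero \<in> carrier (free_lie R X)"
    by (auto simp: carrier_free_lie)
  have "lie_class R X LZero \<oplus>\<^bsub>free_lie R X\<^esub> lie_class R X LZero = lie_class R X LZero"
    using Z by (simp add: add_free_lie lie_class_eqI[OF lie_eq.add_zero])
  then have "h (lie_class R X LZero) \<oplus>\<^bsub>L\<^esub> h (lie_class R X LZero) = h (lie_class R X LZero)"
    using linear_mapsD(2)[OF h cZ cZ] by simp
  then show ?thesis
    using linear_mapsD(1)[OF h cZ] L.add.l_cancel_one by simp
qed

text \<open>Homomorphisms on the free algebra are handled through values of formal expressions: by this lemma
  a homomorphism is determined by the valuation of the variables that it induces, and by
  \<open>free_lie_universal\<close> every graded valuation arises in this way.\<close>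

lemma graded_lie_hom_eval:
  assumes "module R L" and h: "h \<in> graded_lie_homs R (free_lie R X) L"
    and t: "t \<in> lie_terms R X"
  shows "h (lie_class R X t) = lie_eval L (\<lambda>x. h (lie_class R X (LVar x))) t"
proof -
  have lin: "h \<in> linear_maps R (free_lie R X) L"
    using h by (simp add: graded_lie_homs_def)
  have br: "h (bracket (free_lie R X) x y) = bracket L (h x) (h y)"
    if "x \<in> carrier (free_lie R X)" "y \<in> carrier (free_lie R X)" for x y
    using h that by (simp add: graded_lie_homs_def)
  have cl: "lie_class R X u \<in> carrier (free_lie R X)" if "u \<in> lie_terms R X" for u
    using that by (simp add: carrier_free_lie)
  show ?thesis
    using t
  proof induction
    case 2
    show ?case using linear_map_free_lie_zero[OF assms(1) lin] by simp
  next
    case (3 s t)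
    then show ?case
      using linear_mapsD(2)[OF lin cl cl] by (simp add: add_free_lie[symmetric])
  next
    case (4 c t)
    then show ?case
      using linear_mapsD(3)[OF lin _ cl] by (simp add: smult_free_lie[symmetric])
  next
    case (5 s t)
    then show ?case
      using br[OF cl cl] by (simp add: bracket_free_lie[symmetric])
  qed simp
qed

context three_graded_lie_algebra
begin

lemma grade_carrier: "x \<in> grade L k \<Longrightarrow> x \<in> carrier L"
  using submoduleE(1)[OF grade_submodule] by blast

lemma grade_zero: "\<zero>\<^bsub>L\<^esub> \<in> grade L k"
  using subgroup.one_closed[OF submodule.axioms(1)[OF grade_submodule[of k]]] by simp

lemma grade_add: "x \<in> grade L k \<Longrightarrow> y \<in> grade L k \<Longrightarrow> x \<oplus>\<^bsub>L\<^esub> y \<in> grade L k"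
  by (rule submoduleE(5)[OF grade_submodule])

lemma grade_smult: "c \<in> carrier R \<Longrightarrow> x \<in> grade L k \<Longrightarrow> c \<odot>\<^bsub>L\<^esub> x \<in> grade L k"
  by (rule submoduleE(4)[OF grade_submodule])

lemma lie_eval_homogeneous:
  assumes v: "graded_valuation X L v" and "lie_homogeneous R X k t"
  shows "lie_eval L v t \<in> grade L k"
  using assms(2)
  by (induction rule: lie_homogeneous.induct)
    (use v in \<open>auto simp: graded_valuation_def grade_zero grade_add grade_smult grade_bracket\<close>)

lemma lie_eval_closed:
  assumes v: "graded_valuation X L v" and "t \<in> lie_terms R X"
  shows "lie_eval L v t \<in> carrier L"
  using assms(2)
  by induction
    (use v in \<open>auto simp: graded_valuation_def bracket_closed intro: grade_carrier\<close>)

text \<open>Each generating relation of \<open>lie_eq\<close> is an axiom of 3-graded Lie algebras. The relations that kill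
  the homogeneous expressions of degree outside \<open>{-1, 0, 1}\<close> hold because such an expression takes its
  value in a component that is zero.\<close>

lemma lie_eval_respects_lie_eq:
  assumes v: "graded_valuation X L v" and "lie_eq R X s t"
  shows "lie_eval L v s = lie_eval L v t"
proof -
  note [simp] = lie_eval_closed[OF v]
  note lie_jacobi = jacobi
  have neg: "(\<ominus> \<one> \<odot>\<^bsub>L\<^esub> x) \<oplus>\<^bsub>L\<^esub> x = \<zero>\<^bsub>L\<^esub>" if "x \<in> carrier L" for x
    using that by (simp add: smult_l_minus M.l_neg)
  show ?thesis
    using assms(2)
  proof (induction rule: lie_eq.induct)
    case (add_comm s t)
    then show ?case by (simp add: M.a_comm)
  next
    case (jacobi s t u)
    then show ?case using lie_jacobi by simp
  next
    case (three_graded k t)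
    then show ?case
      using lie_eval_homogeneous[OF v three_graded(1)] grade_trivial by auto
  qed (simp_all add: M.a_assoc neg smult_l_distr smult_r_distr smult_assoc1 bracket_add_left
      bracket_add_right bracket_smult_left bracket_smult_right bracket_self)
qed

lemma free_lie_universal:
  assumes v: "graded_valuation X L v"
  obtains h where "h \<in> graded_lie_homs R (free_lie R X) L"
    and "\<And>t. t \<in> lie_terms R X \<Longrightarrow> h (lie_class R X t) = lie_eval L v t"
proof
  define h where "h A = lie_eval L v (SOME t. t \<in> A)" for A
  show eval: "h (lie_class R X t) = lie_eval L v t" if t: "t \<in> lie_terms R X" for t
  proof -
    have "(SOME u. u \<in> lie_class R X t) \<in> lie_class R X t"
      using lie_class_self[OF t] by (rule someI)
    then show ?thesis
      using lie_eval_respects_lie_eq[OF v] by (simp add: h_def lie_class_def)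
  qed
  show "h \<in> graded_lie_homs R (free_lie R X) L"
    unfolding graded_lie_homs_def linear_maps_def
  proof (intro CollectI conjI ballI allI funcsetI; (unfold carrier_free_lie)?; (elim imageE)?; (simp only:)?)
    fix k
    show "h ` grade (free_lie R X) k \<subseteq> grade L k"
      using lie_eval_homogeneous[OF v]
      by (auto simp: free_lie_def eval lie_homogeneous_imp_lie_terms)
  qed (simp_all add: eval lie_eval_closed[OF v] add_free_lie smult_free_lie bracket_free_lie lie_terms.intros)
qed

end

section \<open>The universal property of the free Jordan pair\<close>

primrec pair_eval ::
    "('a, 'v, 'm) pair_scheme \<Rightarrow> ('x \<Rightarrow> 'v) \<Rightarrow> ('a, 'x) jordan_term \<Rightarrow> sign \<Rightarrow> 'v"
  where
  "pair_eval V v (JVar x) \<sigma> = v x"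
| "pair_eval V v JZero \<sigma> = \<zero>\<^bsub>side V \<sigma>\<^esub>"
| "pair_eval V v (JAdd s t) \<sigma> = pair_eval V v s \<sigma> \<oplus>\<^bsub>side V \<sigma>\<^esub> pair_eval V v t \<sigma>"
| "pair_eval V v (JSmult c t) \<sigma> = c \<odot>\<^bsub>side V \<sigma>\<^esub> pair_eval V v t \<sigma>"
| "pair_eval V v (JQuad s t) \<sigma> = quad V \<sigma> (pair_eval V v s \<sigma>) (pair_eval V v t (opp \<sigma>))"

definition pair_valuation ::
    "(sign \<Rightarrow> 'x set) \<Rightarrow> ('a, 'v, 'm) pair_scheme \<Rightarrow> ('x \<Rightarrow> 'v) \<Rightarrow> bool"
  where "pair_valuation X V v \<longleftrightarrow> (\<forall>\<sigma>. \<forall>x\<in>X \<sigma>. v x \<in> carrier (side V \<sigma>))"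

lemma opp_opp [simp]: "opp (opp \<sigma>) = \<sigma>"
  by (cases \<sigma>) auto

lemma deg_opp [simp]: "deg (opp \<sigma>) = - deg \<sigma>"
  by (cases \<sigma>) auto

lemma (in cring) jordan_term_of_jtriple:
  assumes "jordan_term_of R X \<sigma> x" "jordan_term_of R X (opp \<sigma>) y" "jordan_term_of R X \<sigma> z"
  shows "jordan_term_of R X \<sigma> (jtriple R x y z)"
  using assms by (auto simp: jtriple_def intro!: jordan_term_of.intros)

lemma jordan_class_eqI:
  assumes "jordan_eq R X \<sigma> s t"
  shows "jordan_class R X \<sigma> s = jordan_class R X \<sigma> t"
proof -
  have "jordan_eq R X \<sigma> s u \<longleftrightarrow> jordan_eq R X \<sigma> t u" for u
    using jordan_eq.trans[OF assms] jordan_eq.trans[OF jordan_eq.sym[OF assms]] by (rule iffI[rotated])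
  then show ?thesis
    by (simp add: jordan_class_def)
qed

lemma jordan_class_self: "jordan_term_of R X \<sigma> t \<Longrightarrow> t \<in> jordan_class R X \<sigma> t"
  unfolding jordan_class_def by (simp add: jordan_eq.refl)

lemma carrier_free_jordan_pair:
  "carrier (side (free_jordan_pair R X) \<sigma>) = jordan_class R X \<sigma> ` {t. jordan_term_of R X \<sigma> t}"
  by (simp add: free_jordan_pair_def)

lemma add_free_jordan_pair:
  assumes "jordan_term_of R X \<sigma> s" "jordan_term_of R X \<sigma> t"
  shows "jordan_class R X \<sigma> s \<oplus>\<^bsub>side (free_jordan_pair R X) \<sigma>\<^esub> jordan_class R X \<sigma> t
    = jordan_class R X \<sigma> (JAdd s t)"
proof -
  have "jordan_class R X \<sigma> (JAdd s' t') = jordan_class R X \<sigma> (JAdd s t)"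
    if "s' \<in> jordan_class R X \<sigma> s" "t' \<in> jordan_class R X \<sigma> t" for s' t'
    using that unfolding jordan_class_def mem_Collect_eq
    by (rule jordan_class_eqI[unfolded jordan_class_def, OF jordan_eq.sym[OF jordan_eq.cong_add]])
  note * = Union2_eq_const[OF jordan_class_self[OF assms(1)] jordan_class_self[OF assms(2)] this]
  show ?thesis
    by (simp add: free_jordan_pair_def *)
qed

lemma smult_free_jordan_pair:
  assumes "c \<in> carrier R" "jordan_term_of R X \<sigma> t"
  shows "c \<odot>\<^bsub>side (free_jordan_pair R X) \<sigma>\<^esub> jordan_class R X \<sigma> t = jordan_class R X \<sigma> (JSmult c t)"
proof -
  have "jordan_class R X \<sigma> (JSmult c t') = jordan_class R X \<sigma> (JSmult c t)"
    if "t' \<in> jordan_class R X \<sigma> t" for t'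
    using assms(1) that unfolding jordan_class_def mem_Collect_eq
    by (rule jordan_class_eqI[unfolded jordan_class_def, OF jordan_eq.sym[OF jordan_eq.cong_smult]])
  note * = SUP_eq_const[OF _ this, of "jordan_class R X \<sigma> t" "\<lambda>t. t"]
  show ?thesis
    using jordan_class_self[OF assms(2)] by (auto simp: free_jordan_pair_def intro!: *)
qed

lemma quad_free_jordan_pair:
  assumes "jordan_term_of R X \<sigma> s" "jordan_term_of R X (opp \<sigma>) t"
  shows "quad (free_jordan_pair R X) \<sigma> (jordan_class R X \<sigma> s) (jordan_class R X (opp \<sigma>) t)
    = jordan_class R X \<sigma> (JQuad s t)"
proof -
  have "jordan_class R X \<sigma> (JQuad s' t') = jordan_class R X \<sigma> (JQuad s t)"
    if "s' \<in> jordan_class R X \<sigma> s" "t' \<in> jordan_class R X (opp \<sigma>) t" for s' t'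
    using that unfolding jordan_class_def mem_Collect_eq
    by (rule jordan_class_eqI[unfolded jordan_class_def, OF jordan_eq.sym[OF jordan_eq.cong_quad]])
  note * = Union2_eq_const[OF jordan_class_self[OF assms(1)] jordan_class_self[OF assms(2)] this]
  show ?thesis
    by (simp add: free_jordan_pair_def *)
qed

context jordan_pair
begin

lemma side_abelian_group: "abelian_group (side V \<sigma>)"
  by (rule module.axioms(2)[OF side_module])

lemma quad_closed:
  "x \<in> carrier (side V \<sigma>) \<Longrightarrow> y \<in> carrier (side V (opp \<sigma>)) \<Longrightarrow> quad V \<sigma> x y \<in> carrier (side V \<sigma>)"
  by (rule linear_mapsD(1)[OF quad_linear])

lemma triple_closed:
  "x \<in> carrier (side V \<sigma>) \<Longrightarrow> y \<in> carrier (side V (opp \<sigma>)) \<Longrightarrow> z \<in> carrier (side V \<sigma>) \<Longrightarrow>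
    triple V \<sigma> x y z \<in> carrier (side V \<sigma>)"
  by (rule linear_mapsD(1)[OF triple_linear])

lemma side_zero: "\<zero>\<^bsub>side V \<sigma>\<^esub> \<in> carrier (side V \<sigma>)"
  by (rule abelian_groupE(2)[OF side_abelian_group])

lemma side_neg:
  "x \<in> carrier (side V \<sigma>) \<Longrightarrow> (\<ominus> \<one>) \<odot>\<^bsub>side V \<sigma>\<^esub> x = \<ominus>\<^bsub>side V \<sigma>\<^esub> x"
  using module.smult_l_minus[OF side_module R.one_closed] module.smult_one[OF side_module] by simp

lemma pair_eval_closed:
  assumes v: "pair_valuation X V v" and "jordan_term_of R X \<sigma> t"
  shows "pair_eval V v t \<sigma> \<in> carrier (side V \<sigma>)"
  using assms(2)
proof induction
  case (1 x \<sigma>)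
  then show ?case using v by (simp add: pair_valuation_def)
qed (auto intro: side_zero abelian_groupE(1)[OF side_abelian_group]
    module.smult_closed[OF side_module] quad_closed)

lemma pair_eval_jtriple:
  assumes v: "pair_valuation X V v"
    and "jordan_term_of R X \<sigma> x" "jordan_term_of R X (opp \<sigma>) y" "jordan_term_of R X \<sigma> z"
  shows "pair_eval V v (jtriple R x y z) \<sigma>
    = triple V \<sigma> (pair_eval V v x \<sigma>) (pair_eval V v y (opp \<sigma>)) (pair_eval V v z \<sigma>)"
  using assms(2-)
  by (simp add: jtriple_def triple_def a_minus_def side_neg quad_closed pair_eval_closed[OF v])

text \<open>The relations generating \<open>jordan_eq\<close> are the axioms of a Jordan pair, read off through
  \<open>pair_eval_jtriple\<close>.\<close>

lemma pair_eval_respects_jordan_eq: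
  assumes v: "pair_valuation X V v" and "jordan_eq R X \<sigma> s t"
  shows "pair_eval V v s \<sigma> = pair_eval V v t \<sigma>"
proof -
  note [simp] = pair_eval_closed[OF v] pair_eval_jtriple[OF v] jordan_term_of.intros(2-)
    jordan_term_of_jtriple
  note quad_smult' = quad_smult and JPs = JP1 JP1_lin JP2 JP3 JP3_lin
  have neg: "(\<ominus> \<one> \<odot>\<^bsub>side V \<sigma>\<^esub> x) \<oplus>\<^bsub>side V \<sigma>\<^esub> x = \<zero>\<^bsub>side V \<sigma>\<^esub>"
    if "x \<in> carrier (side V \<sigma>)" for x \<sigma>
    using that by (simp add: side_neg abelian_group.l_neg[OF side_abelian_group])
  show ?thesis
    using assms(2)
  proof (induction rule: jordan_eq.induct)
    case (add_comm \<sigma> s t)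
    then show ?case by (simp add: abelian_groupE(4)[OF side_abelian_group])
  next
    case (quad_smult c \<sigma> x t)
    then show ?case by (simp add: quad_smult')
  next
    case (JP1 \<sigma> x y z)
    then show ?case using JPs(1) by simp
  next
    case (JP1_lin \<sigma> x w y z)
    then show ?case using JPs(2) by simp
  next
    case (JP2 \<sigma> x y z)
    then show ?case using JPs(3) by simp
  next
    case (JP3 \<sigma> x y z)
    then show ?case using JPs(4) by simp
  next
    case (JP3_lin \<sigma> x w y z)
    then show ?case using JPs(5) by simp
  qed (simp_all add: neg abelian_groupE(3,5)[OF side_abelian_group]
      module.smult_l_distr[OF side_module] module.smult_r_distr[OF side_module]
      module.smult_assoc1[OF side_module] module.smult_one[OF side_module]
      linear_mapsD(2,3)[OF quad_linear] linear_mapsD(2,3)[OF triple_linear])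
qed

lemma free_jordan_pair_universal:
  assumes v: "pair_valuation X V v"
  obtains h where "h \<in> pair_homs R (free_jordan_pair R X) V"
    and "\<And>\<sigma> t. jordan_term_of R X \<sigma> t \<Longrightarrow> h \<sigma> (jordan_class R X \<sigma> t) = pair_eval V v t \<sigma>"
proof
  define h where "h \<sigma> A = pair_eval V v (SOME t. t \<in> A) \<sigma>" for \<sigma> A
  show eval: "h \<sigma> (jordan_class R X \<sigma> t) = pair_eval V v t \<sigma>"
    if t: "jordan_term_of R X \<sigma> t" for \<sigma> t
  proof -
    have "(SOME u. u \<in> jordan_class R X \<sigma> t) \<in> jordan_class R X \<sigma> t"
      using jordan_class_self[OF t] by (rule someI)
    then show ?thesis
      using pair_eval_respects_jordan_eq[OF v] by (simp add: h_def jordan_class_def)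
  qed
  show "h \<in> pair_homs R (free_jordan_pair R X) V"
    unfolding pair_homs_def linear_maps_def
    by (intro CollectI conjI ballI allI funcsetI; (unfold carrier_free_jordan_pair)?;
        (elim imageE CollectE)?; (simp only:)?)
      (simp_all add: eval pair_eval_closed[OF v] add_free_jordan_pair smult_free_jordan_pair
        quad_free_jordan_pair jordan_term_of.intros)
qed

lemma pair_hom_eval:
  assumes h: "h \<in> pair_homs R (free_jordan_pair R X) V"
    and v: "\<And>\<sigma> x. x \<in> X \<sigma> \<Longrightarrow> v x = h \<sigma> (jordan_class R X \<sigma> (JVar x))"
    and t: "jordan_term_of R X \<sigma> t"
  shows "h \<sigma> (jordan_class R X \<sigma> t) = pair_eval V v t \<sigma>"
proof -
  have lin: "h \<sigma> \<in> linear_maps R (side (free_jordan_pair R X) \<sigma>) (side V \<sigma>)" for \<sigma>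
    using h by (simp add: pair_homs_def)
  have qd: "h \<sigma> (quad (free_jordan_pair R X) \<sigma> x y) = quad V \<sigma> (h \<sigma> x) (h (opp \<sigma>) y)"
    if "x \<in> carrier (side (free_jordan_pair R X) \<sigma>)"
      "y \<in> carrier (side (free_jordan_pair R X) (opp \<sigma>))" for x y \<sigma>
    using h that by (simp add: pair_homs_def)
  have cl: "jordan_class R X \<sigma> u \<in> carrier (side (free_jordan_pair R X) \<sigma>)"
    if "jordan_term_of R X \<sigma> u" for u \<sigma>
    using that by (simp add: carrier_free_jordan_pair)
  show ?thesis
    using t
  proof induction
    case (1 x \<sigma>)
    then show ?case by (simp add: v)
  next
    case (2 \<sigma>)
    interpret S: module R "side V \<sigma>" by (rule side_module)
    have Z: "jordan_term_of R X \<sigma> JZero" by (rule jordan_term_of.intros)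
    have "jordan_class R X \<sigma> JZero \<oplus>\<^bsub>side (free_jordan_pair R X) \<sigma>\<^esub> jordan_class R X \<sigma> JZero
        = jordan_class R X \<sigma> JZero"
      using Z by (simp add: add_free_jordan_pair jordan_class_eqI[OF jordan_eq.add_zero])
    then have "h \<sigma> (jordan_class R X \<sigma> JZero) \<oplus>\<^bsub>side V \<sigma>\<^esub> h \<sigma> (jordan_class R X \<sigma> JZero)
        = h \<sigma> (jordan_class R X \<sigma> JZero)"
      using linear_mapsD(2)[OF lin cl[OF Z] cl[OF Z]] by simp
    moreover have "h \<sigma> (jordan_class R X \<sigma> JZero) \<in> carrier (side V \<sigma>)"
      by (rule linear_mapsD(1)[OF lin cl[OF Z]])
    ultimately show ?case
      using S.M.add.l_cancel_one by simp
  next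
    case (3 \<sigma> s t)
    then show ?case
      using linear_mapsD(2)[OF lin cl cl] by (simp add: add_free_jordan_pair[symmetric])
  next
    case (4 c \<sigma> t)
    then show ?case
      using linear_mapsD(3)[OF lin _ cl] by (simp add: smult_free_jordan_pair[symmetric])
  next
    case (5 \<sigma> s t)
    then show ?case
      using qd[OF cl cl] by (simp add: quad_free_jordan_pair[symmetric])
  qed
qed

end

section \<open>Reading a Lie polynomial as a triple of Jordan polynomials\<close>

text \<open>A list of pairs \<open>(a, b)\<close> of Jordan polynomials of signs \<open>+\<close> and \<open>-\<close> stands for the Lie polynomial
  \<open>\<Sum> [a, b]\<close> of degree \<open>0\<close>. Its bracket with a Jordan polynomial \<open>z\<close> is again a Jordan polynomial:
  \<open>[[a, b], z]\<close> equals \<open>{a, b, z}\<close> if \<open>z\<close> has sign \<open>+\<close>, and \<open>-[[b, a], z] = -{b, a, z}\<close> if \<open>z\<close> has sign \<open>-\<close>.\<close>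

fun inner_act ::
    "('a, 'r) ring_scheme \<Rightarrow> (('a, 'x) jordan_term \<times> ('a, 'x) jordan_term) list \<Rightarrow> sign
      \<Rightarrow> ('a, 'x) jordan_term \<Rightarrow> ('a, 'x) jordan_term"
  where
  "inner_act R [] \<sigma> z = JZero"
| "inner_act R ((a, b) # Z) Pos z = JAdd (jtriple R a b z) (inner_act R Z Pos z)"
| "inner_act R ((a, b) # Z) Neg z =
    JAdd (JSmult (\<ominus>\<^bsub>R\<^esub> \<one>\<^bsub>R\<^esub>) (jtriple R b a z)) (inner_act R Z Neg z)"

text \<open>The components of degrees \<open>\<plusminus>1\<close>, as a function of the sign, and the component of degree \<open>0\<close>. In the
  clause for \<open>[s, t]\<close> the summand \<open>[s\<^sub>0, t\<^sub>0]\<close> is expanded by the derivation rule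
  \<open>[s\<^sub>0, [c, d]] = [[s\<^sub>0, c], d] + [c, [s\<^sub>0, d]]\<close>, and the summand \<open>[s\<^sub>-\<^sub>1, t\<^sub>1]\<close> is written as
  \<open>[-t\<^sub>1, s\<^sub>-\<^sub>1]\<close> in order to have the factor of sign \<open>+\<close> in front.\<close>

primrec jordan_parts ::
    "('a, 'r) ring_scheme \<Rightarrow> (sign \<Rightarrow> 'x set) \<Rightarrow> ('a, 'x) lie_term
      \<Rightarrow> (sign \<Rightarrow> ('a, 'x) jordan_term) \<times> (('a, 'x) jordan_term \<times> ('a, 'x) jordan_term) list"
  where
  "jordan_parts R X (LVar x) = (\<lambda>\<sigma>. if x \<in> X \<sigma> then JVar x else JZero, [])"
| "jordan_parts R X LZero = (\<lambda>\<sigma>. JZero, [])"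
| "jordan_parts R X (LAdd s t) =
    (let (p, S) = jordan_parts R X s; (q, T) = jordan_parts R X t
     in (\<lambda>\<sigma>. JAdd (p \<sigma>) (q \<sigma>), S @ T))"
| "jordan_parts R X (LSmult c t) =
    (let (q, T) = jordan_parts R X t
     in (\<lambda>\<sigma>. JSmult c (q \<sigma>), map (\<lambda>(a, b). (JSmult c a, b)) T))"
| "jordan_parts R X (LBracket s t) =
    (let (p, S) = jordan_parts R X s; (q, T) = jordan_parts R X t
     in (\<lambda>\<sigma>. JAdd (inner_act R S \<sigma> (q \<sigma>)) (JSmult (\<ominus>\<^bsub>R\<^esub> \<one>\<^bsub>R\<^esub>) (inner_act R T \<sigma> (p \<sigma>))),
       (p Pos, q Neg) # (JSmult (\<ominus>\<^bsub>R\<^esub> \<one>\<^bsub>R\<^esub>) (q Pos), p Neg) #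
       concat (map (\<lambda>(c, d). [(inner_act R S Pos c, d), (c, inner_act R S Neg d)]) T)))"

definition inner_term ::
    "('a, 'r) ring_scheme \<Rightarrow> (sign \<Rightarrow> 'x set) \<Rightarrow> (('a, 'x) jordan_term \<times> ('a, 'x) jordan_term) list \<Rightarrow> bool"
  where "inner_term R X Z \<longleftrightarrow>
    (\<forall>(a, b)\<in>set Z. jordan_term_of R X Pos a \<and> jordan_term_of R X Neg b)"

lemma inner_term_simps [simp]:
  "inner_term R X []"
  "inner_term R X ((a, b) # Z) \<longleftrightarrow>
    jordan_term_of R X Pos a \<and> jordan_term_of R X Neg b \<and> inner_term R X Z"
  "inner_term R X (Z @ Z') \<longleftrightarrow> inner_term R X Z \<and> inner_term R X Z'"
  by (auto simp: inner_term_def)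

context cring
begin

lemma jordan_term_of_inner_act:
  "inner_term R X Z \<Longrightarrow> jordan_term_of R X \<sigma> z \<Longrightarrow> jordan_term_of R X \<sigma> (inner_act R Z \<sigma> z)"
proof (induction Z)
  case (Cons e Z)
  then show ?case
    by (cases e; cases \<sigma>) (auto intro!: jordan_term_of.intros(2-) jordan_term_of_jtriple)
qed (simp add: jordan_term_of.intros)

lemma jordan_parts_are_jordan_terms:
  assumes "t \<in> lie_terms R X" and "jordan_parts R X t = (p, Z)"
  shows "jordan_term_of R X \<sigma> (p \<sigma>) \<and> inner_term R X Z"
  using assms
proof (induction arbitrary: p Z \<sigma>)
  case (3 s t)
  obtain p S q T where st: "jordan_parts R X s = (p, S)" "jordan_parts R X t = (q, T)"
    by (metis surj_pair)
  then show ?case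
    using 3(3)[OF st(1)] 3(4)[OF st(2)] 3(5) by (auto intro!: jordan_term_of.intros(2-))
next
  case (4 c t)
  have "inner_term R X (map (\<lambda>(a, b). (JSmult c a, b)) Z)" if "inner_term R X Z" for Z
    using that 4(1) by (induction Z) (auto intro: jordan_term_of.intros)
  moreover obtain q T where t: "jordan_parts R X t = (q, T)"
    by (metis surj_pair)
  ultimately show ?case
    using 4(3)[OF t] 4(1,4) by (auto simp: t intro!: jordan_term_of.intros(2-))
next
  case (5 s t)
  obtain p S q T where st: "jordan_parts R X s = (p, S)" "jordan_parts R X t = (q, T)"
    by (metis surj_pair)
  have "inner_term R X (concat (map (\<lambda>(c, d). [(inner_act R S Pos c, d),
      (c, inner_act R S Neg d)]) Z))" if "inner_term R X Z" for Z
  proof -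
    have "inner_term R X S"
      using 5(3)[OF st(1)] by blast
    then show ?thesis
      using that by (induction Z) (auto intro: jordan_term_of_inner_act)
  qed
  moreover have "jordan_term_of R X Neg (p Neg)" "jordan_term_of R X Neg (q Neg)"
    using 5(3)[OF st(1)] 5(4)[OF st(2)] by auto
  ultimately show ?case
    using 5(5) 5(3)[OF st(1)] 5(4)[OF st(2)]
    by (auto simp: st intro!: jordan_term_of.intros(2-) jordan_term_of_inner_act)
qed (auto intro: jordan_term_of.intros)

end

context three_graded_lie_algebra
begin

lemma bracket_zero [simp]:
  assumes "x \<in> carrier L"
  shows "bracket L \<zero>\<^bsub>L\<^esub> x = \<zero>\<^bsub>L\<^esub>" "bracket L x \<zero>\<^bsub>L\<^esub> = \<zero>\<^bsub>L\<^esub>"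
  using bracket_smult_left[OF R.zero_closed assms assms]
    bracket_smult_right[OF R.zero_closed assms assms] assms
  by (simp_all add: bracket_closed)

lemma bracket_antisym:
  assumes "x \<in> carrier L" "y \<in> carrier L"
  shows "bracket L y x = \<ominus>\<^bsub>L\<^esub> bracket L x y"
proof -
  have "bracket L (x \<oplus>\<^bsub>L\<^esub> y) (x \<oplus>\<^bsub>L\<^esub> y) = bracket L y x \<oplus>\<^bsub>L\<^esub> bracket L x y"
    using assms by (simp add: bracket_add_left bracket_add_right bracket_self[of x] bracket_self[of y]
        bracket_closed M.a_comm)
  then have "bracket L y x \<oplus>\<^bsub>L\<^esub> bracket L x y = \<zero>\<^bsub>L\<^esub>"
    using assms bracket_self[of "x \<oplus>\<^bsub>L\<^esub> y"] by simp
  then show ?thesis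
    using assms M.minus_equality by (simp add: bracket_closed)
qed

lemma bracket_minus:
  assumes "x \<in> carrier L" "y \<in> carrier L"
  shows "bracket L (\<ominus>\<^bsub>L\<^esub> x) y = \<ominus>\<^bsub>L\<^esub> bracket L x y" "bracket L x (\<ominus>\<^bsub>L\<^esub> y) = \<ominus>\<^bsub>L\<^esub> bracket L x y"
  using bracket_smult_left[of "\<ominus> \<one>" x y] bracket_smult_right[of "\<ominus> \<one>" x y] assms
  by (simp_all add: smult_l_minus bracket_closed)

lemma bracket_bracket_left:
  assumes "x \<in> carrier L" "y \<in> carrier L" "z \<in> carrier L"
  shows "bracket L x (bracket L y z)
    = bracket L (bracket L x y) z \<oplus>\<^bsub>L\<^esub> bracket L y (bracket L x z)"
proof -
  have "bracket L (bracket L x y) z \<oplus>\<^bsub>L\<^esub> bracket L (bracket L y z) x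
      \<oplus>\<^bsub>L\<^esub> bracket L (bracket L z x) y = \<zero>\<^bsub>L\<^esub>"
    using assms by (rule jacobi)
  moreover have "bracket L (bracket L y z) x = \<ominus>\<^bsub>L\<^esub> bracket L x (bracket L y z)"
    using assms by (intro bracket_antisym) (simp_all add: bracket_closed)
  moreover have "bracket L (bracket L z x) y = bracket L y (bracket L x z)"
  proof -
    have "bracket L (bracket L z x) y = \<ominus>\<^bsub>L\<^esub> bracket L y (bracket L z x)"
      using assms by (intro bracket_antisym) (simp_all add: bracket_closed)
    also have "\<dots> = bracket L y (bracket L x z)"
      using assms bracket_antisym[of x z] by (simp add: bracket_closed bracket_minus)
    finally show ?thesis .
  qed
  ultimately have "(bracket L (bracket L x y) z \<oplus>\<^bsub>L\<^esub> bracket L y (bracket L x z))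
      \<oplus>\<^bsub>L\<^esub> \<ominus>\<^bsub>L\<^esub> bracket L x (bracket L y z) = \<zero>\<^bsub>L\<^esub>"
    using assms by (simp add: bracket_closed M.a_ac)
  then show ?thesis
    using assms M.add.inv_solve_right[of "\<zero>\<^bsub>L\<^esub>"] M.add.inv_solve_right'[of "\<zero>\<^bsub>L\<^esub>"]
    by (simp add: bracket_closed)
qed

lemma bracket_same_sign:
  "x \<in> grade L (deg \<sigma>) \<Longrightarrow> y \<in> grade L (deg \<sigma>) \<Longrightarrow> bracket L x y = \<zero>\<^bsub>L\<^esub>"
  using grade_bracket[of x "deg \<sigma>" y "deg \<sigma>"] grade_trivial[of "deg \<sigma> + deg \<sigma>"]
  by (cases \<sigma>) auto

lemma grade_components_unique:
  assumes "a \<in> grade L 1" "b \<in> grade L 0" "c \<in> grade L (-1)"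
    and "a' \<in> grade L 1" "b' \<in> grade L 0" "c' \<in> grade L (-1)"
    and "a \<oplus>\<^bsub>L\<^esub> b \<oplus>\<^bsub>L\<^esub> c = a' \<oplus>\<^bsub>L\<^esub> b' \<oplus>\<^bsub>L\<^esub> c'"
  shows "a = a' \<and> b = b' \<and> c = c'"
proof -
  have "a \<oplus>\<^bsub>L\<^esub> b \<oplus>\<^bsub>L\<^esub> c \<in> carrier L"
    using assms(1-3) by (auto intro: grade_carrier)
  from grade_direct_sum[OF this] have "(a, b, c) = (a', b', c')"
    by (rule ex1E) (use assms in auto)
  then show ?thesis by simp
qed

end

text \<open>A Jordan pair realized on the odd components of a 3-graded Lie algebra. The quadratic operators are
  given by \<open>2 Q\<^sub>x y = [[x, y], x]\<close>, because this is what a computation with commutators yields when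
  \<open>Q\<^sub>x y = x y x\<close> in an associative algebra.\<close>

locale lie_jordan_pair =
  three_graded_lie_algebra R L + V: jordan_pair R V
  for R (structure) and L (structure) and V (structure) +
  assumes half: "\<one> \<oplus> \<one> \<in> Units R"
    and side_carrier: "carrier (side V \<sigma>) = grade L (deg \<sigma>)"
    and side_zero: "\<zero>\<^bsub>side V \<sigma>\<^esub> = \<zero>\<^bsub>L\<^esub>"
    and side_add: "x \<oplus>\<^bsub>side V \<sigma>\<^esub> y = x \<oplus>\<^bsub>L\<^esub> y"
    and side_smult: "c \<odot>\<^bsub>side V \<sigma>\<^esub> x = c \<odot>\<^bsub>L\<^esub> x"
    and quad_double:
      "\<lbrakk>x \<in> grade L (deg \<sigma>); y \<in> grade L (- deg \<sigma>)\<rbrakk> \<Longrightarrow>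
        quad V \<sigma> x y \<oplus>\<^bsub>L\<^esub> quad V \<sigma> x y = bracket L (bracket L x y) x"
begin

lemma double_cancel:
  assumes "x \<in> carrier L" "y \<in> carrier L" and "x \<oplus>\<^bsub>L\<^esub> x = y \<oplus>\<^bsub>L\<^esub> y"
  shows "x = y"
proof -
  have *: "inv (\<one> \<oplus> \<one>) \<odot>\<^bsub>L\<^esub> (z \<oplus>\<^bsub>L\<^esub> z) = z" if "z \<in> carrier L" for z
  proof -
    have "z \<oplus>\<^bsub>L\<^esub> z = (\<one> \<oplus> \<one>) \<odot>\<^bsub>L\<^esub> z"
      using that by (simp add: smult_l_distr)
    then have "inv (\<one> \<oplus> \<one>) \<odot>\<^bsub>L\<^esub> (z \<oplus>\<^bsub>L\<^esub> z) = (inv (\<one> \<oplus> \<one>) \<otimes> (\<one> \<oplus> \<one>)) \<odot>\<^bsub>L\<^esub> z"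
      using that half smult_assoc1[of "inv (\<one> \<oplus> \<one>)" "\<one> \<oplus> \<one>" z] by simp
    also have "\<dots> = z"
      using that half by simp
    finally show ?thesis .
  qed
  show ?thesis
    using *[OF assms(1)] *[OF assms(2)] assms(3) by metis
qed

text \<open>Twice the linearization of \<open>Q\<close> is \<open>[[x, y], z] + [[z, y], x]\<close>, and the two summands agree by the Jacobi
  identity, since \<open>[x, z]\<close> has degree \<open>\<plusminus>2\<close> and vanishes.\<close>

lemma triple_eq_bracket:
  assumes "x \<in> grade L (deg \<sigma>)" "y \<in> grade L (- deg \<sigma>)" "z \<in> grade L (deg \<sigma>)"
  shows "triple V \<sigma> x y z = bracket L (bracket L x y) z"
proof -
  have c [simp]: "x \<in> carrier L" "y \<in> carrier L" "z \<in> carrier L"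
    using assms by (auto intro: grade_carrier)
  have qc [simp]: "quad V \<sigma> u y \<in> carrier L" if "u \<in> grade L (deg \<sigma>)" for u
    using V.quad_closed[of u \<sigma> y] that assms by (auto simp: side_carrier intro: grade_carrier)
  have xz: "x \<oplus>\<^bsub>L\<^esub> z \<in> grade L (deg \<sigma>)"
    using assms by (simp add: grade_add)
  note [simp] = assms xz bracket_closed
  have "triple V \<sigma> x y z \<in> carrier (side V \<sigma>)"
    using assms by (intro V.triple_closed) (simp_all add: side_carrier)
  then have tc [simp]: "triple V \<sigma> x y z \<in> carrier L"
    by (auto simp: side_carrier intro: grade_carrier)
  have "bracket L y (bracket L x z) = \<zero>\<^bsub>L\<^esub>"
    using bracket_same_sign[of x \<sigma> z] by simp
  moreover have "bracket L y (bracket L x z)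
      = \<ominus>\<^bsub>L\<^esub> bracket L (bracket L x y) z \<oplus>\<^bsub>L\<^esub> bracket L (bracket L z y) x"
    using bracket_bracket_left[of y x z] bracket_antisym[of x y] bracket_antisym[of z y]
      bracket_antisym[of x "bracket L z y"] by (simp add: bracket_minus)
  ultimately have comm: "bracket L (bracket L z y) x = bracket L (bracket L x y) z"
    using M.minus_equality[of "bracket L (bracket L z y) x" "\<ominus>\<^bsub>L\<^esub> bracket L (bracket L x y) z"]
    by (simp add: M.a_comm)
  have "triple V \<sigma> x y z \<oplus>\<^bsub>L\<^esub> (quad V \<sigma> x y \<oplus>\<^bsub>L\<^esub> quad V \<sigma> z y) = quad V \<sigma> (x \<oplus>\<^bsub>L\<^esub> z) y"
  proof -
    interpret S: abelian_group "side V \<sigma>" by (rule V.side_abelian_group)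
    have qS: "quad V \<sigma> u y \<in> carrier (side V \<sigma>)" if "u \<in> grade L (deg \<sigma>)" for u
      using V.quad_closed[of u \<sigma> y] that assms by (simp add: side_carrier)
    note qS [of x, simp] qS [of z, simp] qS [of "x \<oplus>\<^bsub>L\<^esub> z", simp]
    have "triple V \<sigma> x y z \<oplus>\<^bsub>side V \<sigma>\<^esub> (quad V \<sigma> x y \<oplus>\<^bsub>side V \<sigma>\<^esub> quad V \<sigma> z y)
        = quad V \<sigma> (x \<oplus>\<^bsub>side V \<sigma>\<^esub> z) y"
      unfolding triple_def side_add[of \<sigma> x z]
      by (simp add: a_minus_def S.a_ac S.r_neg2 S.r_neg S.l_neg)
    then show ?thesis by (simp add: side_add)
  qed
  then have "(triple V \<sigma> x y z \<oplus>\<^bsub>L\<^esub> (quad V \<sigma> x y \<oplus>\<^bsub>L\<^esub> quad V \<sigma> z y)) \<oplus>\<^bsub>L\<^esub>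
      (triple V \<sigma> x y z \<oplus>\<^bsub>L\<^esub> (quad V \<sigma> x y \<oplus>\<^bsub>L\<^esub> quad V \<sigma> z y))
      = bracket L (bracket L (x \<oplus>\<^bsub>L\<^esub> z) y) (x \<oplus>\<^bsub>L\<^esub> z)"
    by (simp add: quad_double)
  then have "(triple V \<sigma> x y z \<oplus>\<^bsub>L\<^esub> triple V \<sigma> x y z) \<oplus>\<^bsub>L\<^esub>
      ((quad V \<sigma> x y \<oplus>\<^bsub>L\<^esub> quad V \<sigma> x y) \<oplus>\<^bsub>L\<^esub> (quad V \<sigma> z y \<oplus>\<^bsub>L\<^esub> quad V \<sigma> z y))
      = (bracket L (bracket L x y) z \<oplus>\<^bsub>L\<^esub> bracket L (bracket L x y) z) \<oplus>\<^bsub>L\<^esub>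
        (bracket L (bracket L x y) x \<oplus>\<^bsub>L\<^esub> bracket L (bracket L z y) z)"
    by (simp add: bracket_add_left bracket_add_right comm M.a_ac)
  then have "triple V \<sigma> x y z \<oplus>\<^bsub>L\<^esub> triple V \<sigma> x y z
      = bracket L (bracket L x y) z \<oplus>\<^bsub>L\<^esub> bracket L (bracket L x y) z"
    unfolding quad_double[OF assms(1,2)] quad_double[OF assms(3,2)]
    by (subst (asm) M.add.right_cancel) (simp only: tc c M.a_closed bracket_closed)+
  then show ?thesis
    by (rule double_cancel[rotated 2]) simp_all
qed

lemma pair_valuation_iff: "pair_valuation X V v \<longleftrightarrow> graded_valuation X L v"
  by (simp add: pair_valuation_def graded_valuation_def side_carrier)

primrec inner_eval :: "('x \<Rightarrow> 'c) \<Rightarrow> (('a, 'x) jordan_term \<times> ('a, 'x) jordan_term) list \<Rightarrow> 'c"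
  where
  "inner_eval v [] = \<zero>\<^bsub>L\<^esub>"
| "inner_eval v (p # Z) =
    bracket L (pair_eval V v (fst p) Pos) (pair_eval V v (snd p) Neg) \<oplus>\<^bsub>L\<^esub> inner_eval v Z"

context
  fixes X v
  assumes v: "graded_valuation X L v"
begin

lemma pair_eval_grade:
  "jordan_term_of R X \<sigma> t \<Longrightarrow> pair_eval V v t \<sigma> \<in> grade L (deg \<sigma>)"
  using V.pair_eval_closed[of X v \<sigma> t] v by (simp add: pair_valuation_iff side_carrier)

lemma pair_eval_carrier:
  "jordan_term_of R X \<sigma> t \<Longrightarrow> pair_eval V v t \<sigma> \<in> carrier L"
  by (rule grade_carrier[OF pair_eval_grade])

lemma inner_eval_grade: "inner_term R X Z \<Longrightarrow> inner_eval v Z \<in> grade L 0"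
proof (induction Z)
  case (Cons p Z)
  then have "bracket L (pair_eval V v (fst p) Pos) (pair_eval V v (snd p) Neg) \<in> grade L (deg Pos + deg Neg)"
    by (intro grade_bracket pair_eval_grade) (auto simp: inner_term_def)
  then show ?case
    using Cons by (auto simp: inner_term_def intro: grade_add)
qed (simp add: grade_zero)

lemma inner_eval_carrier: "inner_term R X Z \<Longrightarrow> inner_eval v Z \<in> carrier L"
  by (rule grade_carrier[OF inner_eval_grade])

lemma inner_eval_append:
  "inner_term R X Z \<Longrightarrow> inner_term R X Z' \<Longrightarrow>
    inner_eval v (Z @ Z') = inner_eval v Z \<oplus>\<^bsub>L\<^esub> inner_eval v Z'"
proof (induction Z)
  case (Cons p Z)
  then show ?case
    by (cases p) (simp add: M.a_assoc bracket_closed pair_eval_carrier inner_eval_carrier)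
qed (simp add: inner_eval_carrier)

lemma pair_eval_jtriple_bracket:
  assumes "jordan_term_of R X \<sigma> x" "jordan_term_of R X (opp \<sigma>) y" "jordan_term_of R X \<sigma> z"
  shows "pair_eval V v (jtriple R x y z) \<sigma>
    = bracket L (bracket L (pair_eval V v x \<sigma>) (pair_eval V v y (opp \<sigma>))) (pair_eval V v z \<sigma>)"
  using assms V.pair_eval_jtriple[of X v \<sigma> x y z] v pair_eval_grade[of "opp \<sigma>" y]
  by (simp add: pair_valuation_iff triple_eq_bracket pair_eval_grade)

lemma pair_eval_inner_act:
  assumes "inner_term R X Z" "jordan_term_of R X \<sigma> z"
  shows "pair_eval V v (inner_act R Z \<sigma> z) \<sigma> = bracket L (inner_eval v Z) (pair_eval V v z \<sigma>)"
  using assms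
proof (induction Z)
  case Nil
  then show ?case by (simp add: side_zero pair_eval_carrier)
next
  case (Cons e Z)
  obtain a b where e: "e = (a, b)" by (cases e)
  show ?case
  proof (cases \<sigma>)
    case Pos
    then show ?thesis using Cons
      by (simp add: e side_add pair_eval_jtriple_bracket bracket_add_left bracket_closed
        pair_eval_carrier inner_eval_carrier)
  next
    case Neg
    then show ?thesis
      using Cons bracket_antisym[of "pair_eval V v b Neg" "pair_eval V v a Pos"]
      by (simp add: e side_add side_smult pair_eval_jtriple_bracket bracket_add_left bracket_closed
        pair_eval_carrier inner_eval_carrier smult_l_minus bracket_minus)
  qed
qed

text \<open>By induction on the expression. For a bracket, of the nine products of homogeneous components those
  of degree \<open>\<plusminus>2\<close> vanish, and the others are the summands collected in \<open>jordan_parts\<close>.\<close>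

lemma lie_eval_eq_jordan_parts:
  assumes X: "polarized X" and "t \<in> lie_terms R X" and "jordan_parts R X t = (p, Z)"
  shows "lie_eval L v t
    = pair_eval V v (p Pos) Pos \<oplus>\<^bsub>L\<^esub> inner_eval v Z \<oplus>\<^bsub>L\<^esub> pair_eval V v (p Neg) Neg"
  using assms(2,3)
proof (induction arbitrary: p Z)
  case (1 x \<sigma>)
  have "v x \<in> carrier L"
    using v 1 by (auto simp: graded_valuation_def intro: grade_carrier)
  then show ?case
    using 1 X by (cases \<sigma>) (auto simp: polarized_def side_zero)
next
  case 2
  then show ?case by (auto simp: side_zero)
next
  case (3 s t)
  obtain p S q T where st: "jordan_parts R X s = (p, S)" "jordan_parts R X t = (q, T)"
    by (metis surj_pair)
  note jt = jordan_parts_are_jordan_terms[OF 3(1) st(1)] jordan_parts_are_jordan_terms[OF 3(2) st(2)]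
  show ?case
    using 3(3)[OF st(1)] 3(4)[OF st(2)] 3(5) jt
    by (auto simp: st side_add inner_eval_append M.a_ac pair_eval_carrier inner_eval_carrier)
next
  case (4 c t)
  obtain q T where t: "jordan_parts R X t = (q, T)"
    by (metis surj_pair)
  note jt = jordan_parts_are_jordan_terms[OF 4(2) t]
  have "inner_eval v (map (\<lambda>(a, b). (JSmult c a, b)) T) = c \<odot>\<^bsub>L\<^esub> inner_eval v T"
    if "inner_term R X T" for T
    using that 4(1)
    by (induction T) (auto simp: side_smult bracket_smult_left smult_r_distr pair_eval_carrier
        inner_eval_carrier bracket_closed)
  then show ?case
    using 4(3)[OF t] 4(4) 4(1) jt
    by (auto simp: t side_smult smult_r_distr pair_eval_carrier inner_eval_carrier)
next
  case (5 s t)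
  obtain p' S q T where st: "jordan_parts R X s = (p', S)" "jordan_parts R X t = (q, T)"
    by (metis surj_pair)
  note js = jordan_parts_are_jordan_terms[OF 5(1) st(1)]
  note jt = jordan_parts_are_jordan_terms[OF 5(2) st(2)]
  define a b c where "a = pair_eval V v (p' Pos) Pos" "b = inner_eval v S" "c = pair_eval V v (p' Neg) Neg"
  define a' b' c' where "a' = pair_eval V v (q Pos) Pos" "b' = inner_eval v T" "c' = pair_eval V v (q Neg) Neg"
  have gr: "a \<in> grade L (deg Pos)" "c \<in> grade L (deg Neg)" "a' \<in> grade L (deg Pos)" "c' \<in> grade L (deg Neg)"
    using js jt by (simp_all only: a_b_c_def a'_b'_c'_def pair_eval_grade)
  have [simp]: "a \<in> carrier L" "b \<in> carrier L" "c \<in> carrier L"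
    "a' \<in> carrier L" "b' \<in> carrier L" "c' \<in> carrier L"
    using js jt by (simp_all add: a_b_c_def a'_b'_c'_def pair_eval_carrier inner_eval_carrier)
  have derivation: "inner_eval v (concat (map (\<lambda>(c, d).
      [(inner_act R S Pos c, d), (c, inner_act R S Neg d)]) T)) = bracket L b (inner_eval v T)"
    if "inner_term R X T" for T
    using that
  proof (induction T)
    case Nil
    then show ?case by simp
  next
    case (Cons e T)
    obtain x y where e: "e = (x, y)" by (cases e)
    show ?case
      using Cons js
      by (simp add: e pair_eval_inner_act a_b_c_def(2)[symmetric] bracket_add_right
        bracket_bracket_left[of b "pair_eval V v x Pos"] M.a_assoc
        pair_eval_carrier inner_eval_carrier bracket_closed)
  qed
  have pa: "pair_eval V v (p Pos) Pos = bracket L b a' \<oplus>\<^bsub>L\<^esub> \<ominus>\<^bsub>L\<^esub> bracket L b' a"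
    "pair_eval V v (p Neg) Neg = bracket L b c' \<oplus>\<^bsub>L\<^esub> \<ominus>\<^bsub>L\<^esub> bracket L b' c"
    using 5(5) js jt by (auto simp: st pair_eval_inner_act side_add side_smult smult_l_minus
        bracket_closed pair_eval_carrier inner_eval_carrier a_b_c_def a'_b'_c'_def)
  have pz: "inner_eval v Z = bracket L a c' \<oplus>\<^bsub>L\<^esub> (\<ominus>\<^bsub>L\<^esub> bracket L a' c \<oplus>\<^bsub>L\<^esub> bracket L b b')"
    using 5(5) js jt by (auto simp: st derivation side_smult smult_l_minus bracket_minus
        bracket_closed pair_eval_carrier inner_eval_carrier a_b_c_def(1,3) a'_b'_c'_def)
  have "lie_eval L v (LBracket s t) = bracket L (a \<oplus>\<^bsub>L\<^esub> b \<oplus>\<^bsub>L\<^esub> c) (a' \<oplus>\<^bsub>L\<^esub> b' \<oplus>\<^bsub>L\<^esub> c')"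
    using 5(3)[OF st(1)] 5(4)[OF st(2)] by (simp add: a_b_c_def a'_b'_c'_def)
  also have "\<dots> = (bracket L b a' \<oplus>\<^bsub>L\<^esub> bracket L a b')
      \<oplus>\<^bsub>L\<^esub> (bracket L a c' \<oplus>\<^bsub>L\<^esub> (bracket L c a' \<oplus>\<^bsub>L\<^esub> bracket L b b'))
      \<oplus>\<^bsub>L\<^esub> (bracket L b c' \<oplus>\<^bsub>L\<^esub> bracket L c b')"
    using bracket_same_sign[OF gr(1,3)] bracket_same_sign[OF gr(2,4)]
    by (simp add: bracket_add_left bracket_add_right bracket_closed M.a_ac)
  also have "\<dots> = pair_eval V v (p Pos) Pos \<oplus>\<^bsub>L\<^esub> inner_eval v Z \<oplus>\<^bsub>L\<^esub> pair_eval V v (p Neg) Neg"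
    unfolding pa pz
    using bracket_antisym[of a b'] bracket_antisym[of b' a] bracket_antisym[of a' c] bracket_antisym[of b' c]
    by (simp add: bracket_closed)
  finally show ?case .
qed

end

end

lemma (in jordan_3_graded_lie_algebra) lie_pair_in_lie: "lie_jordan_pair R L (lie_pair R L)"
proof (intro lie_jordan_pair.intro lie_jordan_pair_axioms.intro)
  fix \<sigma> x y assume "x \<in> grade L (deg \<sigma>)" "y \<in> grade L (- deg \<sigma>)"
  then have "x \<in> carrier L" "y \<in> carrier L"
    by (auto intro: grade_carrier)
  then have c: "bracket L (bracket L x y) x \<in> carrier L"
    by (simp add: bracket_closed)
  have "inv (\<one> \<oplus> \<one>) \<oplus> inv (\<one> \<oplus> \<one>) = inv (\<one> \<oplus> \<one>) \<otimes> (\<one> \<oplus> \<one>)"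
    using half by (simp add: R.r_distr)
  also have "\<dots> = \<one>"
    using half by simp
  finally have "(inv (\<one> \<oplus> \<one>) \<oplus> inv (\<one> \<oplus> \<one>)) \<odot>\<^bsub>L\<^esub> bracket L (bracket L x y) x
      = bracket L (bracket L x y) x"
    using c by simp
  then show "quad (lie_pair R L) \<sigma> x y \<oplus>\<^bsub>L\<^esub> quad (lie_pair R L) \<sigma> x y = bracket L (bracket L x y) x"
    using c half by (simp add: lie_pair_def smult_l_distr)
qed ((rule lie_pair_jordan half three_graded_lie_algebra_axioms)
    | simp add: lie_pair_def module.truncate_def)+

section \<open>Associative algebras and their Jordan pairs\<close>

locale associative_algebra = module R A + A: ring A for R (structure) and A (structure) +
  assumes smult_mult_left:
      "\<lbrakk>c \<in> carrier R; x \<in> carrier A; y \<in> carrier A\<rbrakk> \<Longrightarrow>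
        (c \<odot>\<^bsub>A\<^esub> x) \<otimes>\<^bsub>A\<^esub> y = c \<odot>\<^bsub>A\<^esub> (x \<otimes>\<^bsub>A\<^esub> y)"
    and smult_mult_right:
      "\<lbrakk>c \<in> carrier R; x \<in> carrier A; y \<in> carrier A\<rbrakk> \<Longrightarrow>
        x \<otimes>\<^bsub>A\<^esub> (c \<odot>\<^bsub>A\<^esub> y) = c \<odot>\<^bsub>A\<^esub> (x \<otimes>\<^bsub>A\<^esub> y)"

text \<open>With \<open>Q\<^sub>x y = x y x\<close> the triple product is \<open>{x, y, z} = x y z + z y x\<close>, and each Jordan identity
  becomes an equality between sums of associative words after multiplying out.\<close>

lemma associative_pair_is_jordan_pair:
  fixes R (structure) and A :: "('a, 'c) module" and S :: "sign \<Rightarrow> 'c set"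
  assumes "associative_algebra R A"
    and S: "\<And>\<sigma>. submodule (S \<sigma>) R A"
    and SSS: "\<And>\<sigma> x y z. \<lbrakk>x \<in> S \<sigma>; y \<in> S (opp \<sigma>); z \<in> S \<sigma>\<rbrakk> \<Longrightarrow> x \<otimes>\<^bsub>A\<^esub> y \<otimes>\<^bsub>A\<^esub> z \<in> S \<sigma>"
  defines "V \<equiv> \<lparr>side = (\<lambda>\<sigma>. A\<lparr>carrier := S \<sigma>\<rparr>), quad = (\<lambda>\<sigma> x y. x \<otimes>\<^bsub>A\<^esub> y \<otimes>\<^bsub>A\<^esub> x)\<rparr>"
  shows "jordan_pair R V"
proof -
  interpret associative_algebra R A by fact
  have SA: "x \<in> carrier A" if "x \<in> S \<sigma>" for x \<sigma>
    using submoduleE(1)[OF S] that by blast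
  note S_add = submoduleE(5)[OF S] and S_smult = submoduleE(4)[OF S]
  have V [simp]: "carrier (side V \<sigma>) = S \<sigma>" "x \<oplus>\<^bsub>side V \<sigma>\<^esub> y = x \<oplus>\<^bsub>A\<^esub> y"
    "c \<odot>\<^bsub>side V \<sigma>\<^esub> x = c \<odot>\<^bsub>A\<^esub> x" "quad V \<sigma> x y = x \<otimes>\<^bsub>A\<^esub> y \<otimes>\<^bsub>A\<^esub> x" for \<sigma> x y c
    by (simp_all add: V_def)
  have md: "module R (side V \<sigma>)" for \<sigma>
    using submodule.submodule_is_module[OF S module_axioms] by (simp add: V_def)
  have Q: "x \<otimes>\<^bsub>A\<^esub> y \<otimes>\<^bsub>A\<^esub> x \<in> S \<sigma>" if "x \<in> S \<sigma>" "y \<in> S (opp \<sigma>)" for x y \<sigma>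
    using that by (intro SSS)
  have T: "x \<otimes>\<^bsub>A\<^esub> y \<otimes>\<^bsub>A\<^esub> z \<oplus>\<^bsub>A\<^esub> z \<otimes>\<^bsub>A\<^esub> y \<otimes>\<^bsub>A\<^esub> x \<in> S \<sigma>"
    if "x \<in> S \<sigma>" "y \<in> S (opp \<sigma>)" "z \<in> S \<sigma>" for x y z \<sigma>
    using that by (intro S_add SSS)
  have triple [simp]: "triple V \<sigma> x y z = x \<otimes>\<^bsub>A\<^esub> y \<otimes>\<^bsub>A\<^esub> z \<oplus>\<^bsub>A\<^esub> z \<otimes>\<^bsub>A\<^esub> y \<otimes>\<^bsub>A\<^esub> x"
    if xyz: "x \<in> S \<sigma>" "y \<in> S (opp \<sigma>)" "z \<in> S \<sigma>" for x y z \<sigma>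
  proof -
    interpret S: abelian_group "side V \<sigma>"
      by (rule module.axioms(2)[OF md])
    have [simp]: "x \<in> carrier A" "y \<in> carrier A" "z \<in> carrier A"
      using xyz by (auto intro: SA)
    let ?t = "x \<otimes>\<^bsub>A\<^esub> y \<otimes>\<^bsub>A\<^esub> z \<oplus>\<^bsub>A\<^esub> z \<otimes>\<^bsub>A\<^esub> y \<otimes>\<^bsub>A\<^esub> x"
      and ?q = "x \<otimes>\<^bsub>A\<^esub> y \<otimes>\<^bsub>A\<^esub> x" and ?r = "z \<otimes>\<^bsub>A\<^esub> y \<otimes>\<^bsub>A\<^esub> z"
    have c: "?t \<in> carrier (side V \<sigma>)" "?q \<in> carrier (side V \<sigma>)" "?r \<in> carrier (side V \<sigma>)"
      using T[OF xyz] Q xyz by simp_all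
    have "(x \<oplus>\<^bsub>A\<^esub> z) \<otimes>\<^bsub>A\<^esub> y \<otimes>\<^bsub>A\<^esub> (x \<oplus>\<^bsub>A\<^esub> z) = ?t \<oplus>\<^bsub>A\<^esub> ?q \<oplus>\<^bsub>A\<^esub> ?r"
      by (simp add: A.l_distr A.r_distr A.m_assoc M.a_ac)
    then have "triple V \<sigma> x y z = (?t \<oplus>\<^bsub>side V \<sigma>\<^esub> ?q \<oplus>\<^bsub>side V \<sigma>\<^esub> ?r) \<ominus>\<^bsub>side V \<sigma>\<^esub> ?q \<ominus>\<^bsub>side V \<sigma>\<^esub> ?r"
      by (simp add: triple_def)
    also have "\<dots> = ?t"
    proof -
      have "(t \<oplus>\<^bsub>side V \<sigma>\<^esub> q \<oplus>\<^bsub>side V \<sigma>\<^esub> r) \<ominus>\<^bsub>side V \<sigma>\<^esub> q \<ominus>\<^bsub>side V \<sigma>\<^esub> r = t"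
        if "t \<in> carrier (side V \<sigma>)" "q \<in> carrier (side V \<sigma>)" "r \<in> carrier (side V \<sigma>)" for t q r
      proof -
        have "(t \<oplus>\<^bsub>side V \<sigma>\<^esub> q \<oplus>\<^bsub>side V \<sigma>\<^esub> r) \<ominus>\<^bsub>side V \<sigma>\<^esub> q \<ominus>\<^bsub>side V \<sigma>\<^esub> r
            = t \<oplus>\<^bsub>side V \<sigma>\<^esub> (q \<ominus>\<^bsub>side V \<sigma>\<^esub> q) \<oplus>\<^bsub>side V \<sigma>\<^esub> (r \<ominus>\<^bsub>side V \<sigma>\<^esub> r)"
          using that by (simp del: V add: a_minus_def S.a_ac)
        then show ?thesis
          using that by (simp del: V add: a_minus_def S.r_neg)
      qed
      from this[OF c] show ?thesis .
    qed
    finally show ?thesis .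
  qed
  note eval = V triple Q T SSS S_add S_smult SA A.l_distr A.r_distr A.m_assoc
    smult_mult_left smult_mult_right smult_r_distr smult_assoc1 R.m_closed
  have Q': "x \<otimes>\<^bsub>A\<^esub> (y \<otimes>\<^bsub>A\<^esub> x) \<in> S \<sigma>" if "x \<in> S \<sigma>" "y \<in> S (opp \<sigma>)" for x y \<sigma>
    using Q[OF that] SA that by (simp add: A.m_assoc)
  have T': "x \<otimes>\<^bsub>A\<^esub> (y \<otimes>\<^bsub>A\<^esub> z) \<oplus>\<^bsub>A\<^esub> z \<otimes>\<^bsub>A\<^esub> (y \<otimes>\<^bsub>A\<^esub> x) \<in> S \<sigma>"
    if "x \<in> S \<sigma>" "y \<in> S (opp \<sigma>)" "z \<in> S \<sigma>" for x y z \<sigma>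
    using T[OF that] SA that by (simp add: A.m_assoc)
  show ?thesis
  proof (intro jordan_pair.intro jordan_pair_axioms.intro)
    fix \<sigma> x assume x: "x \<in> carrier (side V \<sigma>)"
    show "quad V \<sigma> x \<in> linear_maps R (side V (opp \<sigma>)) (side V \<sigma>)"
      using x SA[of x \<sigma>] by (auto simp: linear_maps_def eval intro: Q')
    fix y assume y: "y \<in> carrier (side V (opp \<sigma>))"
    show "triple V \<sigma> x y \<in> linear_maps R (side V \<sigma>) (side V \<sigma>)"
      using x y SA[of x \<sigma>] SA[of y "opp \<sigma>"]
      by (auto simp: linear_maps_def eval M.a_ac intro: T')
  next
    fix c \<sigma> x y assume "c \<in> carrier R" "x \<in> carrier (side V \<sigma>)" "y \<in> carrier (side V (opp \<sigma>))"
    then show "quad V \<sigma> (c \<odot>\<^bsub>side V \<sigma>\<^esub> x) y = (c \<otimes> c) \<odot>\<^bsub>side V \<sigma>\<^esub> quad V \<sigma> x y"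
      using SA[of x \<sigma>] SA[of y "opp \<sigma>"] by (simp add: eval)
  next
    fix \<sigma> x w y z
    assume xwyz: "x \<in> carrier (side V \<sigma>)" "w \<in> carrier (side V \<sigma>)"
      "y \<in> carrier (side V (opp \<sigma>))" "z \<in> carrier (side V (opp \<sigma>))"
    then have [simp]: "x \<in> S \<sigma>" "w \<in> S \<sigma>" "y \<in> S (opp \<sigma>)" "z \<in> S (opp \<sigma>)"
      "x \<in> carrier A" "w \<in> carrier A" "y \<in> carrier A" "z \<in> carrier A"
      by (simp_all add: SA[of _ \<sigma>] SA[of _ "opp \<sigma>"])
    have Sy: "u \<otimes>\<^bsub>A\<^esub> v \<otimes>\<^bsub>A\<^esub> u' \<in> S (opp \<sigma>)" if "u \<in> S (opp \<sigma>)" "v \<in> S \<sigma>" "u' \<in> S (opp \<sigma>)" for u v u'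
      using SSS[of u "opp \<sigma>" v u'] that by simp
    have Ty: "triple V (opp \<sigma>) u v u' = u \<otimes>\<^bsub>A\<^esub> v \<otimes>\<^bsub>A\<^esub> u' \<oplus>\<^bsub>A\<^esub> u' \<otimes>\<^bsub>A\<^esub> v \<otimes>\<^bsub>A\<^esub> u"
      if "u \<in> S (opp \<sigma>)" "v \<in> S \<sigma>" "u' \<in> S (opp \<sigma>)" for u v u'
      using triple[of u "opp \<sigma>" v u'] that by simp
    note [simp] = SSS[of _ \<sigma>] Sy S_add Ty
    note expand = A.l_distr A.r_distr A.m_assoc
    show "triple V \<sigma> x y (quad V \<sigma> x z) = quad V \<sigma> x (triple V (opp \<sigma>) y x z)"
      by (simp, simp add: expand M.a_ac)
    show "triple V \<sigma> w y (quad V \<sigma> x z) \<oplus>\<^bsub>side V \<sigma>\<^esub> triple V \<sigma> x y (triple V \<sigma> x z w)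
        = triple V \<sigma> x (triple V (opp \<sigma>) y x z) w \<oplus>\<^bsub>side V \<sigma>\<^esub> quad V \<sigma> x (triple V (opp \<sigma>) y w z)"
      by (simp, simp add: expand M.a_ac)
    show "triple V \<sigma> (quad V \<sigma> x y) y w = triple V \<sigma> x (quad V (opp \<sigma>) y x) w"
      by (simp, simp add: expand M.a_ac)
    show "quad V \<sigma> (quad V \<sigma> x y) z = quad V \<sigma> x (quad V (opp \<sigma>) y (quad V \<sigma> x z))"
      by (simp, simp add: expand M.a_ac)
    show "triple V \<sigma> (quad V \<sigma> x y) z (triple V \<sigma> x y w)
        = quad V \<sigma> x (quad V (opp \<sigma>) y (triple V \<sigma> x z w))
          \<oplus>\<^bsub>side V \<sigma>\<^esub> triple V \<sigma> x (quad V (opp \<sigma>) y (quad V \<sigma> x z)) w"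
      by (simp, simp add: expand M.a_ac)
  qed (simp_all only: R.is_cring md)
qed

context associative_algebra
begin

definition commutator :: "'c \<Rightarrow> 'c \<Rightarrow> 'c"
  where "commutator x y = x \<otimes>\<^bsub>A\<^esub> y \<ominus>\<^bsub>A\<^esub> y \<otimes>\<^bsub>A\<^esub> x"

lemma commutator_closed [simp]:
  "x \<in> carrier A \<Longrightarrow> y \<in> carrier A \<Longrightarrow> commutator x y \<in> carrier A"
  by (simp add: commutator_def)

lemma commutator_laws:
  assumes "x \<in> carrier A" "y \<in> carrier A" "z \<in> carrier A"
  shows "commutator (x \<oplus>\<^bsub>A\<^esub> y) z = commutator x z \<oplus>\<^bsub>A\<^esub> commutator y z"
    and "commutator z (x \<oplus>\<^bsub>A\<^esub> y) = commutator z x \<oplus>\<^bsub>A\<^esub> commutator z y"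
    and "c \<in> carrier R \<Longrightarrow> commutator (c \<odot>\<^bsub>A\<^esub> x) y = c \<odot>\<^bsub>A\<^esub> commutator x y"
    and "c \<in> carrier R \<Longrightarrow> commutator x (c \<odot>\<^bsub>A\<^esub> y) = c \<odot>\<^bsub>A\<^esub> commutator x y"
    and "commutator x x = \<zero>\<^bsub>A\<^esub>"
    and "commutator (commutator x y) z \<oplus>\<^bsub>A\<^esub> commutator (commutator y z) x
      \<oplus>\<^bsub>A\<^esub> commutator (commutator z x) y = \<zero>\<^bsub>A\<^esub>"
proof -
  show "commutator (commutator x y) z \<oplus>\<^bsub>A\<^esub> commutator (commutator y z) x
      \<oplus>\<^bsub>A\<^esub> commutator (commutator z x) y = \<zero>\<^bsub>A\<^esub>"
    using assms unfolding commutator_def by algebra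
qed (use assms in \<open>simp_all add: commutator_def M.minus_eq A.l_distr A.r_distr M.minus_add M.r_neg
  M.a_ac smult_mult_left smult_mult_right smult_r_distr smult_r_minus\<close>)

end

section \<open>Algebras of words\<close>

text \<open>The coefficient of \<open>w\<close> in a product is the sum over all ways to cut \<open>w\<close> into two factors. It is defined
  by recursion on the word, splitting off the cut at the front and absorbing the first letter into the
  left factor otherwise, so that associativity and bilinearity are proved by induction on \<open>w\<close>.\<close>

fun word_conv :: "('a, 'r) ring_scheme \<Rightarrow> ('x list \<Rightarrow> 'a) \<Rightarrow> ('x list \<Rightarrow> 'a) \<Rightarrow> 'x list \<Rightarrow> 'a"
  where
  "word_conv R p q [] = p [] \<otimes>\<^bsub>R\<^esub> q []"
| "word_conv R p q (x # w) = p [] \<otimes>\<^bsub>R\<^esub> q (x # w) \<oplus>\<^bsub>R\<^esub> word_conv R (\<lambda>u. p (x # u)) q w"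

text \<open>The words outside such a set span an ideal of the free associative algebra, and \<open>word_algebra\<close> is the
  quotient by this ideal.\<close>

definition factor_closed :: "'x list set \<Rightarrow> bool"
  where "factor_closed W \<longleftrightarrow> [] \<in> W \<and> (\<forall>u v. u @ v \<in> W \<longrightarrow> u \<in> W \<and> v \<in> W)"

lemma word_conv_cong:
  assumes "\<And>u v. w = u @ v \<Longrightarrow> p u = p' u \<and> q v = q' v"
  shows "word_conv R p q w = word_conv R p' q' w"
  using assms
proof (induction w arbitrary: p p')
  case (Cons x w)
  have "word_conv R (\<lambda>u. p (x # u)) q w = word_conv R (\<lambda>u. p' (x # u)) q' w"
    using Cons.prems by (intro Cons.IH) (metis append_Cons)
  then show ?case
    using Cons.prems[of "[]" "x # w"] by simp
qed simp

context cring
begin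

lemma word_conv_closed [simp]:
  "(\<And>u. p u \<in> carrier R) \<Longrightarrow> (\<And>u. q u \<in> carrier R) \<Longrightarrow> word_conv R p q w \<in> carrier R"
  by (induction w arbitrary: p) auto

lemma word_conv_eq_finsum:
  assumes "\<And>u. p u \<in> carrier R" "\<And>u. q u \<in> carrier R"
  shows "(\<Oplus>i\<in>{..length w}. p (take i w) \<otimes> q (drop i w)) = word_conv R p q w"
  using assms
proof (induction w arbitrary: p)
  case Nil
  then show ?case by simp
next
  case (Cons x w)
  have "(\<Oplus>i\<in>{..length (x # w)}. p (take i (x # w)) \<otimes> q (drop i (x # w)))
      = (\<Oplus>i\<in>{..length w}. p (x # take i w) \<otimes> q (drop i w)) \<oplus> p [] \<otimes> q (x # w)"
    using Cons.prems by (subst length_Cons, subst finsum_Suc2) auto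
  then show ?case
    using Cons.IH[of "\<lambda>u. p (x # u)"] Cons.prems by (simp add: a_comm)
qed

lemma word_conv_add_left:
  assumes "\<And>u. p u \<in> carrier R" "\<And>u. p' u \<in> carrier R" "\<And>u. q u \<in> carrier R"
  shows "word_conv R (\<lambda>u. p u \<oplus> p' u) q w = word_conv R p q w \<oplus> word_conv R p' q w"
  using assms by (induction w arbitrary: p p') (auto simp: l_distr a_ac)

lemma word_conv_add_right:
  assumes "\<And>u. p u \<in> carrier R" "\<And>u. q u \<in> carrier R" "\<And>u. q' u \<in> carrier R"
  shows "word_conv R p (\<lambda>u. q u \<oplus> q' u) w = word_conv R p q w \<oplus> word_conv R p q' w"
  using assms by (induction w arbitrary: p) (auto simp: r_distr a_ac)

lemma word_conv_smult_left:
  assumes "c \<in> carrier R" "\<And>u. p u \<in> carrier R" "\<And>u. q u \<in> carrier R"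
  shows "word_conv R (\<lambda>u. c \<otimes> p u) q w = c \<otimes> word_conv R p q w"
  using assms by (induction w arbitrary: p) (auto simp: r_distr m_assoc)

lemma word_conv_smult_right:
  assumes "c \<in> carrier R" "\<And>u. p u \<in> carrier R" "\<And>u. q u \<in> carrier R"
  shows "word_conv R p (\<lambda>u. c \<otimes> q u) w = c \<otimes> word_conv R p q w"
  using assms by (induction w arbitrary: p) (auto simp: r_distr m_lcomm)

lemma word_conv_assoc:
  assumes "\<And>u. p u \<in> carrier R" "\<And>u. q u \<in> carrier R" "\<And>u. r u \<in> carrier R"
  shows "word_conv R (word_conv R p q) r w = word_conv R p (word_conv R q r) w"
  using assms
proof (induction w arbitrary: p q)
  case Nil
  then show ?case by (simp add: m_assoc)
next
  case (Cons x w)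
  have "word_conv R (\<lambda>u. word_conv R p q (x # u)) r w
      = p [] \<otimes> word_conv R (\<lambda>u. q (x # u)) r w \<oplus> word_conv R (\<lambda>u. p (x # u)) (word_conv R q r) w"
    using Cons.prems Cons.IH[of "\<lambda>u. p (x # u)" q]
    by (simp add: word_conv_add_left word_conv_smult_left)
  then show ?case
    using Cons.prems by (simp add: m_assoc r_distr a_assoc)
qed

lemma word_conv_zero_left:
  "(\<And>u. q u \<in> carrier R) \<Longrightarrow> word_conv R (\<lambda>u. \<zero>) q w = \<zero>"
  by (induction w) auto

lemma word_conv_one_left:
  "(\<And>u. q u \<in> carrier R) \<Longrightarrow> word_conv R (\<lambda>u. if u = [] then \<one> else \<zero>) q w = q w"
  by (cases w) (auto simp: word_conv_zero_left)

lemma word_conv_one_right: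
  "(\<And>u. p u \<in> carrier R) \<Longrightarrow> word_conv R p (\<lambda>u. if u = [] then \<one> else \<zero>) w = p w"
  by (induction w arbitrary: p) auto

lemma word_conv_nonzero:
  assumes "word_conv R p q w \<noteq> \<zero>" "\<And>u. p u \<in> carrier R" "\<And>u. q u \<in> carrier R"
  shows "\<exists>u v. w = u @ v \<and> p u \<noteq> \<zero> \<and> q v \<noteq> \<zero>"
  using assms
proof (induction w arbitrary: p)
  case Nil
  then have "p [] \<noteq> \<zero> \<and> q [] \<noteq> \<zero>" by auto
  then show ?case by simp
next
  case (Cons x w)
  show ?case
  proof (cases "p [] \<otimes> q (x # w) = \<zero>")
    case True
    then have "word_conv R (\<lambda>u. p (x # u)) q w \<noteq> \<zero>"
      using Cons.prems by auto
    from Cons.IH[OF this] Cons.prems obtain u v where "w = u @ v" "p (x # u) \<noteq> \<zero>" "q v \<noteq> \<zero>"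
      by blast
    then show ?thesis by (intro exI[of _ "x # u"] exI[of _ v]) simp
  next
    case False
    then have "p [] \<noteq> \<zero> \<and> q (x # w) \<noteq> \<zero>" using Cons.prems by auto
    then show ?thesis by (intro exI[of _ "[]"] exI[of _ "x # w"]) simp
  qed
qed

end

lemma word_algebra_simps:
  "p \<in> carrier (word_algebra R W) \<longleftrightarrow> (\<forall>w. p w \<in> carrier R) \<and> finite {w. p w \<noteq> \<zero>\<^bsub>R\<^esub>} \<and>
    {w. p w \<noteq> \<zero>\<^bsub>R\<^esub>} \<subseteq> W"
  "p \<oplus>\<^bsub>word_algebra R W\<^esub> q = (\<lambda>w. p w \<oplus>\<^bsub>R\<^esub> q w)"
  "\<zero>\<^bsub>word_algebra R W\<^esub> = (\<lambda>w. \<zero>\<^bsub>R\<^esub>)"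
  "\<one>\<^bsub>word_algebra R W\<^esub> = (\<lambda>w. if w = [] then \<one>\<^bsub>R\<^esub> else \<zero>\<^bsub>R\<^esub>)"
  "c \<odot>\<^bsub>word_algebra R W\<^esub> p = (\<lambda>w. c \<otimes>\<^bsub>R\<^esub> p w)"
  by (simp_all add: word_algebra_def)

lemma word_algebra_coeff_closed:
  "p \<in> carrier (word_algebra R W) \<Longrightarrow> p w \<in> carrier R"
  by (simp add: word_algebra_simps)

lemma (in cring) word_algebra_mult:
  assumes "p \<in> carrier (word_algebra R W)" "q \<in> carrier (word_algebra R W)"
  shows "(p \<otimes>\<^bsub>word_algebra R W\<^esub> q) w = (if w \<in> W then word_conv R p q w else \<zero>)"
  using assms by (simp add: word_algebra_def word_conv_eq_finsum)

lemma (in cring) word_algebra_mult_nonzero: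
  assumes "p \<in> carrier (word_algebra R W)" "q \<in> carrier (word_algebra R W)"
    and "(p \<otimes>\<^bsub>word_algebra R W\<^esub> q) w \<noteq> \<zero>"
  shows "\<exists>u v. w = u @ v \<and> w \<in> W \<and> p u \<noteq> \<zero> \<and> q v \<noteq> \<zero>"
proof -
  have "w \<in> W" "word_conv R p q w \<noteq> \<zero>"
    using assms(3) by (auto simp: word_algebra_mult[OF assms(1,2)] split: if_splits)
  then show ?thesis
    using word_conv_nonzero word_algebra_coeff_closed[OF assms(1)] word_algebra_coeff_closed[OF assms(2)]
    by metis
qed

text \<open>For \<open>w \<in> W\<close> all factors of \<open>w\<close> lie in \<open>W\<close>, so the truncation to \<open>W\<close> does not affect the coefficients
  of the factors and the laws follow from those of the untruncated product.\<close>

lemma (in cring) word_algebra_is_associative_algebra: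
  assumes W: "factor_closed W"
  shows "associative_algebra R (word_algebra R W)"
proof -
  let ?A = "word_algebra R W"
  note simps = word_algebra_simps
  have coeff [simp]: "p w \<in> carrier R" if "p \<in> carrier ?A" for p w
    using that by (rule word_algebra_coeff_closed)
  have add_closed: "p \<oplus>\<^bsub>?A\<^esub> q \<in> carrier ?A" if pq: "p \<in> carrier ?A" "q \<in> carrier ?A" for p q
  proof -
    have "{w. p w \<oplus> q w \<noteq> \<zero>} \<subseteq> {w. p w \<noteq> \<zero>} \<union> {w. q w \<noteq> \<zero>}"
      by auto
    then show ?thesis
      using pq by (auto simp: simps intro: finite_subset)
  qed
  have smult_closed: "c \<odot>\<^bsub>?A\<^esub> p \<in> carrier ?A" if "c \<in> carrier R" "p \<in> carrier ?A" for c p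
  proof -
    have "{w. c \<otimes> p w \<noteq> \<zero>} \<subseteq> {w. p w \<noteq> \<zero>}"
      using that by auto
    then show ?thesis
      using that by (auto simp: simps intro: finite_subset)
  qed
  have ab: "abelian_group ?A"
  proof (rule abelian_groupI)
    fix p assume p: "p \<in> carrier ?A"
    have "(\<ominus> \<one>) \<odot>\<^bsub>?A\<^esub> p \<oplus>\<^bsub>?A\<^esub> p = \<zero>\<^bsub>?A\<^esub>"
      using coeff[OF p] by (simp add: simps l_minus l_neg)
    then show "\<exists>q\<in>carrier ?A. q \<oplus>\<^bsub>?A\<^esub> p = \<zero>\<^bsub>?A\<^esub>"
      using smult_closed[OF _ p, of "\<ominus> \<one>"] by blast
  next
    show "\<zero>\<^bsub>?A\<^esub> \<in> carrier ?A"
      by (simp add: simps)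
  qed ((rule add_closed, assumption+) | simp add: simps(2,3) a_ac)+
  have mult_closed: "p \<otimes>\<^bsub>?A\<^esub> q \<in> carrier ?A" if pq: "p \<in> carrier ?A" "q \<in> carrier ?A" for p q
  proof -
    have "{w. (p \<otimes>\<^bsub>?A\<^esub> q) w \<noteq> \<zero>} \<subseteq> (\<lambda>(u, v). u @ v) ` ({u. p u \<noteq> \<zero>} \<times> {v. q v \<noteq> \<zero>})"
      using word_algebra_mult_nonzero[OF pq] by auto
    moreover have "finite ({u. p u \<noteq> \<zero>} \<times> {v. q v \<noteq> \<zero>})"
      using pq by (simp add: simps)
    ultimately have "finite {w. (p \<otimes>\<^bsub>?A\<^esub> q) w \<noteq> \<zero>}"
      by (rule finite_subset[OF _ finite_imageI])
    then show ?thesis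
      using word_algebra_mult_nonzero[OF pq] coeff[OF pq(1)] coeff[OF pq(2)]
      by (auto simp: simps(1) word_algebra_mult[OF pq])
  qed
  have one_closed: "\<one>\<^bsub>?A\<^esub> \<in> carrier ?A"
    using W by (auto simp: simps factor_closed_def)
  have mult: "(p \<otimes>\<^bsub>?A\<^esub> q) w = (if w \<in> W then word_conv R p q w else \<zero>)"
    if "p \<in> carrier ?A" "q \<in> carrier ?A" for p q w
    using that by (rule word_algebra_mult)
  have "monoid ?A"
  proof (rule monoidI)
    fix p q r assume pqr: "p \<in> carrier ?A" "q \<in> carrier ?A" "r \<in> carrier ?A"
    note coeffs = coeff[OF pqr(1)] coeff[OF pqr(2)] coeff[OF pqr(3)]
    show "p \<otimes>\<^bsub>?A\<^esub> q \<otimes>\<^bsub>?A\<^esub> r = p \<otimes>\<^bsub>?A\<^esub> (q \<otimes>\<^bsub>?A\<^esub> r)"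
    proof
      fix w
      show "(p \<otimes>\<^bsub>?A\<^esub> q \<otimes>\<^bsub>?A\<^esub> r) w = (p \<otimes>\<^bsub>?A\<^esub> (q \<otimes>\<^bsub>?A\<^esub> r)) w"
      proof (cases "w \<in> W")
        case True
        then have fac: "u \<in> W \<and> v \<in> W" if "w = u @ v" for u v
          using W that unfolding factor_closed_def by blast
        have "word_conv R (p \<otimes>\<^bsub>?A\<^esub> q) r w = word_conv R (word_conv R p q) r w"
          by (rule word_conv_cong) (use fac in \<open>simp add: mult pqr\<close>)
        moreover have "word_conv R p (q \<otimes>\<^bsub>?A\<^esub> r) w = word_conv R p (word_conv R q r) w"
          by (rule word_conv_cong) (use fac in \<open>simp add: mult pqr\<close>)
        ultimately show ?thesis
          using word_conv_assoc[OF coeffs, where w = w] True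
          by (simp only: mult[OF mult_closed[OF pqr(1,2)] pqr(3)]
              mult[OF pqr(1) mult_closed[OF pqr(2,3)]])
      qed (simp add: mult mult_closed pqr)
    qed
  next
    fix p assume p: "p \<in> carrier ?A"
    then have z: "p w = \<zero>" if "w \<notin> W" for w
      using that by (auto simp: simps)
    show "\<one>\<^bsub>?A\<^esub> \<otimes>\<^bsub>?A\<^esub> p = p"
    proof
      fix w
      have "word_conv R \<one>\<^bsub>?A\<^esub> p w = p w"
        unfolding simps(4) by (rule word_conv_one_left) (rule coeff[OF p])
      then show "(\<one>\<^bsub>?A\<^esub> \<otimes>\<^bsub>?A\<^esub> p) w = p w"
        using z[of w] by (simp add: mult[OF one_closed p])
    qed
    show "p \<otimes>\<^bsub>?A\<^esub> \<one>\<^bsub>?A\<^esub> = p"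
    proof
      fix w
      have "word_conv R p \<one>\<^bsub>?A\<^esub> w = p w"
        unfolding simps(4) by (rule word_conv_one_right) (rule coeff[OF p])
      then show "(p \<otimes>\<^bsub>?A\<^esub> \<one>\<^bsub>?A\<^esub>) w = p w"
        using z[of w] by (simp add: mult[OF p one_closed])
    qed
  qed (simp_all add: one_closed mult_closed)
  moreover have "(p \<oplus>\<^bsub>?A\<^esub> q) \<otimes>\<^bsub>?A\<^esub> r = p \<otimes>\<^bsub>?A\<^esub> r \<oplus>\<^bsub>?A\<^esub> q \<otimes>\<^bsub>?A\<^esub> r"
    "r \<otimes>\<^bsub>?A\<^esub> (p \<oplus>\<^bsub>?A\<^esub> q) = r \<otimes>\<^bsub>?A\<^esub> p \<oplus>\<^bsub>?A\<^esub> r \<otimes>\<^bsub>?A\<^esub> q"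
    if "p \<in> carrier ?A" "q \<in> carrier ?A" "r \<in> carrier ?A" for p q r
  proof -
    note c = coeff[OF that(1)] coeff[OF that(2)] coeff[OF that(3)]
    have l: "word_conv R (p \<oplus>\<^bsub>?A\<^esub> q) r w = word_conv R p r w \<oplus> word_conv R q r w"
      and r: "word_conv R r (p \<oplus>\<^bsub>?A\<^esub> q) w = word_conv R r p w \<oplus> word_conv R r q w" for w
      unfolding simps(2) by (rule word_conv_add_left[OF c] word_conv_add_right[OF c(3,1,2)])+
    show "(p \<oplus>\<^bsub>?A\<^esub> q) \<otimes>\<^bsub>?A\<^esub> r = p \<otimes>\<^bsub>?A\<^esub> r \<oplus>\<^bsub>?A\<^esub> q \<otimes>\<^bsub>?A\<^esub> r"
    proof
      fix w
      show "((p \<oplus>\<^bsub>?A\<^esub> q) \<otimes>\<^bsub>?A\<^esub> r) w = (p \<otimes>\<^bsub>?A\<^esub> r \<oplus>\<^bsub>?A\<^esub> q \<otimes>\<^bsub>?A\<^esub> r) w"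
        unfolding mult[OF add_closed[OF that(1,2)] that(3)] l
        by (simp add: simps(2) mult that)
    qed
    show "r \<otimes>\<^bsub>?A\<^esub> (p \<oplus>\<^bsub>?A\<^esub> q) = r \<otimes>\<^bsub>?A\<^esub> p \<oplus>\<^bsub>?A\<^esub> r \<otimes>\<^bsub>?A\<^esub> q"
    proof
      fix w
      show "(r \<otimes>\<^bsub>?A\<^esub> (p \<oplus>\<^bsub>?A\<^esub> q)) w = (r \<otimes>\<^bsub>?A\<^esub> p \<oplus>\<^bsub>?A\<^esub> r \<otimes>\<^bsub>?A\<^esub> q) w"
        unfolding mult[OF that(3) add_closed[OF that(1,2)]] r
        by (simp add: simps(2) mult that)
    qed
  qed
  ultimately have "ring ?A"
    using ab by (intro ringI) auto
  moreover have "module R ?A"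
    by (rule moduleI[OF is_cring ab])
      ((rule smult_closed, assumption+) | simp add: simps(2,5) l_distr r_distr m_assoc)+
  moreover have "associative_algebra_axioms R ?A"
  proof (rule associative_algebra_axioms.intro)
    fix c p q assume c: "c \<in> carrier R" and p: "p \<in> carrier ?A" and q: "q \<in> carrier ?A"
    show "(c \<odot>\<^bsub>?A\<^esub> p) \<otimes>\<^bsub>?A\<^esub> q = c \<odot>\<^bsub>?A\<^esub> (p \<otimes>\<^bsub>?A\<^esub> q)"
    proof
      fix w
      have "word_conv R (c \<odot>\<^bsub>?A\<^esub> p) q w = c \<otimes> word_conv R p q w"
        unfolding simps(5) by (rule word_conv_smult_left[OF c coeff[OF p] coeff[OF q]])
      then show "((c \<odot>\<^bsub>?A\<^esub> p) \<otimes>\<^bsub>?A\<^esub> q) w = (c \<odot>\<^bsub>?A\<^esub> (p \<otimes>\<^bsub>?A\<^esub> q)) w"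
        unfolding mult[OF smult_closed[OF c p] q] simps(5)[where c = c and p = "p \<otimes>\<^bsub>?A\<^esub> q"] mult[OF p q]
        using c by (cases "w \<in> W") (simp_all only: if_True if_False r_null)
    qed
    show "p \<otimes>\<^bsub>?A\<^esub> (c \<odot>\<^bsub>?A\<^esub> q) = c \<odot>\<^bsub>?A\<^esub> (p \<otimes>\<^bsub>?A\<^esub> q)"
    proof
      fix w
      have "word_conv R p (c \<odot>\<^bsub>?A\<^esub> q) w = c \<otimes> word_conv R p q w"
        unfolding simps(5) by (rule word_conv_smult_right[OF c coeff[OF p] coeff[OF q]])
      then show "(p \<otimes>\<^bsub>?A\<^esub> (c \<odot>\<^bsub>?A\<^esub> q)) w = (c \<odot>\<^bsub>?A\<^esub> (p \<otimes>\<^bsub>?A\<^esub> q)) w"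
        unfolding mult[OF p smult_closed[OF c q]] simps(5)[where c = c and p = "p \<otimes>\<^bsub>?A\<^esub> q"] mult[OF p q]
        using c by (cases "w \<in> W") (simp_all only: if_True if_False r_null)
    qed
  qed
  ultimately show ?thesis
    by (intro associative_algebra.intro)
qed

section \<open>Alternating words\<close>

definition letter_sign :: "(sign \<Rightarrow> 'x set) \<Rightarrow> 'x \<Rightarrow> sign"
  where "letter_sign X x = (if x \<in> X Pos then Pos else Neg)"

lemma letter_sign_iff:
  assumes "polarized X" "x \<in> X Pos \<union> X Neg"
  shows "x \<in> X \<sigma> \<longleftrightarrow> letter_sign X x = \<sigma>"
  using assms by (cases \<sigma>) (auto simp: letter_sign_def polarized_def)

lemma word_degree_simps [simp]:
  "word_degree X [] = 0"
  "word_degree X (x # w) = deg (letter_sign X x) + word_degree X w"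
  "word_degree X (u @ v) = word_degree X u + word_degree X v"
  by (simp_all add: word_degree_def letter_sign_def)

lemma Nil_alternating [simp]: "[] \<in> alternating_words X"
  by (simp add: alternating_words_def)

lemma singleton_alternating: "[x] \<in> alternating_words X \<longleftrightarrow> x \<in> X Pos \<union> X Neg"
  by (simp add: alternating_words_def)

lemma alternating_factors:
  assumes "u @ v \<in> alternating_words X"
  shows "u \<in> alternating_words X" "v \<in> alternating_words X"
proof -
  have *: "\<not> ((u @ v) ! i \<in> X \<sigma> \<and> (u @ v) ! Suc i \<in> X \<sigma>)" if "Suc i < length (u @ v)" for i \<sigma>
    using assms that unfolding alternating_words_def by blast
  have "\<not> (u ! i \<in> X \<sigma> \<and> u ! Suc i \<in> X \<sigma>)" if "Suc i < length u" for i \<sigma>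
    using *[of i \<sigma>] that by (simp add: nth_append)
  moreover have "\<not> (v ! i \<in> X \<sigma> \<and> v ! Suc i \<in> X \<sigma>)" if "Suc i < length v" for i \<sigma>
    using *[of "length u + i" \<sigma>] that by (simp add: nth_append)
  ultimately show "u \<in> alternating_words X" "v \<in> alternating_words X"
    using assms unfolding alternating_words_def by auto
qed

lemma alternating_letter:
  "w \<in> alternating_words X \<Longrightarrow> x \<in> set w \<Longrightarrow> x \<in> X Pos \<union> X Neg"
  unfolding alternating_words_def by blast

lemma factor_closed_alternating_words: "factor_closed (alternating_words X)"
  using alternating_factors by (auto simp: factor_closed_def)

text \<open>Only the junction of the two factors imposes a new condition.\<close>

lemma alternating_append_iff:
  assumes X: "polarized X" and "u \<noteq> []" "v \<noteq> []"
  shows "u @ v \<in> alternating_words X \<longleftrightarrow> u \<in> alternating_words X \<and> v \<in> alternating_words X \<and>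
    letter_sign X (last u) \<noteq> letter_sign X (hd v)"
proof safe
  assume uv: "u @ v \<in> alternating_words X"
  then show "u \<in> alternating_words X" "v \<in> alternating_words X"
    by (rule alternating_factors)+
  assume eq: "letter_sign X (last u) = letter_sign X (hd v)"
  have letters: "last u \<in> X Pos \<union> X Neg" "hd v \<in> X Pos \<union> X Neg"
    using assms(2,3) alternating_letter[OF uv] by auto
  have "\<not> ((u @ v) ! (length u - 1) \<in> X \<sigma> \<and> (u @ v) ! Suc (length u - 1) \<in> X \<sigma>)" for \<sigma>
  proof -
    have "Suc (length u - 1) < length (u @ v)" using assms(2,3) by simp
    then show ?thesis using uv unfolding alternating_words_def by blast
  qed
  then have "\<not> (last u \<in> X \<sigma> \<and> hd v \<in> X \<sigma>)" for \<sigma>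
    using assms(2,3) by (simp add: nth_append last_conv_nth hd_conv_nth)
  then show False
    using letters eq letter_sign_iff[OF X letters(1)] letter_sign_iff[OF X letters(2)] by blast
next
  assume u: "u \<in> alternating_words X" and v: "v \<in> alternating_words X"
    and neq: "letter_sign X (last u) \<noteq> letter_sign X (hd v)"
  have letters: "last u \<in> X Pos \<union> X Neg" "hd v \<in> X Pos \<union> X Neg"
    using assms(2,3) alternating_letter[OF u] alternating_letter[OF v] by auto
  have "\<not> ((u @ v) ! i \<in> X \<sigma> \<and> (u @ v) ! Suc i \<in> X \<sigma>)" if i: "Suc i < length (u @ v)" for i \<sigma>
  proof -
    consider "Suc i < length u" | "Suc i = length u" | "length u \<le> i"
      by linarith
    then show ?thesis
    proof cases
      case 1
      then show ?thesis using u by (auto simp: alternating_words_def nth_append)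
    next
      case 2
      then have "i = length u - 1"
        by simp
      then have "(u @ v) ! i = last u" "(u @ v) ! Suc i = hd v"
        using assms(2,3) by (simp_all add: nth_append last_conv_nth hd_conv_nth)
      then show ?thesis
        using neq letter_sign_iff[OF X letters(1)] letter_sign_iff[OF X letters(2)] by auto
    next
      case 3
      then have "Suc (i - length u) < length v" "(u @ v) ! i = v ! (i - length u)"
        "(u @ v) ! Suc i = v ! Suc (i - length u)"
        using i by (auto simp: nth_append Suc_diff_le)
      then show ?thesis using v unfolding alternating_words_def by auto
    qed
  qed
  then show "u @ v \<in> alternating_words X"
    using u v unfolding alternating_words_def by auto
qed

text \<open>Signs alternate along the word and cancel in pairs.\<close>

lemma alternating_word_degree:
  assumes X: "polarized X" and "w \<in> alternating_words X" "w \<noteq> []"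
  shows "word_degree X w = (if even (length w) then 0 else deg (letter_sign X (hd w)))"
    and "letter_sign X (last w)
      = (if even (length w) then opp (letter_sign X (hd w)) else letter_sign X (hd w))"
  using assms(2,3)
proof (induction w)
  case (Cons x w)
  {
    case 1
    show ?case
    proof (cases "w = []")
      case False
      then have "w \<in> alternating_words X" "letter_sign X x \<noteq> letter_sign X (hd w)"
        using 1 alternating_append_iff[OF X, of "[x]" w] by auto
      moreover from this(2) have "letter_sign X (hd w) = opp (letter_sign X x)"
        by (cases "letter_sign X x"; cases "letter_sign X (hd w)") auto
      ultimately show ?thesis
        using Cons.IH(1) False by simp
    qed simp
  next
    case 2
    show ?case
    proof (cases "w = []")
      case False
      then have "w \<in> alternating_words X" "letter_sign X x \<noteq> letter_sign X (hd w)"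
        using 2 alternating_append_iff[OF X, of "[x]" w] by auto
      moreover from this(2) have "letter_sign X (hd w) = opp (letter_sign X x)"
        by (cases "letter_sign X x"; cases "letter_sign X (hd w)") auto
      ultimately show ?thesis
        using Cons.IH(2) False by simp
    qed simp
  }
qed simp_all

lemma alternating_degree_range:
  assumes "polarized X" "w \<in> alternating_words X"
  shows "word_degree X w \<in> {-1, 0, 1}"
  using alternating_word_degree(1)[OF assms]
  by (cases "w = []"; cases "letter_sign X (hd w)") auto

lemma alternating_degree_eq_deg_iff:
  assumes X: "polarized X" and w: "w \<in> alternating_words X"
  shows "word_degree X w = deg \<sigma> \<longleftrightarrow> odd (length w) \<and> hd w \<in> X \<sigma> \<and> last w \<in> X \<sigma>"
proof (cases "w = []")
  case True
  then show ?thesis by (cases \<sigma>) auto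
next
  case False
  have letters: "hd w \<in> X Pos \<union> X Neg" "last w \<in> X Pos \<union> X Neg"
    using False alternating_letter[OF w] by auto
  have "deg \<tau> = deg \<sigma> \<longleftrightarrow> \<tau> = \<sigma>" "deg \<sigma> \<noteq> 0" for \<tau>
    by (cases \<tau>; cases \<sigma>; simp)+
  then show ?thesis
    using alternating_word_degree[OF X w False] letter_sign_iff[OF X letters(1)]
      letter_sign_iff[OF X letters(2)] by auto
qed

definition ass_grade :: "('a, 'r) ring_scheme \<Rightarrow> (sign \<Rightarrow> 'x set) \<Rightarrow> int \<Rightarrow> ('x list \<Rightarrow> 'a) set"
  where "ass_grade R X k =
    {p \<in> carrier (ass R X). \<forall>w. p w \<noteq> \<zero>\<^bsub>R\<^esub> \<longrightarrow> word_degree X w = k}"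

lemma ass_minus_simps [simp]:
  "carrier (ass_minus R X) = carrier (ass R X)"
  "p \<oplus>\<^bsub>ass_minus R X\<^esub> q = p \<oplus>\<^bsub>ass R X\<^esub> q"
  "\<zero>\<^bsub>ass_minus R X\<^esub> = \<zero>\<^bsub>ass R X\<^esub>"
  "c \<odot>\<^bsub>ass_minus R X\<^esub> p = c \<odot>\<^bsub>ass R X\<^esub> p"
  "bracket (ass_minus R X) p q = p \<otimes>\<^bsub>ass R X\<^esub> q \<ominus>\<^bsub>ass R X\<^esub> q \<otimes>\<^bsub>ass R X\<^esub> p"
  "grade (ass_minus R X) k = ass_grade R X k"
  by (simp_all add: ass_minus_def ass_grade_def lie.defs module.defs graded_lie.defs)

text \<open>An alternating word starts and ends with letters of sign \<open>\<sigma>\<close> exactly when it has degree \<open>deg \<sigma>\<close>, so the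
  sides of the special Jordan pair are the odd components of \<open>ass_minus\<close>.\<close>

lemma special_jordan_pair_eq:
  assumes X: "polarized X"
  shows "special_jordan_pair R X =
    \<lparr>side = (\<lambda>\<sigma>. (ass R X)\<lparr>carrier := ass_grade R X (deg \<sigma>)\<rparr>),
     quad = (\<lambda>\<sigma> x y. x \<otimes>\<^bsub>ass R X\<^esub> y \<otimes>\<^bsub>ass R X\<^esub> x)\<rparr>"
proof -
  have "{p \<in> carrier (ass R X). \<forall>w. p w \<noteq> \<zero>\<^bsub>R\<^esub> \<longrightarrow> odd (length w) \<and> hd w \<in> X \<sigma> \<and> last w \<in> X \<sigma>}
      = ass_grade R X (deg \<sigma>)" for \<sigma>
    using alternating_degree_eq_deg_iff[OF X]
    unfolding ass_grade_def ass_def word_algebra_simps by blast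
  then show ?thesis
    by (simp add: special_jordan_pair_def)
qed

context cring
begin

lemma ass_is_associative_algebra: "associative_algebra R (ass R X)"
  unfolding ass_def by (rule word_algebra_is_associative_algebra[OF factor_closed_alternating_words])

lemma ass_grade_mult:
  assumes p: "p \<in> ass_grade R X i" and q: "q \<in> ass_grade R X j"
  shows "p \<otimes>\<^bsub>ass R X\<^esub> q \<in> ass_grade R X (i + j)"
proof -
  interpret A: associative_algebra R "ass R X"
    by (rule ass_is_associative_algebra)
  have c: "p \<in> carrier (ass R X)" "q \<in> carrier (ass R X)"
    using p q by (simp_all add: ass_grade_def)
  have "word_degree X w = i + j" if nz: "(p \<otimes>\<^bsub>ass R X\<^esub> q) w \<noteq> \<zero>" for w
  proof -
    obtain u v where "w = u @ v" "p u \<noteq> \<zero>" "q v \<noteq> \<zero>"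
      using word_algebra_mult_nonzero[OF c[unfolded ass_def] nz[unfolded ass_def]] by blast
    then show ?thesis
      using p q by (simp add: ass_grade_def)
  qed
  then show ?thesis
    using c by (simp add: ass_grade_def)
qed

lemma ass_simps:
  "p \<oplus>\<^bsub>ass R X\<^esub> q = (\<lambda>w. p w \<oplus> q w)"
  "\<zero>\<^bsub>ass R X\<^esub> = (\<lambda>w. \<zero>)"
  "c \<odot>\<^bsub>ass R X\<^esub> p = (\<lambda>w. c \<otimes> p w)"
  by (simp_all add: ass_def word_algebra_simps)

lemma ass_coeff_closed: "p \<in> carrier (ass R X) \<Longrightarrow> p w \<in> carrier R"
  unfolding ass_def by (rule word_algebra_coeff_closed)

lemma ass_grade_submodule: "submodule (ass_grade R X k) R (ass R X)"
proof -
  interpret A: associative_algebra R "ass R X"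
    by (rule ass_is_associative_algebra)
  have smult: "c \<odot>\<^bsub>ass R X\<^esub> p \<in> ass_grade R X k" if "c \<in> carrier R" "p \<in> ass_grade R X k" for c p
  proof -
    have "p w \<noteq> \<zero>" if "c \<otimes> p w \<noteq> \<zero>" for w
      using that \<open>c \<in> carrier R\<close> by auto
    moreover have "c \<odot>\<^bsub>ass R X\<^esub> p \<in> carrier (ass R X)"
      using that by (simp add: ass_grade_def)
    ultimately show ?thesis
      using that(2) by (simp add: ass_grade_def) (simp add: ass_simps(3))
  qed
  show ?thesis
  proof (rule A.submoduleI)
    show "ass_grade R X k \<subseteq> carrier (ass R X)" "\<zero>\<^bsub>ass R X\<^esub> \<in> ass_grade R X k"
      by (auto simp: ass_grade_def ass_simps(2)[symmetric]) (simp add: ass_simps(2))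
  next
    fix p assume p: "p \<in> ass_grade R X k"
    then have "\<ominus>\<^bsub>ass R X\<^esub> p = (\<ominus> \<one>) \<odot>\<^bsub>ass R X\<^esub> p"
      by (simp add: A.smult_l_minus ass_grade_def)
    then show "\<ominus>\<^bsub>ass R X\<^esub> p \<in> ass_grade R X k"
      using smult[OF _ p] by simp
  next
    fix p q assume pq: "p \<in> ass_grade R X k" "q \<in> ass_grade R X k"
    have "p w \<noteq> \<zero> \<or> q w \<noteq> \<zero>" if "p w \<oplus> q w \<noteq> \<zero>" for w
      using that by auto
    moreover have "p \<oplus>\<^bsub>ass R X\<^esub> q \<in> carrier (ass R X)"
      using pq by (simp add: ass_grade_def)
    ultimately show "p \<oplus>\<^bsub>ass R X\<^esub> q \<in> ass_grade R X k"
      using pq by (simp add: ass_grade_def) (auto simp: ass_simps(1))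
  qed (rule smult)
qed

lemma ass_grade_trivial:
  assumes "polarized X" "k \<notin> {-1, 0, 1}"
  shows "ass_grade R X k = {\<zero>\<^bsub>ass R X\<^esub>}"
proof -
  have "p = \<zero>\<^bsub>ass R X\<^esub>" if "p \<in> ass_grade R X k" for p
  proof
    fix w
    have "w \<in> alternating_words X \<and> word_degree X w = k" if "p w \<noteq> \<zero>"
      using that \<open>p \<in> _\<close> by (auto simp: ass_grade_def ass_def word_algebra_simps)
    then show "p w = \<zero>\<^bsub>ass R X\<^esub> w"
      using alternating_degree_range[OF assms(1), of w] assms(2) by (auto simp: ass_simps(2))
  qed
  moreover have "\<zero>\<^bsub>ass R X\<^esub> \<in> ass_grade R X k"
    using subgroup.one_closed[OF submodule.axioms(1)[OF ass_grade_submodule[of X k]]] by simp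
  ultimately show ?thesis by blast
qed

lemma special_jordan_pair_is_jordan_pair:
  assumes "polarized X"
  shows "jordan_pair R (special_jordan_pair R X)"
  unfolding special_jordan_pair_eq[OF assms]
proof (rule associative_pair_is_jordan_pair[OF ass_is_associative_algebra ass_grade_submodule])
  fix \<sigma> x y z
  assume "x \<in> ass_grade R X (deg \<sigma>)" "y \<in> ass_grade R X (deg (opp \<sigma>))" "z \<in> ass_grade R X (deg \<sigma>)"
  then show "x \<otimes>\<^bsub>ass R X\<^esub> y \<otimes>\<^bsub>ass R X\<^esub> z \<in> ass_grade R X (deg \<sigma>)"
    using ass_grade_mult[OF ass_grade_mult, of x X "deg \<sigma>" y "deg (opp \<sigma>)" z "deg \<sigma>"] by simp
qed

lemma ass_minus_is_lie_algebra: "lie_algebra R (ass_minus R X)"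
proof -
  interpret A: associative_algebra R "ass R X"
    by (rule ass_is_associative_algebra)
  have br: "bracket (ass_minus R X) = A.commutator"
    by (intro ext) (simp add: A.commutator_def)
  show ?thesis
  proof (rule lie_algebra.intro)
    show "module R (ass_minus R X)"
    proof (rule moduleI[OF is_cring])
      show "abelian_group (ass_minus R X)"
        using abelian_groupE[OF A.M.abelian_group_axioms]
        by (intro abelian_groupI) (simp_all)
    qed (simp_all add: A.smult_l_distr A.smult_r_distr A.smult_assoc1)
    show "lie_algebra_axioms R (ass_minus R X)"
      unfolding lie_algebra_axioms_def br using A.commutator_laws by simp
  qed
qed

lemma ass_minus_is_three_graded:
  assumes X: "polarized X"
  shows "three_graded_lie_algebra R (ass_minus R X)"
proof -
  interpret A: associative_algebra R "ass R X"
    by (rule ass_is_associative_algebra)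
  interpret L: lie_algebra R "ass_minus R X"
    by (rule ass_minus_is_lie_algebra)
  show ?thesis
  proof (intro three_graded_lie_algebra.intro three_graded_lie_algebra_axioms.intro)
    show "lie_algebra R (ass_minus R X)"
      by (rule ass_minus_is_lie_algebra)
    show "submodule (grade (ass_minus R X) k) R (ass_minus R X)" for k
    proof (rule L.submoduleI)
      fix p assume p: "p \<in> grade (ass_minus R X) k"
      then have "\<ominus>\<^bsub>ass_minus R X\<^esub> p = (\<ominus> \<one>) \<odot>\<^bsub>ass_minus R X\<^esub> p"
        using L.smult_l_minus[of \<one> p] L.smult_one[of p] by (simp add: ass_grade_def)
      then show "\<ominus>\<^bsub>ass_minus R X\<^esub> p \<in> grade (ass_minus R X) k"
        using p A.submoduleE(4)[OF ass_grade_submodule[of X k], of "\<ominus> \<one>" p] by simp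
    qed (use A.submoduleE[OF ass_grade_submodule[of X k]] 
          subgroup.one_closed[OF submodule.axioms(1)[OF ass_grade_submodule[of X k]]] in auto)
    show "grade (ass_minus R X) k = {\<zero>\<^bsub>ass_minus R X\<^esub>}" if "k \<notin> {-1, 0, 1}" for k
      using ass_grade_trivial[OF X that] by simp
  next
    fix p assume "p \<in> carrier (ass_minus R X)"
    then have p: "p \<in> carrier (ass R X)" by simp
    define r where "r k = (\<lambda>w. if word_degree X w = k then p w else \<zero>)" for k
    have r: "r k \<in> ass_grade R X k" for k
    proof -
      have "{w. r k w \<noteq> \<zero>} \<subseteq> {w. p w \<noteq> \<zero>}"
        by (auto simp: r_def)
      then show ?thesis
        using p finite_subset[of "{w. r k w \<noteq> \<zero>}" "{w. p w \<noteq> \<zero>}"]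
        by (auto simp: ass_grade_def ass_def word_algebra_simps r_def)
    qed
    have sum: "p = r 1 \<oplus>\<^bsub>ass R X\<^esub> r 0 \<oplus>\<^bsub>ass R X\<^esub> r (-1)"
    proof
      fix w
      show "p w = (r 1 \<oplus>\<^bsub>ass R X\<^esub> r 0 \<oplus>\<^bsub>ass R X\<^esub> r (-1)) w"
      proof (cases "p w = \<zero>")
        case True
        then show ?thesis by (simp add: ass_simps(1) r_def)
      next
        case False
        then have "w \<in> alternating_words X"
          using p by (auto simp: ass_def word_algebra_simps)
        then show ?thesis
          using alternating_degree_range[OF X, of w] ass_coeff_closed[OF p, of w]
          by (auto simp: ass_simps(1) r_def)
      qed
    qed
    have unique: "a = r 1 \<and> b = r 0 \<and> c = r (-1)"
      if abc: "a \<in> ass_grade R X 1" "b \<in> ass_grade R X 0" "c \<in> ass_grade R X (-1)"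
        and eq: "p = a \<oplus>\<^bsub>ass R X\<^esub> b \<oplus>\<^bsub>ass R X\<^esub> c" for a b c
    proof -
      have z: "q w = \<zero>" if "q \<in> ass_grade R X k" "word_degree X w \<noteq> k" for q k w
        using that by (auto simp: ass_grade_def)
      have [simp]: "a w \<in> carrier R" "b w \<in> carrier R" "c w \<in> carrier R" for w
        using abc by (auto simp: ass_grade_def intro: ass_coeff_closed)
      have pw: "p w = a w \<oplus> b w \<oplus> c w" for w
        unfolding eq by (simp add: ass_simps(1))
      have "a w = r 1 w" "b w = r 0 w" "c w = r (-1) w" for w
        using z[OF abc(1), of w] z[OF abc(2), of w] z[OF abc(3), of w]
        by (auto simp: r_def pw)
      then show ?thesis by auto
    qed
    show "\<exists>!(a, b, c). a \<in> grade (ass_minus R X) 1 \<and> b \<in> grade (ass_minus R X) 0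
        \<and> c \<in> grade (ass_minus R X) (- 1) \<and> p = a \<oplus>\<^bsub>ass_minus R X\<^esub> b \<oplus>\<^bsub>ass_minus R X\<^esub> c"
      using r sum unique by (intro ex1I[of _ "(r 1, r 0, r (-1))"]) auto
  next
    fix p q i j
    assume pq: "p \<in> grade (ass_minus R X) i" "q \<in> grade (ass_minus R X) j"
    then have "p \<otimes>\<^bsub>ass R X\<^esub> q \<in> ass_grade R X (i + j)" "q \<otimes>\<^bsub>ass R X\<^esub> p \<in> ass_grade R X (i + j)"
      using ass_grade_mult[of p X i q j] ass_grade_mult[of q X j p i] by (simp_all add: add.commute)
    then show "bracket (ass_minus R X) p q \<in> grade (ass_minus R X) (i + j)"
      using A.submoduleE(3,5)[OF ass_grade_submodule] by (simp add: a_minus_def)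
  qed
qed

text \<open>The double commutator \<open>[[x, y], x]\<close> is \<open>2 x y x - y x x - x x y\<close>, and \<open>x x = 0\<close> for reasons of degree.\<close>

lemma special_jordan_pair_in_ass_minus:
  assumes X: "polarized X" and half: "\<one> \<oplus> \<one> \<in> Units R"
  shows "lie_jordan_pair R (ass_minus R X) (special_jordan_pair R X)"
proof (intro lie_jordan_pair.intro lie_jordan_pair_axioms.intro)
  interpret A: associative_algebra R "ass R X"
    by (rule ass_is_associative_algebra)
  fix \<sigma> x y
  assume "x \<in> grade (ass_minus R X) (deg \<sigma>)" "y \<in> grade (ass_minus R X) (- deg \<sigma>)"
  then have x: "x \<in> ass_grade R X (deg \<sigma>)" and [simp]: "x \<in> carrier (ass R X)" "y \<in> carrier (ass R X)"
    by (simp_all add: ass_grade_def)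
  have "deg \<sigma> + deg \<sigma> \<notin> {-1, 0, 1}"
    by (cases \<sigma>) auto
  then have xx: "x \<otimes>\<^bsub>ass R X\<^esub> x = \<zero>\<^bsub>ass R X\<^esub>"
    using ass_grade_mult[OF x x] ass_grade_trivial[OF X] by blast
  have "bracket (ass_minus R X) (bracket (ass_minus R X) x y) x
      = (x \<otimes>\<^bsub>ass R X\<^esub> y \<otimes>\<^bsub>ass R X\<^esub> x \<oplus>\<^bsub>ass R X\<^esub> x \<otimes>\<^bsub>ass R X\<^esub> y \<otimes>\<^bsub>ass R X\<^esub> x)
        \<ominus>\<^bsub>ass R X\<^esub> (y \<otimes>\<^bsub>ass R X\<^esub> (x \<otimes>\<^bsub>ass R X\<^esub> x) \<oplus>\<^bsub>ass R X\<^esub> (x \<otimes>\<^bsub>ass R X\<^esub> x) \<otimes>\<^bsub>ass R X\<^esub> y)"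
    using \<open>x \<in> carrier _\<close> \<open>y \<in> carrier _\<close> unfolding ass_minus_simps by algebra
  also have "\<dots> = x \<otimes>\<^bsub>ass R X\<^esub> y \<otimes>\<^bsub>ass R X\<^esub> x \<oplus>\<^bsub>ass R X\<^esub> x \<otimes>\<^bsub>ass R X\<^esub> y \<otimes>\<^bsub>ass R X\<^esub> x"
    by (simp add: xx A.M.minus_eq)
  finally show "quad (special_jordan_pair R X) \<sigma> x y \<oplus>\<^bsub>ass_minus R X\<^esub> quad (special_jordan_pair R X) \<sigma> x y
      = bracket (ass_minus R X) (bracket (ass_minus R X) x y) x"
    by (simp add: special_jordan_pair_eq[OF X])
qed (simp_all add: special_jordan_pair_eq[OF X] ass_minus_is_three_graded[OF X] half
    special_jordan_pair_is_jordan_pair[OF X, unfolded special_jordan_pair_eq[OF X]])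

lemma monomial_in_ass_grade:
  assumes "w \<in> alternating_words X"
  shows "monomial R w \<in> ass_grade R X (word_degree X w)"
proof -
  have "{u. monomial R w u \<noteq> \<zero>} \<subseteq> {w}"
    by (auto simp: monomial_def)
  then have "finite {u. monomial R w u \<noteq> \<zero>}"
    by (rule finite_subset) simp
  then show ?thesis
    using assms by (auto simp: ass_grade_def ass_def word_algebra_simps monomial_def split: if_splits)
qed

lemma letters_graded_valuation:
  assumes "polarized X"
  shows "graded_valuation X (ass_minus R X) (\<lambda>x. monomial R [x])"
  unfolding graded_valuation_def
proof (intro allI ballI)
  fix \<sigma> x assume x: "x \<in> X \<sigma>"
  then have xX: "x \<in> X Pos \<union> X Neg" by (cases \<sigma>) auto
  then have "letter_sign X x = \<sigma>"
    using letter_sign_iff[OF assms xX] x by simp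
  then show "monomial R [x] \<in> grade (ass_minus R X) (deg \<sigma>)"
    using monomial_in_ass_grade[of "[x]" X] xX by (simp add: singleton_alternating)
qed

end

section \<open>Leading words\<close>

text \<open>The components of an element are unique, so a Lie polynomial that takes the value \<open>0\<close> has components
  of value \<open>0\<close>.\<close>

lemma (in lie_jordan_pair) parts_vanish:
  assumes X: "polarized X" and v: "graded_valuation X L v"
    and t: "t \<in> lie_terms R X" "jordan_parts R X t = (p, Z)" and "lie_eval L v t = \<zero>\<^bsub>L\<^esub>"
  shows "pair_eval V v (p \<sigma>) \<sigma> = \<zero>\<^bsub>side V \<sigma>\<^esub>"
    and "jordan_term_of R X \<sigma> z \<Longrightarrow> pair_eval V v (inner_act R Z \<sigma> z) \<sigma> = \<zero>\<^bsub>side V \<sigma>\<^esub>"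
proof -
  have pZ: "jordan_term_of R X \<sigma> (p \<sigma>)" "inner_term R X Z" for \<sigma>
    using jordan_parts_are_jordan_terms[OF t] by auto
  have "pair_eval V v (p Pos) Pos \<oplus>\<^bsub>L\<^esub> inner_eval v Z \<oplus>\<^bsub>L\<^esub> pair_eval V v (p Neg) Neg
      = \<zero>\<^bsub>L\<^esub> \<oplus>\<^bsub>L\<^esub> \<zero>\<^bsub>L\<^esub> \<oplus>\<^bsub>L\<^esub> \<zero>\<^bsub>L\<^esub>"
    using lie_eval_eq_jordan_parts[OF v X t] assms(5) by (metis M.l_zero M.zero_closed)
  then have "pair_eval V v (p Pos) Pos = \<zero>\<^bsub>L\<^esub> \<and> inner_eval v Z = \<zero>\<^bsub>L\<^esub>
      \<and> pair_eval V v (p Neg) Neg = \<zero>\<^bsub>L\<^esub>"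
    using pair_eval_grade[OF v pZ(1), of Pos] pair_eval_grade[OF v pZ(1), of Neg]
      inner_eval_grade[OF v pZ(2)]
    by (intro grade_components_unique) (simp_all add: grade_zero)
  then show "pair_eval V v (p \<sigma>) \<sigma> = \<zero>\<^bsub>side V \<sigma>\<^esub>"
    and "jordan_term_of R X \<sigma> z \<Longrightarrow> pair_eval V v (inner_act R Z \<sigma> z) \<sigma> = \<zero>\<^bsub>side V \<sigma>\<^esub>"
    using pZ by (cases \<sigma>; simp add: side_zero pair_eval_inner_act[OF v] pair_eval_carrier[OF v])+
qed

context cring
begin

lemma ass_minus_coeff:
  assumes "p \<in> carrier (ass R X)" "q \<in> carrier (ass R X)"
  shows "(p \<ominus>\<^bsub>ass R X\<^esub> q) w = p w \<oplus> \<ominus> q w"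
proof -
  interpret A: associative_algebra R "ass R X"
    by (rule ass_is_associative_algebra)
  have "p \<ominus>\<^bsub>ass R X\<^esub> q = p \<oplus>\<^bsub>ass R X\<^esub> (\<ominus> \<one>) \<odot>\<^bsub>ass R X\<^esub> q"
    using assms by (simp add: A.M.minus_eq A.smult_l_minus)
  then show ?thesis
    using assms by (simp add: ass_simps l_minus ass_coeff_closed)
qed

lemma ass_mult_coeff:
  assumes "p \<in> carrier (ass R X)" "q \<in> carrier (ass R X)"
  shows "(p \<otimes>\<^bsub>ass R X\<^esub> q) w = (if w \<in> alternating_words X then word_conv R p q w else \<zero>)"
  using assms unfolding ass_def by (rule word_algebra_mult)

lemma ass_mult_nonzero:
  assumes "p \<in> carrier (ass R X)" "q \<in> carrier (ass R X)" "(p \<otimes>\<^bsub>ass R X\<^esub> q) w \<noteq> \<zero>"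
  shows "\<exists>u v. w = u @ v \<and> w \<in> alternating_words X \<and> p u \<noteq> \<zero> \<and> q v \<noteq> \<zero>"
  using assms unfolding ass_def by (rule word_algebra_mult_nonzero)

lemma word_conv_append_letter:
  assumes "\<And>u. p u \<in> carrier R"
  shows "word_conv R p (monomial R [z]) (w @ [z]) = p w"
  using assms
proof (induction w arbitrary: p)
  case Nil
  then show ?case by (simp add: monomial_def)
next
  case (Cons x w)
  then show ?case
    using Cons.IH[of "\<lambda>u. p (x # u)"] by (simp add: monomial_def)
qed

text \<open>In \<open>b z - z b\<close> only the first term contributes to the word \<open>w z\<close>, because the words of \<open>z b\<close> begin with
  \<open>z\<close> but \<open>w\<close> does not.\<close>

lemma append_letter_coeff:
  assumes b: "b \<in> carrier (ass R X)"
    and wz: "w @ [z] \<in> alternating_words X" and z: "z \<notin> set w" and w: "w \<noteq> []"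
  shows "bracket (ass_minus R X) b (monomial R [z]) (w @ [z]) = b w"
proof -
  interpret A: associative_algebra R "ass R X"
    by (rule ass_is_associative_algebra)
  have m: "monomial R [z] \<in> carrier (ass R X)"
    using monomial_in_ass_grade[of "[z]" X] alternating_factors(2)[OF wz] by (simp add: ass_grade_def)
  have "(monomial R [z] \<otimes>\<^bsub>ass R X\<^esub> b) (w @ [z]) = \<zero>"
  proof (rule ccontr)
    assume "\<not> ?thesis"
    then obtain u v where "w @ [z] = u @ v" "monomial R [z] u \<noteq> \<zero>"
      using ass_mult_nonzero[OF m b] by blast
    then have "hd (w @ [z]) = z"
      by (auto simp: monomial_def split: if_splits)
    then show False using z w by (cases w) auto
  qed
  moreover have "(b \<otimes>\<^bsub>ass R X\<^esub> monomial R [z]) (w @ [z]) = b w"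
    using wz ass_coeff_closed[OF b] by (simp add: ass_mult_coeff[OF b m] word_conv_append_letter)
  ultimately show ?thesis
    using m b ass_coeff_closed[OF b] by (simp add: ass_minus_coeff)
qed

lemma bracket_letter_length:
  assumes b: "b \<in> carrier (ass R X)" and z: "[z] \<in> alternating_words X"
    and len: "\<And>v. b v \<noteq> \<zero> \<Longrightarrow> length v \<le> n"
    and nz: "bracket (ass_minus R X) b (monomial R [z]) v \<noteq> \<zero>"
  shows "length v \<le> Suc n"
proof -
  interpret A: associative_algebra R "ass R X"
    by (rule ass_is_associative_algebra)
  have m: "monomial R [z] \<in> carrier (ass R X)"
    using monomial_in_ass_grade[OF z] by (simp add: ass_grade_def)
  have "(b \<otimes>\<^bsub>ass R X\<^esub> monomial R [z]) v \<noteq> \<zero> \<or> (monomial R [z] \<otimes>\<^bsub>ass R X\<^esub> b) v \<noteq> \<zero>"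
    using nz m b by (auto simp: ass_minus_coeff)
  then obtain u u' where "v = u @ u'"
    "b u \<noteq> \<zero> \<and> monomial R [z] u' \<noteq> \<zero> \<or> monomial R [z] u \<noteq> \<zero> \<and> b u' \<noteq> \<zero>"
    using ass_mult_nonzero[OF b m] ass_mult_nonzero[OF m b] by blast
  then show ?thesis
    using len[of u] len[of u'] by (auto simp: monomial_def split: if_splits)
qed

text \<open>Here \<open>q\<close> is the image of a Lie polynomial in the algebra of alternating words, and \<open>z\<close> provides for each sign a
  variable that does not occur in the leading word.\<close>

lemma leading_word_to_jordan:
  assumes X: "polarized X" and half: "\<one> \<oplus> \<one> \<in> Units R" and "\<one> \<noteq> \<zero>"
    and t: "t \<in> lie_terms R X" "jordan_parts R X t = (p, Z)"
    and q_def: "q = lie_eval (ass_minus R X) (\<lambda>x. monomial R [x]) t"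
    and lead: "q w = \<one>" "\<And>v. q v \<noteq> \<zero> \<Longrightarrow> length v \<le> length w"
    and z: "\<And>\<sigma>. z \<sigma> \<in> X \<sigma>" "\<And>\<sigma>. z \<sigma> \<notin> set w"
  shows "\<exists>\<sigma>. \<exists>g\<in>{p \<sigma>, inner_act R Z \<sigma> (JVar (z \<sigma>))}.
    monic_leading_term R (pair_eval (special_jordan_pair R X) (\<lambda>x. monomial R [x]) g \<sigma>)"
proof -
  let ?v = "\<lambda>x. monomial R [x]" and ?V = "special_jordan_pair R X"
  interpret S: lie_jordan_pair R "ass_minus R X" ?V
    by (rule special_jordan_pair_in_ass_minus[OF X half])
  note v = letters_graded_valuation[OF X]
  have pZ: "jordan_term_of R X \<sigma> (p \<sigma>)" "inner_term R X Z" for \<sigma>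
    using jordan_parts_are_jordan_terms[OF t] by auto
  define b where "b = S.inner_eval ?v Z"
  have odd: "pair_eval ?V ?v (p \<sigma>) \<sigma> \<in> ass_grade R X (deg \<sigma>)" for \<sigma>
    using S.pair_eval_grade[OF v pZ(1)] by simp
  have even: "b \<in> ass_grade R X 0"
    using S.inner_eval_grade[OF v pZ(2)] by (simp add: b_def)
  have coeff [simp]: "pair_eval ?V ?v (p \<sigma>) \<sigma> u \<in> carrier R" "b u \<in> carrier R" for \<sigma> u
    using odd[of \<sigma>] even by (auto simp: ass_grade_def intro: ass_coeff_closed)
  have "q = pair_eval ?V ?v (p Pos) Pos \<oplus>\<^bsub>ass R X\<^esub> b \<oplus>\<^bsub>ass R X\<^esub> pair_eval ?V ?v (p Neg) Neg"
    using S.lie_eval_eq_jordan_parts[OF v X t] by (simp add: q_def b_def)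
  then have q: "q u = pair_eval ?V ?v (p Pos) Pos u \<oplus> b u \<oplus> pair_eval ?V ?v (p Neg) Neg u" for u
    by (simp add: ass_simps(1))
  have vanish: "r u = \<zero>" if "r \<in> ass_grade R X k" "word_degree X u \<noteq> k" for r k u
    using that by (auto simp: ass_grade_def)
  have odd_q: "pair_eval ?V ?v (p \<sigma>) \<sigma> u = (if word_degree X u = deg \<sigma> then q u else \<zero>)" for u \<sigma>
    using vanish[OF odd[of Pos], of u] vanish[OF odd[of Neg], of u] vanish[OF even, of u] q[of u]
    by (cases \<sigma>) auto
  have even_q: "b u = (if word_degree X u = 0 then q u else \<zero>)" for u
    using vanish[OF odd[of Pos], of u] vanish[OF odd[of Neg], of u] vanish[OF even, of u] q[of u]
    by auto
  have w: "w \<in> alternating_words X"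
  proof (rule ccontr)
    assume "w \<notin> alternating_words X"
    then have off: "r w = \<zero>" if "r \<in> ass_grade R X k" for r k
      using that by (auto simp: ass_grade_def ass_def word_algebra_simps)
    have "q w = \<zero>"
      using q[of w] off[OF odd[of Pos]] off[OF odd[of Neg]] off[OF even] by simp
    then show False using lead(1) \<open>\<one> \<noteq> \<zero>\<close> by simp
  qed
  show ?thesis
  proof (cases "word_degree X w = 0")
    case False
    then obtain \<sigma> where \<sigma>: "word_degree X w = deg \<sigma>"
      using alternating_degree_range[OF X w] by (metis deg.simps insert_iff singletonD)
    have "monic_leading_term R (pair_eval ?V ?v (p \<sigma>) \<sigma>)"
      unfolding monic_leading_term_def using lead \<sigma>
      by (intro exI[of _ w]) (auto simp: odd_q)
    then show ?thesis by blast
  next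
    case True
    \<comment> \<open>The leading word has to have a last letter: \<open>b\<close> is a sum of commutators of elements in which
      all words have odd length, so it has no constant term.\<close>
    have "b [] = \<zero>"
    proof -
      have "S.inner_eval ?v Z [] = \<zero>" if "inner_term R X Z" for Z
        using that
      proof (induction Z)
        case Nil
        show ?case by (simp add: ass_simps)
      next
        case (Cons e Z)
        obtain c d where e: "e = (c, d)" by (cases e)
        have cd: "pair_eval ?V ?v c Pos \<in> ass_grade R X 1" "pair_eval ?V ?v d Neg \<in> ass_grade R X (- 1)"
          using Cons.prems S.pair_eval_grade[OF v, of Pos c] S.pair_eval_grade[OF v, of Neg d]
          by (simp_all add: e)
        then have cd': "pair_eval ?V ?v c Pos \<in> carrier (ass R X)"
          "pair_eval ?V ?v d Neg \<in> carrier (ass R X)"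
          by (simp_all add: ass_grade_def)
        interpret A: associative_algebra R "ass R X"
          by (rule ass_is_associative_algebra)
        show ?case
          using Cons vanish[OF cd(1), of "[]"] vanish[OF cd(2), of "[]"] cd'
          by (simp add: e ass_simps(1) ass_minus_coeff ass_mult_coeff)
      qed
      from this[OF pZ(2)] show ?thesis by (simp add: b_def)
    qed
    moreover have bw: "b w = \<one>"
      using even_q[of w] True lead(1) by simp
    ultimately have "w \<noteq> []"
      using \<open>\<one> \<noteq> \<zero>\<close> by auto
    define \<sigma> where "\<sigma> = opp (letter_sign X (last w))"
    have zX: "z \<sigma> \<in> X Pos \<union> X Neg"
      using z(1)[of \<sigma>] by (cases \<sigma>) auto
    then have "letter_sign X (z \<sigma>) = \<sigma>"
      using letter_sign_iff[OF X zX] z(1) by blast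
    moreover have "letter_sign X (last w) \<noteq> \<sigma>"
      unfolding \<sigma>_def by (cases "letter_sign X (last w)") auto
    ultimately have wz: "w @ [z \<sigma>] \<in> alternating_words X"
      using alternating_append_iff[OF X \<open>w \<noteq> []\<close>, of "[z \<sigma>]"] w zX
      by (simp add: singleton_alternating)
    have bc: "b \<in> carrier (ass R X)"
      using even by (simp add: ass_grade_def)
    have zt: "jordan_term_of R X \<sigma> (JVar (z \<sigma>))"
      using z(1) by (rule jordan_term_of.intros)
    have g: "pair_eval ?V ?v (inner_act R Z \<sigma> (JVar (z \<sigma>))) \<sigma>
        = bracket (ass_minus R X) b (monomial R [z \<sigma>])"
      using S.pair_eval_inner_act[OF v pZ(2) zt] by (simp only: b_def pair_eval.simps)
    have "monic_leading_term R (bracket (ass_minus R X) b (monomial R [z \<sigma>]))"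
      unfolding monic_leading_term_def
    proof (intro exI[of _ "w @ [z \<sigma>]"] conjI allI impI)
      show "bracket (ass_minus R X) b (monomial R [z \<sigma>]) (w @ [z \<sigma>]) = \<one>"
        using append_letter_coeff[OF bc wz z(2) \<open>w \<noteq> []\<close>] bw by simp
      fix u assume nz: "bracket (ass_minus R X) b (monomial R [z \<sigma>]) u \<noteq> \<zero>"
      have "length u' \<le> length w" if "b u' \<noteq> \<zero>" for u'
        using that lead(2)[of u'] even_q[of u'] by (auto split: if_splits)
      from bracket_letter_length[OF bc alternating_factors(2)[OF wz] this nz]
      show "length u \<le> length (w @ [z \<sigma>])" by simp
    qed
    then show ?thesis using g by (metis insertCI)
  qed
qed

end

section \<open>Renaming variables\<close>

lemma lie_eval_cong:
  "(\<And>x. x \<in> set2_lie_term t \<Longrightarrow> v x = v' x) \<Longrightarrow> lie_eval L v t = lie_eval L v' t"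
  by (induction t) auto

lemma lie_eval_rename: "lie_eval L v (map_lie_term id \<rho> t) = lie_eval L (v \<circ> \<rho>) t"
  by (induction t) auto

lemma finite_lie_term_vars: "finite (set2_lie_term t)"
  by (induction t) auto

lemma lie_term_vars: "t \<in> lie_terms R X \<Longrightarrow> set2_lie_term t \<subseteq> X Pos \<union> X Neg"
proof (induction rule: lie_terms.induct)
  case (1 x \<sigma>)
  then show ?case by (cases \<sigma>) auto
qed auto

lemma rename_lie_terms:
  assumes "t \<in> lie_terms R X"
    and "\<And>\<sigma> x. x \<in> set2_lie_term t \<Longrightarrow> x \<in> X \<sigma> \<Longrightarrow> \<rho> x \<in> Y \<sigma>"
  shows "map_lie_term id \<rho> t \<in> lie_terms R Y"
  using assms by (induction rule: lie_terms.induct) (auto intro: lie_terms.intros)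

context cring
begin

text \<open>For \<open>\<rho>\<close> injective on \<open>T\<close>: \<open>q\<close> is \<open>p\<close> with its variables renamed. As a relation between coefficients it
  needs no choice of values of \<open>\<rho>\<close> outside \<open>T\<close>, and the coefficients of \<open>q\<close> are read off directly.\<close>

definition renames ::
    "(sign \<Rightarrow> 'x set) \<Rightarrow> (sign \<Rightarrow> 'y set) \<Rightarrow> 'x set \<Rightarrow> ('x \<Rightarrow> 'y)
      \<Rightarrow> ('x list \<Rightarrow> 'a) \<Rightarrow> ('y list \<Rightarrow> 'a) \<Rightarrow> bool"
  where "renames X Y T \<rho> p q \<longleftrightarrow> p \<in> carrier (ass R X) \<and> q \<in> carrier (ass R Y) \<and>
    (\<forall>u\<in>lists T. q (map \<rho> u) = p u) \<and> (\<forall>u. p u \<noteq> \<zero> \<longrightarrow> u \<in> lists T) \<and>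
    (\<forall>v. q v \<noteq> \<zero> \<longrightarrow> v \<in> map \<rho> ` lists T)"

context
  fixes X :: "sign \<Rightarrow> 'x set" and Y :: "sign \<Rightarrow> 'y set" and T :: "'x set" and \<rho> :: "'x \<Rightarrow> 'y"
  assumes T: "T \<subseteq> X Pos \<union> X Neg" and inj: "inj_on \<rho> T"
    and signs: "\<And>\<sigma> x. x \<in> T \<Longrightarrow> \<rho> x \<in> Y \<sigma> \<longleftrightarrow> x \<in> X \<sigma>"
begin

lemma alternating_rename:
  assumes "u \<in> lists T"
  shows "map \<rho> u \<in> alternating_words Y \<longleftrightarrow> u \<in> alternating_words X"
proof -
  have "\<rho> (u ! i) \<in> Y \<sigma> \<longleftrightarrow> u ! i \<in> X \<sigma>" if "i < length u" for i \<sigma>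
    using assms that by (intro signs) (auto simp: lists_eq_set)
  moreover have "\<rho> x \<in> Y Pos \<union> Y Neg" "x \<in> X Pos \<union> X Neg" if "x \<in> set u" for x
    using assms that T signs[of x] by (auto simp: lists_eq_set)
  ultimately show ?thesis
    unfolding alternating_words_def by auto
qed

lemma word_conv_rename:
  assumes "\<And>u. u \<in> lists T \<Longrightarrow> q (map \<rho> u) = p u" "\<And>u. u \<in> lists T \<Longrightarrow> q' (map \<rho> u) = p' u"
    and "u \<in> lists T"
  shows "word_conv R q q' (map \<rho> u) = word_conv R p p' u"
  using assms
proof (induction u arbitrary: p q)
  case Nil
  then show ?case using Nil(1)[of "[]"] Nil(2)[of "[]"] by simp
next
  case (Cons x u)
  have "word_conv R (\<lambda>u. q (\<rho> x # u)) q' (map \<rho> u) = word_conv R (\<lambda>u. p (x # u)) p' u"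
    using Cons.prems(1)[of "x # _"] Cons.prems(2,3) by (intro Cons.IH) auto
  then show ?case
    using Cons.prems(1)[of "[]"] Cons.prems(2)[of "x # u"] Cons.prems(3) by simp
qed

lemma renames_add:
  assumes "renames X Y T \<rho> p q" "renames X Y T \<rho> p' q'"
  shows "renames X Y T \<rho> (p \<oplus>\<^bsub>ass R X\<^esub> p') (q \<oplus>\<^bsub>ass R Y\<^esub> q')"
proof -
  interpret A: associative_algebra R "ass R X" by (rule ass_is_associative_algebra)
  interpret B: associative_algebra R "ass R Y" by (rule ass_is_associative_algebra)
  have "p u \<noteq> \<zero> \<or> p' u \<noteq> \<zero>" if "p u \<oplus> p' u \<noteq> \<zero>" for u
    using that by auto
  moreover have "q u \<noteq> \<zero> \<or> q' u \<noteq> \<zero>" if "q u \<oplus> q' u \<noteq> \<zero>" for u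
    using that by auto
  moreover have "p \<oplus>\<^bsub>ass R X\<^esub> p' \<in> carrier (ass R X)" "q \<oplus>\<^bsub>ass R Y\<^esub> q' \<in> carrier (ass R Y)"
    using assms by (auto simp: renames_def)
  ultimately show ?thesis
    using assms unfolding renames_def by (simp add: ass_simps(1)) blast
qed

lemma renames_smult:
  assumes "c \<in> carrier R" "renames X Y T \<rho> p q"
  shows "renames X Y T \<rho> (c \<odot>\<^bsub>ass R X\<^esub> p) (c \<odot>\<^bsub>ass R Y\<^esub> q)"
proof -
  interpret A: associative_algebra R "ass R X" by (rule ass_is_associative_algebra)
  interpret B: associative_algebra R "ass R Y" by (rule ass_is_associative_algebra)
  have "p u \<noteq> \<zero>" if "c \<otimes> p u \<noteq> \<zero>" for u
    using that assms(1) by auto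
  moreover have "q u \<noteq> \<zero>" if "c \<otimes> q u \<noteq> \<zero>" for u
    using that assms(1) by auto
  moreover have "c \<odot>\<^bsub>ass R X\<^esub> p \<in> carrier (ass R X)" "c \<odot>\<^bsub>ass R Y\<^esub> q \<in> carrier (ass R Y)"
    using assms by (auto simp: renames_def)
  ultimately show ?thesis
    using assms unfolding renames_def by (simp add: ass_simps(3))
qed

lemma renames_mult:
  assumes pq: "renames X Y T \<rho> p q" and pq': "renames X Y T \<rho> p' q'"
  shows "renames X Y T \<rho> (p \<otimes>\<^bsub>ass R X\<^esub> p') (q \<otimes>\<^bsub>ass R Y\<^esub> q')"
proof -
  interpret A: associative_algebra R "ass R X" by (rule ass_is_associative_algebra)
  interpret B: associative_algebra R "ass R Y" by (rule ass_is_associative_algebra)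
  have c: "p \<in> carrier (ass R X)" "p' \<in> carrier (ass R X)"
    "q \<in> carrier (ass R Y)" "q' \<in> carrier (ass R Y)"
    using assms by (auto simp: renames_def)
  show ?thesis
    unfolding renames_def
  proof (intro conjI ballI allI impI)
    fix u assume "u \<in> lists T"
    then show "(q \<otimes>\<^bsub>ass R Y\<^esub> q') (map \<rho> u) = (p \<otimes>\<^bsub>ass R X\<^esub> p') u"
      using pq pq' word_conv_rename[of q p q' p' u]
      by (simp add: ass_mult_coeff c alternating_rename renames_def)
  next
    fix u assume "(p \<otimes>\<^bsub>ass R X\<^esub> p') u \<noteq> \<zero>"
    then obtain u1 u2 where "u = u1 @ u2" "p u1 \<noteq> \<zero>" "p' u2 \<noteq> \<zero>"
      using ass_mult_nonzero[OF c(1,2)] by blast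
    then show "u \<in> lists T"
      using pq pq' by (simp add: renames_def)
  next
    fix v assume "(q \<otimes>\<^bsub>ass R Y\<^esub> q') v \<noteq> \<zero>"
    then obtain v1 v2 where v: "v = v1 @ v2" "q v1 \<noteq> \<zero>" "q' v2 \<noteq> \<zero>"
      using ass_mult_nonzero[OF c(3,4)] by blast
    then obtain u1 u2 where "u1 \<in> lists T" "v1 = map \<rho> u1" "u2 \<in> lists T" "v2 = map \<rho> u2"
      using pq pq' unfolding renames_def by (meson imageE)
    then have "u1 @ u2 \<in> lists T" "v = map \<rho> (u1 @ u2)"
      using v by auto
    then show "v \<in> map \<rho> ` lists T" by blast
  qed (simp_all add: c)
qed

text \<open>The relation is compatible with all operations, and hence with the values of Lie expressions. For
  products this uses that \<open>\<rho>\<close> preserves signs, so that a word is alternating if and only if its image is.\<close>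

lemma renames_lie_eval:
  assumes "t \<in> lie_terms R X" "set2_lie_term t \<subseteq> T"
  shows "renames X Y T \<rho> (lie_eval (ass_minus R X) (\<lambda>x. monomial R [x]) t)
    (lie_eval (ass_minus R Y) (\<lambda>y. monomial R [\<rho> y]) t)"
proof -
  interpret A: associative_algebra R "ass R X" by (rule ass_is_associative_algebra)
  interpret B: associative_algebra R "ass R Y" by (rule ass_is_associative_algebra)
  show ?thesis
    using assms
  proof (induction rule: lie_terms.induct)
    case (1 x \<sigma>)
    then have x: "x \<in> T" by simp
    then have "\<rho> x \<in> Y Pos \<union> Y Neg" "x \<in> X Pos \<union> X Neg"
      using T signs[OF x] by auto
    then have "monomial R [x] \<in> carrier (ass R X)" "monomial R [\<rho> x] \<in> carrier (ass R Y)"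
      using monomial_in_ass_grade[of "[x]" X] monomial_in_ass_grade[of "[\<rho> x]" Y]
      by (simp_all add: singleton_alternating ass_grade_def)
    moreover have "map \<rho> u = [\<rho> x] \<longleftrightarrow> u = [x]" if "u \<in> lists T" for u
      using that x inj by (auto simp: inj_on_def)
    moreover have "[\<rho> x] \<in> map \<rho> ` lists T"
      using x by (intro image_eqI[of _ _ "[x]"]) auto
    ultimately have "renames X Y T \<rho> (monomial R [x]) (monomial R [\<rho> x])"
      unfolding renames_def using x
      by (intro conjI; (assumption | auto simp: monomial_def)?)
    then show ?case by simp
  next
    case 2
    show ?case by (auto simp: renames_def ass_simps(2)[symmetric]) (simp_all add: ass_simps(2))
  next
    case (3 s t)
    then show ?case by (simp add: renames_add)
  next
    case (4 c t)
    then show ?case by (simp add: renames_smult)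
  next
    case (5 s t)
    have minus: "renames X Y T \<rho> (p \<ominus>\<^bsub>ass R X\<^esub> p') (q \<ominus>\<^bsub>ass R Y\<^esub> q')"
      if "renames X Y T \<rho> p q" "renames X Y T \<rho> p' q'" for p p' q q'
    proof -
      have "p' \<in> carrier (ass R X)" "q' \<in> carrier (ass R Y)"
        using that by (simp_all add: renames_def)
      then have "p \<ominus>\<^bsub>ass R X\<^esub> p' = p \<oplus>\<^bsub>ass R X\<^esub> (\<ominus> \<one>) \<odot>\<^bsub>ass R X\<^esub> p'"
        "q \<ominus>\<^bsub>ass R Y\<^esub> q' = q \<oplus>\<^bsub>ass R Y\<^esub> (\<ominus> \<one>) \<odot>\<^bsub>ass R Y\<^esub> q'"
        by (simp_all add: A.M.minus_eq B.M.minus_eq A.smult_l_minus B.smult_l_minus)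
      then show ?thesis
        using that by (simp add: renames_add renames_smult)
    qed
    show ?case
      using 5 by (simp add: minus renames_mult)
  qed
qed

end

end

section \<open>Essential identities\<close>

theorem theorem5p8:
  fixes R (structure) and L (structure)
  assumes "cring R" and "\<one> \<oplus> \<one> \<in> Units R"
    and "jordan_3_graded_lie_algebra R L"
    and "satisfies_essential_3_graded_identity TYPE('x) R L"
  shows "satisfies_essential_jordan_identity TYPE(nat) R (lie_pair R L)"
proof -
  interpret R: cring R by fact
  interpret L: jordan_3_graded_lie_algebra R L by fact
  interpret LV: lie_jordan_pair R L "lie_pair R L"
    by (rule L.lie_pair_in_lie)
  obtain X :: "sign \<Rightarrow> 'x set" and t \<pi>
    where X: "polarized X" and t: "t \<in> lie_terms R X"
      and \<pi>: "\<pi> \<in> lie_pi_maps R X" "\<pi> (lie_class R X t) \<noteq> \<zero>\<^bsub>ass R X\<^esub>"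
        "monic_leading_term R (\<pi> (lie_class R X t))"
      and ident: "three_graded_identity R X L (lie_class R X t)"
    using assms(4)
    unfolding satisfies_essential_3_graded_identity_def essential_lie_def carrier_free_lie by blast
  define T where "T = set2_lie_term t"
  obtain n \<rho> where \<rho>: "\<rho> ` T = {i. i < (n :: nat)}" "inj_on \<rho> T"
    using finite_imp_inj_to_nat_seg[OF finite_lie_term_vars[of t]] unfolding T_def by metis
  have TX: "T \<subseteq> X Pos \<union> X Neg"
    using lie_term_vars[OF t] by (simp add: T_def)
  \<comment> \<open>One new variable of each sign, outside the range \<open>{0..<n}\<close> of the renaming.\<close>
  define z where "z \<sigma> = (if \<sigma> = Pos then n else Suc n)" for \<sigma>
  define Y where "Y \<sigma> = insert (z \<sigma>) (\<rho> ` (T \<inter> X \<sigma>))" for \<sigma>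
  have \<rho>n: "\<rho> x < n" if "x \<in> T" for x
    using \<rho>(1) that by blast
  have signs: "\<rho> x \<in> Y \<sigma> \<longleftrightarrow> x \<in> X \<sigma>" if "x \<in> T" for x \<sigma>
    using \<rho>n[OF that] \<rho>(2) that by (auto simp: Y_def z_def inj_on_def split: if_splits)
  have Y: "polarized Y"
    using X \<rho>(2) \<rho>n by (auto simp: polarized_def Y_def z_def inj_on_def) (fastforce dest: \<rho>n)+
  define t' where "t' = map_lie_term id \<rho> t"
  have t': "t' \<in> lie_terms R Y"
    unfolding t'_def by (rule rename_lie_terms[OF t]) (simp add: signs T_def[symmetric])
  obtain p Z where parts: "jordan_parts R Y t' = (p, Z)"
    by (metis surj_pair)

  have eval_\<pi>: "\<pi> (lie_class R X t) = lie_eval (ass_minus R X) (\<lambda>x. monomial R [x]) t"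
  proof -
    interpret AX: lie_algebra R "ass_minus R X" by (rule R.ass_minus_is_lie_algebra)
    have hom: "\<pi> \<in> graded_lie_homs R (free_lie R X) (ass_minus R X)"
      and var: "\<And>\<sigma> x. x \<in> X \<sigma> \<Longrightarrow> \<pi> (lie_class R X (LVar x)) = monomial R [x]"
      using \<pi>(1) by (auto simp: lie_pi_maps_def)
    have "\<pi> (lie_class R X t) = lie_eval (ass_minus R X) (\<lambda>x. \<pi> (lie_class R X (LVar x))) t"
      by (rule graded_lie_hom_eval[OF AX.module_axioms hom t])
    also have "\<dots> = lie_eval (ass_minus R X) (\<lambda>x. monomial R [x]) t"
      using TX var by (intro lie_eval_cong) (auto simp: T_def)
    finally show ?thesis .
  qed
  define q where "q = lie_eval (ass_minus R Y) (\<lambda>x. monomial R [x]) t'"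
  have ren: "R.renames X Y T \<rho> (\<pi> (lie_class R X t)) q"
    unfolding eval_\<pi> q_def t'_def lie_eval_rename comp_def
    by (rule R.renames_lie_eval[OF TX \<rho>(2) signs t]) (simp_all add: T_def)
  obtain w where w: "\<pi> (lie_class R X t) w = \<one>"
    "\<And>v. \<pi> (lie_class R X t) v \<noteq> \<zero> \<Longrightarrow> length v \<le> length w"
    using \<pi>(3) unfolding monic_leading_term_def by blast
  \<comment> \<open>Over the zero ring every polynomial is zero, so an essential one cannot exist.\<close>
  have nontrivial: "\<one> \<noteq> \<zero>"
  proof
    assume "\<one> = \<zero>"
    have "\<pi> (lie_class R X t) u = \<zero>" for u
    proof -
      have "\<pi> (lie_class R X t) u \<in> carrier R"
        using ren R.ass_coeff_closed unfolding R.renames_def by blast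
      then show ?thesis
        using R.r_one R.r_null \<open>\<one> = \<zero>\<close> by metis
    qed
    then show False
      using \<pi>(2) by (simp add: R.ass_simps fun_eq_iff)
  qed
  note ren' = ren[unfolded R.renames_def]
  have wT: "w \<in> lists T"
    using ren' w(1) nontrivial by auto
  obtain \<sigma> g where g: "g \<in> {p \<sigma>, inner_act R Z \<sigma> (JVar (z \<sigma>))}"
    and monic: "monic_leading_term R
      (pair_eval (special_jordan_pair R Y) (\<lambda>x. monomial R [x]) g \<sigma>)"
  proof -
    have "q (map \<rho> w) = \<one>"
      using ren' wT w(1) by simp
    moreover have "length v \<le> length (map \<rho> w)" if qv: "q v \<noteq> \<zero>" for v
    proof -
      obtain u where "u \<in> lists T" "v = map \<rho> u"
        using ren' qv by blast
      then show ?thesis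
        using ren' qv w(2)[of u] by simp
    qed
    moreover have "z \<sigma> \<notin> set (map \<rho> w)" for \<sigma>
    proof -
      have "y < n" if "y \<in> set (map \<rho> w)" for y
        using wT \<rho>n that by (auto simp: lists_eq_set)
      from this[of "z \<sigma>"] show ?thesis by (auto simp: z_def split: if_splits)
    qed
    moreover have "z \<sigma> \<in> Y \<sigma>" for \<sigma>
      by (simp add: Y_def)
    ultimately have "\<exists>\<sigma>. \<exists>g\<in>{p \<sigma>, inner_act R Z \<sigma> (JVar (z \<sigma>))}. monic_leading_term R
        (pair_eval (special_jordan_pair R Y) (\<lambda>x. monomial R [x]) g \<sigma>)"
      by (intro R.leading_word_to_jordan[OF Y assms(2) nontrivial t' parts q_def]) auto
    then show thesis using that by blast
  qed
  have pZ: "jordan_term_of R Y \<sigma> (p \<sigma>)" "inner_term R Y Z"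
    using R.jordan_parts_are_jordan_terms[OF t' parts] by auto
  have zt: "jordan_term_of R Y \<sigma> (JVar (z \<sigma>))"
    by (rule jordan_term_of.intros) (simp add: Y_def)
  have g_term: "jordan_term_of R Y \<sigma> g"
    using g pZ R.jordan_term_of_inner_act[OF pZ(2) zt] by auto

  have "essential_jordan R Y \<sigma> (jordan_class R Y \<sigma> g)"
  proof -
    interpret S: lie_jordan_pair R "ass_minus R Y" "special_jordan_pair R Y"
      by (rule R.special_jordan_pair_in_ass_minus[OF Y assms(2)])
    have "pair_valuation Y (special_jordan_pair R Y) (\<lambda>x. monomial R [x])"
      using R.letters_graded_valuation[OF Y] by (simp add: S.pair_valuation_iff)
    from S.V.free_jordan_pair_universal[OF this]
    obtain h where h: "h \<in> pair_homs R (free_jordan_pair R Y) (special_jordan_pair R Y)"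
      and eval: "\<And>\<tau> s. jordan_term_of R Y \<tau> s \<Longrightarrow>
        h \<tau> (jordan_class R Y \<tau> s) = pair_eval (special_jordan_pair R Y) (\<lambda>x. monomial R [x]) s \<tau>"
      by blast
    have "h \<in> jordan_pi_maps R Y"
      using h eval by (auto simp: jordan_pi_maps_def jordan_term_of.intros)
    moreover have "h \<sigma> (jordan_class R Y \<sigma> g) \<noteq> \<zero>\<^bsub>ass R Y\<^esub>"
      using monic nontrivial unfolding eval[OF g_term] monic_leading_term_def R.ass_simps(2)
      by (metis (no_types))
    ultimately show ?thesis
      unfolding essential_jordan_def using monic eval[OF g_term] by (intro bexI[of _ h]) simp_all
  qed
  moreover have "jordan_identity R Y (lie_pair R L) \<sigma> (jordan_class R Y \<sigma> g)"
    unfolding jordan_identity_def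
  proof
    fix h assume h: "h \<in> pair_homs R (free_jordan_pair R Y) (lie_pair R L)"
    define v where "v y = h (letter_sign Y y) (jordan_class R Y (letter_sign Y y) (JVar y))" for y
    have v: "v y = h \<tau> (jordan_class R Y \<tau> (JVar y))" if "y \<in> Y \<tau>" for y \<tau>
    proof -
      have "y \<in> Y Pos \<union> Y Neg"
        using that by (cases \<tau>) auto
      then have "letter_sign Y y = \<tau>"
        using letter_sign_iff[OF Y] that by blast
      then show ?thesis by (simp add: v_def)
    qed
    have valY: "graded_valuation Y L v"
      unfolding LV.pair_valuation_iff[symmetric] pair_valuation_def
    proof (intro allI ballI)
      fix \<tau> y assume y: "y \<in> Y \<tau>"
      then have "jordan_class R Y \<tau> (JVar y) \<in> carrier (side (free_jordan_pair R Y) \<tau>)"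
        by (auto simp: carrier_free_jordan_pair intro: jordan_term_of.intros)
      moreover have "h \<tau> \<in> linear_maps R (side (free_jordan_pair R Y) \<tau>) (side (lie_pair R L) \<tau>)"
        using h by (simp add: pair_homs_def)
      ultimately show "v y \<in> carrier (side (lie_pair R L) \<tau>)"
        unfolding v[OF y] by (rule linear_mapsD(1)[rotated])
    qed
    \<comment> \<open>The valuation of the original variables; those that do not occur in \<open>t\<close> may be sent anywhere,
      and \<open>\<zero>\<close> lies in every component.\<close>
    define u where "u x = (if x \<in> T then v (\<rho> x) else \<zero>\<^bsub>L\<^esub>)" for x
    have valX: "graded_valuation X L u"
      using valY signs by (auto simp: graded_valuation_def u_def L.grade_zero)
    obtain k where k: "k \<in> graded_lie_homs R (free_lie R X) L"
      "\<And>s. s \<in> lie_terms R X \<Longrightarrow> k (lie_class R X s) = lie_eval L u s"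
      using L.free_lie_universal[OF valX] by blast
    have "lie_eval L v t' = lie_eval L u t"
      unfolding t'_def lie_eval_rename by (rule lie_eval_cong) (simp add: u_def T_def)
    also have "\<dots> = \<zero>\<^bsub>L\<^esub>"
      using ident k t unfolding three_graded_identity_def by metis
    finally have "lie_eval L v t' = \<zero>\<^bsub>L\<^esub>" .
    from LV.parts_vanish[OF Y valY t' parts this] g zt
    have "pair_eval (lie_pair R L) v g \<sigma> = \<zero>\<^bsub>side (lie_pair R L) \<sigma>\<^esub>"
      by blast
    then show "h \<sigma> (jordan_class R Y \<sigma> g) = \<zero>\<^bsub>side (lie_pair R L) \<sigma>\<^esub>"
      using LV.V.pair_hom_eval[OF h v g_term] by simp
  qed
  moreover have "jordan_class R Y \<sigma> g \<in> carrier (side (free_jordan_pair R Y) \<sigma>)"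
    using g_term by (simp add: carrier_free_jordan_pair)
  ultimately show ?thesis
    unfolding satisfies_essential_jordan_identity_def using Y by blast
qed

end
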